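(* Suppose $\max\{\omega\|u\|_1,\sqrt{\omega}\|u\|_2\}<2\pi/C$, so that $\mu(x,y;z)$ is the unique solution to $$(-\partial_y+\partial_x^2+2iz\,\partial_x)\mu+u\mu=0,\qquad \mu\in L^\infty(E),\qquad \lim_{|y|\to\infty}\mu(x,y;z)=1.$$ If in addition $y\,u(x,y)\in L^1(\Omega)$ and $u_x,u_y\in L^1(\Omega)\cap L^2(\Omega)$, then $\mu$ has pointwise one-sided limits (from the left and from the right, in the variable $z$) at the lines $\mathrm{Re}\,z=\frac{\omega}{2}n$, $n\in\mathbb{Z}^*$, and $$\lim_{\substack{|\mathrm{Im}\,z|\to\infty\\ \mathrm{Re}\,z=\text{const.}}}\mu(x,y;z)=1.$$
   Context: Fix $\ell>0$ and put $\omega=\pi/\ell$. $\Omega=[-\ell,\ell]\times\mathbb{R}$; functions on $\Omega$ are complex-valued and regarded as $2\ell$-periodic in $x$; $\|\cdot\|_p$ is the norm of $L^p(\Omega)$. $\mathbb{Z}^*=\mathbb{Z}\setminus\{0\}$, $\mathbb{C}_\omega=\{z\in\mathbb{C}: 2\,\mathrm{Re}\,z\notin\omega\mathbb{Z}^*\}$, $E=\Omega\times\mathbb{C}_\omega$. $C=\frac{4\pi^2}{3\omega^2}+\frac{\pi}{\omega}\sqrt{\frac{\pi}{3}}$. Standing assumptions: $u\in L^1(\Omega)\cap L^2(\Omega)$ and (zero mass) $\int_{-\ell}^{\ell}u(x,y)\,dx=0$ for all $y\in\mathbb{R}$. The solution $\mu$ is taken in the class of bounded solutions with $\widehat{\mu-1}(\cdot,\cdot;z)\in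 L^1(\mathbb{Z}\times\mathbb{R})$ for every $z\in\mathbb{C}_\omega$, where $\widehat f(m,\xi)=\frac{1}{2\ell}\int_{-\infty}^{\infty}\int_{-\ell}^{\ell}f(x,y)e^{-i\omega mx-i\xi y}\,dx\,dy$. One-sided limits at a line $\mathrm{Re}\,z=\frac{\omega}{2}n$ are the limits, for fixed $(x,y)$, as $z$ tends non-tangentially to a point of the line from the region to its right (denoted $\mu^+$) or from the region to its left (denoted $\mu^-$). In the last limit $\mathrm{Re}\,z$ is held fixed with $z\in\mathbb{C}_\omega$ and $(x,y)$ is fixed. *)

theory Defs
  imports "HOL-Analysis.Analysis"
begin

definition freq :: "real \<Rightarrow> real" where
  "freq l = pi / l"

definition Omega :: "real \<Rightarrow> (real \<times> real) set" where
  "Omega l = {-l..l} \<times> UNIV"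

definition C_omega :: "real \<Rightarrow> complex set" where
  "C_omega l = {z. \<forall>n::int. n \<noteq> 0 \<longrightarrow> 2 * Re z \<noteq> freq l * of_int n}"

definition E_dom :: "real \<Rightarrow> (real \<times> real \<times> complex) set" where
  "E_dom l = {(x, y, z). (x, y) \<in> Omega l \<and> z \<in> C_omega l}"

definition C_const :: "real \<Rightarrow> real" where
  "C_const w = 4 * pi\<^sup>2 / (3 * w\<^sup>2) + pi / w * sqrt (pi / 3)"

definition x_periodic :: "real \<Rightarrow> (real \<Rightarrow> real \<Rightarrow> complex) \<Rightarrow> bool" where
  "x_periodic l f \<longleftrightarrow> (\<forall>x y. f (x + 2 * l) y = f x y)"

definition in_Lp :: "real \<Rightarrow> real \<Rightarrow> (real \<Rightarrow> real \<Rightarrow> complex) \<Rightarrow> bool" where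
  "in_Lp l p f \<longleftrightarrow>
     (\<lambda>(x, y). f x y) \<in> borel_measurable (lebesgue_on (Omega l)) \<and>
     integrable (lebesgue_on (Omega l)) (\<lambda>(x, y). norm (f x y) powr p)"

definition Lp_norm :: "real \<Rightarrow> real \<Rightarrow> (real \<Rightarrow> real \<Rightarrow> complex) \<Rightarrow> real" where
  "Lp_norm l p f = (LINT (x, y)|lebesgue_on (Omega l). norm (f x y) powr p) powr (1 / p)"

definition in_Linfty_E :: "real \<Rightarrow> (real \<Rightarrow> real \<Rightarrow> complex \<Rightarrow> complex) \<Rightarrow> bool" where
  "in_Linfty_E l \<mu> \<longleftrightarrow>
     (\<lambda>(x, y, z). \<mu> x y z) \<in> borel_measurable (lebesgue_on (E_dom l)) \<and>
     (\<exists>B. AE (x, y, z) in lebesgue_on (E_dom l). norm (\<mu> x y z) \<le> B)"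

definition dx :: "(real \<Rightarrow> real \<Rightarrow> complex) \<Rightarrow> real \<Rightarrow> real \<Rightarrow> complex" where
  "dx f x y = vector_derivative (\<lambda>t. f t y) (at x)"

definition dy :: "(real \<Rightarrow> real \<Rightarrow> complex) \<Rightarrow> real \<Rightarrow> real \<Rightarrow> complex" where
  "dy f x y = vector_derivative (\<lambda>t. f x t) (at y)"

text \<open>Only the mixed derivatives taken in the order "first y, then x" are listed; since they are all
  continuous, Schwarz's theorem gives the remaining orders, so this is \<open>C\<^sup>\<infinity>\<close> on the plane.\<close>

definition smooth :: "(real \<Rightarrow> real \<Rightarrow> complex) \<Rightarrow> bool" where
  "smooth f \<longleftrightarrow> (\<forall>i j. let g = (dx ^^ i) ((dy ^^ j) f) in
     continuous_on UNIV (\<lambda>(x, y). g x y) \<and>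
     (\<forall>x y. (\<lambda>t. g t y) differentiable (at x) \<and> (\<lambda>t. g x t) differentiable (at y)))"

text \<open>Test functions on the cylinder: periodic in \<open>x\<close>, compactly supported in \<open>y\<close>. Pairing with
  them over one period encodes distributional statements about periodic functions, without
  boundary terms at \<open>x = -l\<close> and \<open>x = l\<close>.\<close>

definition test_fun :: "real \<Rightarrow> (real \<Rightarrow> real \<Rightarrow> complex) \<Rightarrow> bool" where
  "test_fun l \<phi> \<longleftrightarrow> smooth \<phi> \<and> x_periodic l \<phi> \<and> (\<exists>R. \<forall>x y. \<bar>y\<bar> > R \<longrightarrow> \<phi> x y = 0)"

definition weak_dx :: "real \<Rightarrow> (real \<Rightarrow> real \<Rightarrow> complex) \<Rightarrow> (real \<Rightarrow> real \<Rightarrow> complex) \<Rightarrow> bool" where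
  "weak_dx l f g \<longleftrightarrow> (\<forall>\<phi>. test_fun l \<phi> \<longrightarrow>
     (LINT (x, y)|lebesgue_on (Omega l). f x y * dx \<phi> x y) =
     - (LINT (x, y)|lebesgue_on (Omega l). g x y * \<phi> x y))"

definition weak_dy :: "real \<Rightarrow> (real \<Rightarrow> real \<Rightarrow> complex) \<Rightarrow> (real \<Rightarrow> real \<Rightarrow> complex) \<Rightarrow> bool" where
  "weak_dy l f g \<longleftrightarrow> (\<forall>\<phi>. test_fun l \<phi> \<longrightarrow>
     (LINT (x, y)|lebesgue_on (Omega l). f x y * dy \<phi> x y) =
     - (LINT (x, y)|lebesgue_on (Omega l). g x y * \<phi> x y))"

definition fourier :: "real \<Rightarrow> (real \<Rightarrow> real \<Rightarrow> complex) \<Rightarrow> int \<Rightarrow> real \<Rightarrow> complex" where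
  "fourier l f m \<xi> = 1 / of_real (2 * l) *
     (LINT (x, y)|lebesgue_on (Omega l).
        f x y * exp (- \<i> * of_real (freq l * of_int m * x) - \<i> * of_real (\<xi> * y)))"

text \<open>A bounded function need not be integrable over the cylinder, so its Fourier transform is meant
  in the sense of distributions, i.e. it is determined by
  \<open>\<integral> f \<phi> = (l / \<pi>) \<Sum>\<^sub>m \<integral> g (m, \<xi>) (fourier \<phi>) (-m, -\<xi>) d\<xi>\<close> for all test functions.
  For integrable \<open>f\<close> this is \<open>g = fourier l f\<close> almost everywhere; the factor \<open>l / \<pi>\<close> comes from
  the inversion formula \<open>f = (1 / (2 \<pi>)) \<Sum>\<^sub>m \<integral> (fourier f) (m, \<xi>) exp (i \<omega> m x + i \<xi> y) d\<xi>\<close>.\<close>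

definition is_fourier_transform ::
  "real \<Rightarrow> (real \<Rightarrow> real \<Rightarrow> complex) \<Rightarrow> (int \<times> real \<Rightarrow> complex) \<Rightarrow> bool" where
  "is_fourier_transform l f g \<longleftrightarrow> (\<forall>\<phi>. test_fun l \<phi> \<longrightarrow>
     (LINT (x, y)|lebesgue_on (Omega l). f x y * \<phi> x y) =
     of_real (l / pi) *
       (LINT (m, \<xi>)|(count_space UNIV \<Otimes>\<^sub>M lborel). g (m, \<xi>) * fourier l \<phi> (- m) (- \<xi>)))"

definition fourier_in_L1 :: "real \<Rightarrow> (real \<Rightarrow> real \<Rightarrow> complex) \<Rightarrow> bool" where
  "fourier_in_L1 l f \<longleftrightarrow>
     (\<exists>g. integrable (count_space UNIV \<Otimes>\<^sub>M lborel) g \<and> is_fourier_transform l f g)"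

text \<open>The equation \<open>(-\<partial>\<^sub>y + \<partial>\<^sub>x\<^sup>2 + 2 i z \<partial>\<^sub>x) m + u m = 0\<close> on the cylinder, in the sense of
  distributions.\<close>

definition solves_PDE ::
  "real \<Rightarrow> (real \<Rightarrow> real \<Rightarrow> complex) \<Rightarrow> complex \<Rightarrow> (real \<Rightarrow> real \<Rightarrow> complex) \<Rightarrow> bool" where
  "solves_PDE l u z m \<longleftrightarrow> (\<forall>\<phi>. test_fun l \<phi> \<longrightarrow>
     (LINT (x, y)|lebesgue_on (Omega l).
        m x y * (dy \<phi> x y + dx (dx \<phi>) x y - 2 * \<i> * z * dx \<phi> x y) + u x y * m x y * \<phi> x y) = 0)"

text \<open>For each \<open>z\<close>, integrability of the transform of \<open>\<mu> - 1\<close> gives \<open>\<mu>\<close> exactly one representative that is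
  continuous in \<open>(x, y)\<close>; requiring continuity selects it, so that limits at a fixed point \<open>(x, y)\<close>
  are meaningful.\<close>

definition is_solution ::
  "real \<Rightarrow> (real \<Rightarrow> real \<Rightarrow> complex) \<Rightarrow> (real \<Rightarrow> real \<Rightarrow> complex \<Rightarrow> complex) \<Rightarrow> bool" where
  "is_solution l u \<mu> \<longleftrightarrow>
     in_Linfty_E l \<mu> \<and>
     (\<forall>z \<in> C_omega l.
        x_periodic l (\<lambda>x y. \<mu> x y z) \<and>
        continuous_on UNIV (\<lambda>(x, y). \<mu> x y z) \<and>
        fourier_in_L1 l (\<lambda>x y. \<mu> x y z - 1) \<and>
        solves_PDE l u z (\<lambda>x y. \<mu> x y z) \<and>
        (\<forall>x. ((\<lambda>y. \<mu> x y z) \<longlongrightarrow> 1) at_infinity))"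

text \<open>Non-tangential approach to \<open>z0\<close> from the right or left: within every sector with vertex \<open>z0\<close>,
  of aperture determined by \<open>K\<close>.\<close>

definition has_right_limit :: "real \<Rightarrow> (complex \<Rightarrow> complex) \<Rightarrow> complex \<Rightarrow> complex \<Rightarrow> bool" where
  "has_right_limit l f z0 L \<longleftrightarrow> (\<forall>K>0.
     (f \<longlongrightarrow> L) (at z0 within
       {z \<in> C_omega l. Re z > Re z0 \<and> \<bar>Im z - Im z0\<bar> \<le> K * (Re z - Re z0)}))"

definition has_left_limit :: "real \<Rightarrow> (complex \<Rightarrow> complex) \<Rightarrow> complex \<Rightarrow> complex \<Rightarrow> bool" where
  "has_left_limit l f z0 L \<longleftrightarrow> (\<forall>K>0.
     (f \<longlongrightarrow> L) (at z0 within
       {z \<in> C_omega l. Re z < Re z0 \<and> \<bar>Im z - Im z0\<bar> \<le> K * (Re z0 - Re z)}))"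

end

theory Submission
  imports Defs "HOL-Complex_Analysis.Great_Picard" "HOL-Probability.Probability"
begin

text \<open>For a single \<open>z\<close> the Fourier coefficients in \<open>x\<close> of a bounded solution \<open>\<mu>(\<cdot>;z)\<close> satisfy the ordinary differential
  equations \<open>\<mu>\<^sub>m' + a(z, m) \<mu>\<^sub>m = (u \<mu>)\<^sub>m\<close>, \<open>a(z, m) = \<omega> m (\<omega> m + 2 z)\<close>, and \<open>\<mu> \<rightarrow> 1\<close> turns into bounds on
  the stable modes by the mass of \<open>u\<close> on the left and on the unstable modes by its mass on the right. These
  bounds pass to limits, so bounded families of solutions are compact, also up to a resonance line, where the side
  of approach decides which of the two bounds the resonant mode inherits.

  The limit does not depend on the sequence because solutions are unique: \<open>exp (i \<omega> j x - a(z, j) y) \<mu>(x, y; z + \<omega> j)\<close>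
  for the finitely many unstable \<open>j\<close> and the difference of two solutions are more functions than there are
  unstable modes, so a nontrivial combination has no unstable component far to the left, where a contraction argument
  makes it vanish; looking at \<open>+\<infinity>\<close> shows that it is the difference. A bound that is uniform in \<open>z\<close>, and not just
  valid almost everywhere, follows from the same compactness and uniqueness.

  As \<open>\<bar>Im z\<bar> \<rightarrow> \<infinity>\<close> the factors \<open>exp (- i Im a(z, m) y)\<close> oscillate, and since \<open>u\<close> has zero mean in \<open>x\<close> the
  Riemann-Lebesgue lemma removes the interaction from the limit equation, which leaves \<open>\<mu> = 1\<close>.\<close>

section \<open>Fourier modes on a period\<close>

text \<open>A periodic function of \<open>x\<close> is measured by the sum of the moduli of its
  Fourier coefficients. This sum dominates the supremum, and its tail over high modes is small
  uniformly over bounded families of solutions with \<open>Re z\<close> bounded. Compactness in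
  \<open>x\<close> thus comes from the tail alone, and what remains are finitely many low modes,
  each obeying a scalar linear equation in \<open>y\<close>. The obstacle is that on a resonance
  line the rate of a mode passes through zero, so a fixed-point scheme on the whole cylinder
  degenerates there. The contraction is therefore run only where little mass of \<open>u\<close> is
  available: first far to the left, then through short slabs further and further to the right. The
  price is that the unstable modes must be removed by hand. The gauge factors that do so owe their
  existence to \<open>a z m = (z + w m)^2 - z^2\<close>: a shift of \<open>z\<close> by
  \<open>w j\<close> merely relabels the modes and subtracts a constant from the rates. The mass
  bounds on the modes keep exactly what uniqueness consumes: decay of the stable modes at
  -\<infinity>, of the unstable ones at +\<infinity>, and of \<open>mode 0 M - 1\<close> at both
  ends.\<close>

locale period =
  fixes l :: real
  assumes l_pos: "0 < l"
begin

definition w :: real where "w = freq l"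

lemma w_pos: "0 < w" and w_l: "w * l = pi"
  using l_pos by (auto simp: w_def freq_def)

definition em :: "int \<Rightarrow> real \<Rightarrow> complex" where
  "em m x = cis (w * of_int m * x)"

lemma em_0 [simp]: "em 0 x = 1" and em_at_0 [simp]: "em m 0 = 1"
  by (auto simp: em_def)

lemma em_add: "em (m + k) x = em m x * em k x"
  by (simp add: em_def cis_mult algebra_simps)

lemma em_add_arg: "em m (x + y) = em m x * em m y"
  by (simp add: em_def cis_mult algebra_simps)

lemma norm_em [simp]: "norm (em m x) = 1"
  by (simp add: em_def)

lemma cnj_em: "cnj (em m x) = em (- m) x"
  by (simp add: em_def cis_cnj)

lemma em_period: "em m (x + 2 * l) = em m x"
proof -
  have "w * of_int m * (x + 2 * l) = w * of_int m * x + of_int m * (2 * (w * l))"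
    by (simp add: algebra_simps)
  also have "\<dots> = w * of_int m * x + 2 * pi * of_int m"
    by (simp only: w_l) (simp add: algebra_simps)
  finally have "cis (w * of_int m * (x + 2 * l)) = cis (w * of_int m * x) * cis (2 * pi * of_int m)"
    by (simp only: cis_mult)
  then show ?thesis by (simp add: em_def cis_multiple_2pi)
qed

lemma continuous_em [continuous_intros]: "continuous_on S g \<Longrightarrow> continuous_on S (\<lambda>x. em m (g x))"
  unfolding em_def cis_conv_exp by (intro continuous_intros)

lemma measurable_em [measurable]: "em m \<in> borel_measurable borel"
  by (intro borel_measurable_continuous_onI continuous_intros)

text \<open>Normalised Lebesgue measure of one period, kept as a Borel measure on the whole line.
  Being a probability measure it makes the coefficients \<open>md\<close> averages, and periodic
  functions need not be restricted.\<close>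

definition X :: "real measure" where
  "X = density lborel (\<lambda>x. ennreal (indicator {-l..l} x / (2 * l)))"

lemma sets_X [measurable_cong, simp]: "sets X = sets borel"
  and space_X [simp]: "space X = UNIV"
  by (auto simp: X_def)

lemma X_prob: "prob_space X"
proof
  have "emeasure X (space X) = (\<integral>\<^sup>+x. ennreal (1 / (2 * l)) * indicator {-l..l} x \<partial>lborel)"
    by (simp add: X_def emeasure_density, intro nn_integral_cong) (auto simp: indicator_def)
  also have "\<dots> = 1"
    using l_pos by (simp add: nn_integral_cmult_indicator ennreal_mult[symmetric] flip: ennreal_1)
  finally show "emeasure X (space X) = 1" .
qed

sublocale X: prob_space X by (rule X_prob)

lemma integral_X:
  fixes f :: "real \<Rightarrow> 'b::{banach, second_countable_topology}"
  assumes "f \<in> borel_measurable borel"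
  shows "integral\<^sup>L X f = (1 / (2 * l)) *\<^sub>R integral\<^sup>L lborel (\<lambda>x. indicator {-l..l} x *\<^sub>R f x)"
proof -
  have "integral\<^sup>L X f = integral\<^sup>L lborel (\<lambda>x. (indicator {-l..l} x / (2 * l)) *\<^sub>R f x)"
    unfolding X_def using assms l_pos by (subst integral_density) auto
  also have "\<dots> = integral\<^sup>L lborel (\<lambda>x. (1 / (2 * l)) *\<^sub>R (indicator {-l..l} x *\<^sub>R f x))"
    by simp
  finally show ?thesis by (simp only: integral_scaleR_right)
qed

lemma AE_X_in: "AE x in X. x \<in> {-l..l}"
  unfolding X_def using l_pos by (subst AE_density) (auto simp: indicator_def)

lemma integrable_X_bounded:
  fixes f :: "real \<Rightarrow> 'b::{banach, second_countable_topology}"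
  assumes "f \<in> borel_measurable borel" "\<And>x. norm (f x) \<le> B"
  shows "integrable X f"
  by (rule X.integrable_const_bound[where B = B]) (use assms in auto)

lemma integral_em: "integral\<^sup>L X (em m) = (if m = 0 then 1 else 0)"
proof (cases "m = 0")
  case True
  have "integral\<^sup>L X (em m) = integral\<^sup>L X (\<lambda>x. 1)"
    by (rule Bochner_Integration.integral_cong) (auto simp: True)
  then show ?thesis using True X.prob_space by simp
next
  case False
  define k where "k = w * of_int m"
  have k: "k \<noteq> 0" using False w_pos by (simp add: k_def)
  let ?F = "\<lambda>x. cis (k * x) / (\<i> * k)"
  have D: "(?F has_vector_derivative em m x) (at x within {-l..l})" for x
    unfolding em_def k_def[symmetric] cis_conv_exp
    by (rule has_vector_derivative_real_field derivative_eq_intros refl | use k in \<open>simp add: field_simps\<close>)+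
  have "integral\<^sup>L lborel (\<lambda>x. indicator {-l..l} x *\<^sub>R em m x) = ?F l - ?F (- l)"
    using l_pos by (intro integral_FTC_atLeastAtMost D) (auto intro!: continuous_intros)
  also have "\<dots> = (em m (-l + 2 * l) - em m (- l)) / (\<i> * k)"
    by (simp add: em_def k_def diff_divide_distrib)
  also have "\<dots> = 0" by (simp only: em_period) simp
  finally show ?thesis using False by (simp add: integral_X)
qed

definition md :: "int \<Rightarrow> (real \<Rightarrow> complex) \<Rightarrow> complex" where
  "md m F = (LINT x|X. F x * em (- m) x)"

lemma integrable_em_mult:
  assumes "integrable X F"
  shows "integrable X (\<lambda>x. F x * em m x)"
  by (rule Bochner_Integration.integrable_bound[OF assms]) (use assms in \<open>auto simp: norm_mult\<close>)

lemma md_add: "integrable X F \<Longrightarrow> integrable X G \<Longrightarrow> md m (\<lambda>x. F x + G x) = md m F + md m G"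
  by (simp add: md_def ring_distribs integrable_em_mult)

lemma md_diff: "integrable X F \<Longrightarrow> integrable X G \<Longrightarrow> md m (\<lambda>x. F x - G x) = md m F - md m G"
  by (simp add: md_def ring_distribs integrable_em_mult)

lemma md_cmult: "md m (\<lambda>x. c * F x) = c * md m F"
  by (simp add: md_def mult.assoc)

lemma md_sum: "(\<And>i. i \<in> A \<Longrightarrow> integrable X (F i)) \<Longrightarrow> md m (\<lambda>x. \<Sum>i\<in>A. F i x) = (\<Sum>i\<in>A. md m (F i))"
  by (simp add: md_def sum_distrib_right integrable_em_mult)

lemma md_em_mult: "md m (\<lambda>x. em j x * F x) = md (m - j) F"
proof -
  have "em j x * F x * em (- m) x = F x * em (- (m - j)) x" for x
    using em_add[of j "- m" x] by (simp add: mult_ac)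
  then show ?thesis by (simp only: md_def)
qed

lemma md_em: "md m (em j) = (if m = j then 1 else 0)"
proof -
  have "em j x * em (- m) x = em (j - m) x" for x
    using em_add[of j "- m" x] by simp
  then show ?thesis by (simp add: md_def integral_em)
qed

lemma md_const: "md m (\<lambda>x. c) = (if m = 0 then c else 0)"
  using md_cmult[of m c "\<lambda>x. 1"] md_em[of m 0] by (auto simp: em_0[abs_def])

lemma norm_md_le: "integrable X F \<Longrightarrow> norm (md m F) \<le> (LINT x|X. norm (F x))"
  unfolding md_def by (rule order.trans[OF integral_norm_bound]) (simp add: norm_mult)

lemma norm_md_le_bound:
  assumes "integrable X F" "\<And>x. norm (F x) \<le> B"
  shows "norm (md m F) \<le> B"
proof -
  have "(LINT x|X. norm (F x)) \<le> (LINT x|X. B)"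
    by (intro integral_mono) (use assms in auto)
  then show ?thesis using norm_md_le[OF assms(1), of m] X.prob_space by simp
qed

text \<open>The mean of \<open>|F - P|^2\<close> is nonnegative for the partial Fourier sum
  \<open>P\<close> over \<open>A\<close>; expanding the square, both the cross term and the square
  of \<open>P\<close> equal the sum on the left.\<close>

lemma bessel:
  assumes F: "integrable X F" and F2: "integrable X (\<lambda>x. (norm (F x))\<^sup>2)" and A: "finite A"
  shows "(\<Sum>m\<in>A. (norm (md m F))\<^sup>2) \<le> (LINT x|X. (norm (F x))\<^sup>2)"
proof -
  define P where "P x = (\<Sum>m\<in>A. md m F * em m x)" for x
  have [measurable]: "P \<in> borel_measurable borel" unfolding P_def by measurable
  have "(\<lambda>x. cnj (P x)) = (\<lambda>x. \<Sum>m\<in>A. cnj (md m F) * em (- m) x)"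
    by (simp add: P_def cnj_em)
  then have [measurable]: "(\<lambda>x. cnj (P x)) \<in> borel_measurable borel" by simp
  have Fm [measurable]: "F \<in> borel_measurable borel" using F by auto
  have iP: "integrable X P"
    unfolding P_def by (intro Bochner_Integration.integrable_sum integrable_mult_right integrable_X_bounded[where B=1]) auto
  have PB: "norm (P x) \<le> (\<Sum>m\<in>A. norm (md m F))" for x
    unfolding P_def by (rule order.trans[OF norm_sum]) (simp add: norm_mult)
  have cP: "integral\<^sup>L X (\<lambda>x. G x * cnj (P x)) = (\<Sum>m\<in>A. cnj (md m F) * md m G)"
    if "integrable X G" for G
  proof -
    have "G x * cnj (P x) = (\<Sum>m\<in>A. cnj (md m F) * (G x * em (- m) x))" for x
      by (simp add: P_def cnj_em sum_distrib_left mult_ac)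
    then show ?thesis using that by (simp add: md_def integrable_em_mult)
  qed
  have mdP: "md m P = md m F" if "m \<in> A" for m
  proof -
    have "md m P = (\<Sum>j\<in>A. md j F * (if m = j then 1 else 0))"
      unfolding P_def by (subst md_sum) (auto simp: md_cmult md_em intro!: integrable_mult_right integrable_X_bounded[where B=1])
    also have "\<dots> = (\<Sum>j\<in>A. if m = j then md j F else 0)"
      by (intro sum.cong) auto
    finally show ?thesis using that A by simp
  qed
  have iFP: "integrable X (\<lambda>x. F x * cnj (P x))"
    by (rule Bochner_Integration.integrable_bound[of X "\<lambda>x. (\<Sum>m\<in>A. norm (md m F)) * norm (F x)"])
       (use F in \<open>auto simp: norm_mult mult.commute[of _ "norm (F _)"] intro!: AE_I2 order.trans[OF mult_left_mono[OF PB] abs_ge_self]\<close>)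
  have iPP: "integrable X (\<lambda>x. P x * cnj (P x))"
    by (rule integrable_X_bounded[where B="(\<Sum>m\<in>A. norm (md m F))\<^sup>2"])
       (auto simp: norm_mult power2_eq_square intro!: mult_mono PB sum_nonneg)
  have eq: "(norm (F x))\<^sup>2 - 2 * Re (F x * cnj (P x)) + Re (P x * cnj (P x)) = (norm (F x - P x))\<^sup>2" for x
    unfolding cmod_power2 by (simp add: power2_eq_square algebra_simps)
  have "0 \<le> (LINT x|X. (norm (F x - P x))\<^sup>2)" by simp
  also have "\<dots> = (LINT x|X. (norm (F x))\<^sup>2 - 2 * Re (F x * cnj (P x)) + Re (P x * cnj (P x)))"
    by (simp only: eq)
  also have "\<dots> = (LINT x|X. (norm (F x))\<^sup>2) - 2 * Re (LINT x|X. F x * cnj (P x)) + Re (LINT x|X. P x * cnj (P x))"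
  proof -
    have "integrable X (\<lambda>x. 2 * Re (F x * cnj (P x)))" "integrable X (\<lambda>x. Re (P x * cnj (P x)))"
      by (rule integrable_mult_right[OF integrable_Re[OF iFP]]) (rule integrable_Re[OF iPP])
    then show ?thesis
      using F2 by (simp only: Bochner_Integration.integral_add Bochner_Integration.integral_diff
        Bochner_Integration.integrable_diff integral_mult_right_zero integral_Re[OF iFP] integral_Re[OF iPP])
  qed
  also have "(LINT x|X. P x * cnj (P x)) = (LINT x|X. F x * cnj (P x))"
    using F iP by (simp add: cP mdP)
  also have "(LINT x|X. F x * cnj (P x)) = of_real (\<Sum>m\<in>A. (norm (md m F))\<^sup>2)"
    using F by (simp only: cP) (simp add: complex_norm_square mult.commute del: of_real_power)
  finally show ?thesis by simp
qed

lemma integrable_X_continuous: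
  fixes F :: "real \<Rightarrow> complex"
  assumes F: "continuous_on UNIV F"
  shows "integrable X F"
proof -
  obtain B where B: "\<And>x. x \<in> {-l..l} \<Longrightarrow> norm (F x) \<le> B"
    using compact_continuous_image[OF continuous_on_subset[OF F subset_UNIV] compact_Icc, THEN compact_imp_bounded]
    unfolding bounded_iff by blast
  have "F \<in> borel_measurable borel" using F by (rule borel_measurable_continuous_onI)
  moreover have "AE x in X. norm (F x) \<le> B"
    by (rule AE_mp[OF AE_X_in]) (use B in auto)
  ultimately show ?thesis by (intro X.integrable_const_bound[where B=B]) auto
qed

text \<open>This is \<open>cos (w x / 2) ^ (2 n)\<close>: a nonnegative trigonometric polynomial
  that concentrates at the multiples of the period.\<close>

definition kern :: "nat \<Rightarrow> real \<Rightarrow> real" where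
  "kern n x = ((1 + cos (w * x)) / 2) ^ n"

text \<open>The binomial theorem applied to \<open>((cis t + cis (- t)) / 2) ^ (2 n)\<close> with
  \<open>t = w x / 2\<close>. The term \<open>j = n\<close> is the constant one, so the mean of the
  kernel is its central coefficient.\<close>

lemma kern_expand:
  "of_real (kern n x) = (\<Sum>j\<le>2*n. of_real (((2*n) choose j) / 4 ^ n) * em (int j - int n) x)"
proof -
  define t where "t = w * x / 2"
  have c: "(1 + cos (w * x)) / 2 = (cos t)\<^sup>2"
    using cos_double_cos[of t] by (simp add: t_def)
  have "of_real (cos t) = (cis t + cis (- t)) / 2"
    by (simp add: complex_eq_iff)
  then have "of_real (kern n x) = ((cis t + cis (- t)) / 2) ^ (2 * n)"
    by (simp only: kern_def c power_mult of_real_power)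
  also have "\<dots> = (\<Sum>j\<le>2*n. of_nat ((2*n) choose j) * cis t ^ j * cis (- t) ^ (2*n - j)) / 4 ^ n"
    by (simp only: power_divide binomial_ring) (simp add: power_mult)
  also have "\<dots> = (\<Sum>j\<le>2*n. of_real (((2*n) choose j) / 4 ^ n) * em (int j - int n) x)"
    unfolding sum_divide_distrib
  proof (rule sum.cong[OF refl])
    fix j assume j: "j \<in> {..2*n}"
    have "cis t ^ j * cis (- t) ^ (2*n - j) = cis (real j * t + real (2*n - j) * (- t))"
      by (simp only: Complex.DeMoivre cis_mult)
    also have "real j * t + real (2*n - j) * (- t) = w * of_int (int j - int n) * x"
      using j by (simp add: t_def of_nat_diff field_simps)
    finally have "cis t ^ j * cis (- t) ^ (2*n - j) = em (int j - int n) x" by (simp add: em_def)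
    then show "of_nat ((2*n) choose j) * cis t ^ j * cis (- t) ^ (2*n - j) / 4 ^ n
      = of_real (((2*n) choose j) / 4 ^ n) * em (int j - int n) x"
      by (simp add: mult.assoc)
  qed
  finally show ?thesis .
qed

lemma half_cos_bounds: "0 \<le> (1 + cos t) / (2::real)" "(1 + cos t) / (2::real) \<le> 1"
proof -
  have "0 \<le> 1 + cos t" "1 + cos t \<le> 2" using cos_ge_minus_one[of t] cos_le_one[of t] by linarith+
  then show "0 \<le> (1 + cos t) / 2" "(1 + cos t) / 2 \<le> 1" by auto
qed

lemma kern_nonneg: "0 \<le> kern n x"
  unfolding kern_def by (intro zero_le_power half_cos_bounds)

lemma continuous_kern [continuous_intros]:
  fixes g :: "real \<Rightarrow> real"
  shows "continuous_on S g \<Longrightarrow> continuous_on S (\<lambda>x. kern n (g x))"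
  unfolding kern_def by (auto intro!: continuous_intros)

text \<open>Convolution with the kernels \<open>cos\<^sup>2\<^sup>n\<close>, suitably normalised, multiplies every Fourier
  coefficient by a number in \<open>[0, 1]\<close>.\<close>

lemma norm_le_sum_fourier:
  fixes F :: "real \<Rightarrow> complex"
  assumes F: "continuous_on UNIV F" and per: "\<And>x. F (x + 2 * l) = F x"
    and S: "\<And>A. finite A \<Longrightarrow> (\<Sum>m\<in>A. norm (md m F)) \<le> S"
  shows "norm (F x1) \<le> S"
proof -
  have iF: "integrable X F" by (rule integrable_X_continuous[OF F])
  have [measurable]: "F \<in> borel_measurable borel" using F by (rule borel_measurable_continuous_onI)
  \<comment> \<open>Mean of the kernel and at the same time its largest Fourier coefficient; the
    quotients by \<open>c n\<close> are the multipliers in \<open>[0, 1]\<close>.\<close>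
  define c where "c n = (2*n choose n) / (4::real) ^ n" for n
  have c_nn: "0 \<le> c n" for n by (simp add: c_def)
  define K where "K n x = kern n (x - x1)" for n x
  have K0: "0 \<le> K n x" for n x by (simp add: K_def kern_nonneg)
  have cK: "continuous_on UNIV (K n)" for n unfolding K_def by (intro continuous_intros)
  have [measurable]: "K n \<in> borel_measurable borel" for n
    using cK by (rule borel_measurable_continuous_onI)
  have Kc: "of_real (K n x) = (\<Sum>j\<le>2*n. of_real (((2*n) choose j) / 4 ^ n) * em (int j - int n) (- x1) * em (int j - int n) x)" for n x
    unfolding K_def kern_expand using em_add_arg[of _ x "- x1"] by (simp add: mult_ac)
  have K1: "K n x \<le> 1" for n x
    unfolding K_def kern_def by (intro power_le_one half_cos_bounds)
  have iK: "integrable X (K n)" for n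
    by (rule integrable_X_bounded[where B=1]) (use K0 K1 in auto)
  have intK: "(LINT x|X. K n x) = c n" for n
  proof -
    have "of_real (LINT x|X. K n x) = (LINT x|X. of_real (K n x) :: complex)" using iK by simp
    also have "\<dots> = (\<Sum>j\<le>2*n. of_real (((2*n) choose j) / 4 ^ n) * em (int j - int n) (- x1) * (LINT x|X. em (int j - int n) x))"
      unfolding Kc by (subst Bochner_Integration.integral_sum)
        (auto intro!: integrable_X_continuous continuous_intros)
    also have "\<dots> = (\<Sum>j\<le>2*n. if j = n then of_real (((2*n) choose j) / 4 ^ n) else 0)"
      by (intro sum.cong) (auto simp: integral_em)
    also have "\<dots> = of_real (c n)" by (simp add: c_def)
    finally show ?thesis by (simp only: of_real_eq_iff)
  qed
  have intFK: "norm (LINT x|X. F x * of_real (K n x)) \<le> c n * S" for n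
  proof -
    have "(LINT x|X. F x * of_real (K n x)) = (\<Sum>j\<le>2*n. of_real (((2*n) choose j) / 4 ^ n) * em (int j - int n) (- x1) * md (int n - int j) F)"
    proof -
      have "F x * of_real (K n x) = (\<Sum>j\<le>2*n. of_real (((2*n) choose j) / 4 ^ n) * em (int j - int n) (- x1) * (F x * em (int j - int n) x))" for x
        unfolding Kc by (simp add: sum_distrib_left mult_ac)
      then show ?thesis using iF by (simp add: md_def integrable_em_mult)
    qed
    also have "norm \<dots> \<le> (\<Sum>j\<le>2*n. c n * norm (md (int n - int j) F))"
      by (rule order.trans[OF norm_sum], intro sum_mono)
        (auto simp: norm_mult c_def norm_divide norm_power intro!: mult_right_mono divide_right_mono binomial_maximum')
    also have "\<dots> = c n * (\<Sum>m\<in>(\<lambda>j. int n - int j) ` {..2*n}. norm (md m F))"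
      by (subst sum.reindex) (auto simp: inj_on_def sum_distrib_left)
    also have "\<dots> \<le> c n * S" by (intro mult_left_mono S) (auto simp: c_def)
    finally show ?thesis .
  qed
  obtain B where B: "\<And>x. x \<in> {-l..l} \<Longrightarrow> norm (F x) \<le> B"
    using compact_continuous_image[OF continuous_on_subset[OF F subset_UNIV] compact_Icc, THEN compact_imp_bounded]
    unfolding bounded_iff by blast
  have perz: "F (x + 2 * l * of_int k) = F x" for x k
  proof (induction k rule: int_induct[where k=0])
    case (step1 i)
    then show ?case using per[of "x + 2 * l * of_int i"] by (simp add: algebra_simps)
  next
    case (step2 i)
    then show ?case using per[of "x + 2 * l * of_int (i - 1)"] by (simp add: algebra_simps)
  qed simp
  have "norm (F x1) \<le> S + e" if e: "e > 0" for e
  proof -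
    obtain d0 where d0: "d0 > 0" "\<And>x. \<bar>x - x1\<bar> < d0 \<Longrightarrow> norm (F x - F x1) < e"
      using F e unfolding continuous_on_iff dist_norm by (metis UNIV_I real_norm_def)
    define d where "d = min d0 l"
    have d: "0 < d" "d \<le> l" "d \<le> d0" using d0 l_pos by (auto simp: d_def)
    \<comment> \<open>The base of the power \<open>kern\<close> at distance \<open>d\<close> from
      the peak: further away, modulo the period, the kernel is at most
      \<open>\<rho> ^ n\<close>.\<close>
    define \<rho> where "\<rho> = (1 + cos (w * d)) / 2"
    have wd: "0 < w * d" "w * d \<le> pi" using d w_pos w_l mult_left_mono[of d l w] by auto
    have \<rho>: "0 \<le> \<rho>" "\<rho> < 1"
      using half_cos_bounds[of "w * d"] cos_monotone_0_pi[of 0 "w * d"] wd unfolding \<rho>_def by auto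
    \<comment> \<open>The cosine sees the distance to \<open>x1\<close> only modulo the period.
      Subtracting the nearest multiple of \<open>2 l\<close> leaves \<open>|r| \<le> l\<close>, and
      on \<open>[0, pi]\<close> the cosine is strictly decreasing, so
      \<open>|r| < d\<close>.\<close>
    have near: "norm (F x - F x1) < e" if "cos (w * (x - x1)) > cos (w * d)" for x
    proof -
      define k where "k = round ((x - x1) / (2 * l))"
      define r where "r = (x - x1) - 2 * l * of_int k"
      have "\<bar>of_int k - (x - x1) / (2 * l)\<bar> \<le> 1/2" unfolding k_def by (rule of_int_round_abs_le)
      then have r: "\<bar>r\<bar> \<le> l" using l_pos unfolding r_def by (auto simp: abs_le_iff field_simps)
      have "w * (x - x1) = w * r + 2 * of_int k * (w * l)" by (simp add: r_def algebra_simps)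
      then have "w * (x - x1) = w * r + 2 * pi * of_int k"
        by (simp only: w_l) (simp add: algebra_simps)
      then have "cos (w * (x - x1)) = cos (w * r)"
        by (simp only: cos_add cos_int_2pin sin_int_2pin)
      also have "\<dots> = cos (w * \<bar>r\<bar>)" by (cases "r \<ge> 0") (auto simp: abs_if)
      finally have *: "cos (w * \<bar>r\<bar>) > cos (w * d)" using that by simp
      have "w * \<bar>r\<bar> \<le> pi" using r w_pos w_l mult_left_mono[of "\<bar>r\<bar>" l w] by auto
      then have "w * \<bar>r\<bar> < w * d" using * cos_mono_less_eq[of "w * d" "w * \<bar>r\<bar>"] wd w_pos by auto
      then have "\<bar>r\<bar> < d0" using w_pos d by auto
      then have "norm (F (x1 + r) - F x1) < e" using d0(2)[of "x1 + r"] by simp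
      moreover have "x = x1 + r + 2 * l * of_int k" by (simp add: r_def)
      ultimately show ?thesis using perz[of "x1 + r" k] by simp
    qed
    define B' where "B' = B + norm (F x1)"
    have bound: "norm (F x1) * c n \<le> c n * S + (e * c n + B' * \<rho> ^ n)" for n
    proof -
      have pt: "norm (F x - F x1) * K n x \<le> e * K n x + B' * \<rho> ^ n" if "x \<in> {-l..l}" for x
      proof (cases "cos (w * (x - x1)) > cos (w * d)")
        case True
        have "0 \<le> B'" using B[OF that] norm_ge_zero[of "F x"] norm_ge_zero[of "F x1"] unfolding B'_def by linarith
        then show ?thesis using near[OF True] K0[of n x] \<rho>
          by (intro add_increasing2 mult_right_mono) auto
      next
        case False
        then have "K n x \<le> \<rho> ^ n" unfolding K_def kern_def \<rho>_def
          by (intro power_mono) (use False half_cos_bounds in auto)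
        moreover have "norm (F x - F x1) \<le> B'" using B[OF that] norm_triangle_ineq4[of "F x" "F x1"] unfolding B'_def by linarith
        ultimately have "norm (F x - F x1) * K n x \<le> B' * \<rho> ^ n"
          using K0[of n x] by (intro mult_mono) (auto intro: order.trans[OF norm_ge_zero])
        then show ?thesis using e K0[of n x] by (intro add_increasing) auto
      qed
      have i1: "integrable X (\<lambda>x. F x * of_real (K n x))"
        by (rule integrable_X_continuous) (intro continuous_intros F cK)
      have i2: "integrable X (\<lambda>x. (F x1 - F x) * of_real (K n x))"
        by (rule integrable_X_continuous) (intro continuous_intros F cK)
      have "F x1 * of_real (c n) = (LINT x|X. F x1 * of_real (K n x))"
        unfolding intK[symmetric] using iK by simp
      also have "\<dots> = (LINT x|X. F x * of_real (K n x) + (F x1 - F x) * of_real (K n x))"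
        by (simp add: algebra_simps)
      also have "\<dots> = (LINT x|X. F x * of_real (K n x)) + (LINT x|X. (F x1 - F x) * of_real (K n x))"
        by (rule Bochner_Integration.integral_add[OF i1 i2])
      finally have eq: "F x1 * of_real (c n) = (LINT x|X. F x * of_real (K n x)) + (LINT x|X. (F x1 - F x) * of_real (K n x))" .
      have "norm (F x1) * c n = norm (F x1 * of_real (c n))" using c_nn[of n] by (simp add: norm_mult)
      also have "\<dots> \<le> c n * S + norm (LINT x|X. (F x1 - F x) * of_real (K n x))"
        unfolding eq by (rule order.trans[OF norm_triangle_ineq add_right_mono[OF intFK]])
      finally have 1: "norm (F x1) * c n \<le> c n * S + norm (LINT x|X. (F x1 - F x) * of_real (K n x))" .
      have "norm (LINT x|X. (F x1 - F x) * of_real (K n x)) \<le> (LINT x|X. norm ((F x1 - F x) * of_real (K n x)))"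
        by (rule integral_norm_bound)
      also have "\<dots> \<le> (LINT x|X. e * K n x + B' * \<rho> ^ n)"
      proof (rule integral_mono_AE)
        show "AE x in X. norm ((F x1 - F x) * of_real (K n x)) \<le> e * K n x + B' * \<rho> ^ n"
          by (rule AE_mp[OF AE_X_in]) (use pt K0 in \<open>auto simp: norm_mult norm_minus_commute intro!: AE_I2\<close>)
      qed (use i2 iK in auto)
      also have "\<dots> = e * c n + B' * \<rho> ^ n" using iK X.prob_space by (simp add: intK)
      finally show ?thesis using 1 by simp
    qed
    \<comment> \<open>The central binomial coefficient is at least \<open>4 ^ n / (2 n)\<close>.
      Normalising therefore costs only a linear factor, which \<open>\<rho> ^ n\<close>
      beats.\<close>
    have c_low: "1 \<le> c n * (2 * real n)" if "n > 0" for n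
      using central_binomial_lower_bound[OF that] that by (simp add: c_def field_simps)
    have "norm (F x1) \<le> S + e + B' * (2 * real n * \<rho> ^ n)" if "n > 0" for n
    proof -
      have c0: "0 < c n" by (simp add: c_def)
      have cc: "1 / c n \<le> 2 * real n" using c_low[OF that] c0 by (simp add: field_simps)
      have "norm (F x1) * c n \<le> (S + e) * c n + B' * \<rho> ^ n" using bound[of n] by (simp add: algebra_simps)
      then have "norm (F x1) \<le> S + e + B' * \<rho> ^ n * (1 / c n)" using c0 by (simp add: field_simps)
      also have "B' * \<rho> ^ n * (1 / c n) \<le> B' * \<rho> ^ n * (2 * real n)"
      proof -
        have "norm (F l) \<le> B" using B[of l] l_pos by auto
        then have "0 \<le> B'" using norm_ge_zero[of "F l"] norm_ge_zero[of "F x1"] unfolding B'_def by linarith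
        then show ?thesis using cc \<rho> by (intro mult_left_mono) auto
      qed
      finally show ?thesis by (simp add: mult_ac)
    qed
    moreover have "(\<lambda>n. S + e + B' * (2 * real n * \<rho> ^ n)) \<longlonglongrightarrow> S + e + B' * 0"
    proof -
      have "(\<lambda>n. real n * \<rho> ^ n) \<longlonglongrightarrow> 0"
        using \<rho> by (intro powser_times_n_limit_0) auto
      then have "(\<lambda>n. 2 * (real n * \<rho> ^ n)) \<longlonglongrightarrow> 2 * 0" by (intro tendsto_intros)
      then show ?thesis by (intro tendsto_intros) (simp add: mult.assoc)
    qed
    ultimately have "norm (F x1) \<le> S + e + B' * 0"
      by (intro LIMSEQ_le_const[of "\<lambda>n. S + e + B' * (2 * real n * \<rho> ^ n)"] exI[of _ 1]) auto
    then show ?thesis by simp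
  qed
  then show ?thesis by (rule field_le_epsilon)
qed

end

section \<open>Elementary estimates and the integrated form of a scalar linear equation\<close>

lemma exp_integral_le:
  fixes c :: real
  assumes "0 < c" "y0 \<le> y"
  shows "set_integrable lborel {y0<..y} (\<lambda>t. exp (- c * (y - t)))"
    and "(LBINT t:{y0<..y}. exp (- c * (y - t))) \<le> 1 / c"
proof -
  let ?F = "\<lambda>t. exp (- c * (y - t)) / c"
  have i: "set_integrable lborel {y0..y} (\<lambda>t. exp (- c * (y - t)))"
    unfolding set_integrable_def by (rule borel_integrable_compact) (auto intro!: continuous_intros)
  then show i': "set_integrable lborel {y0<..y} (\<lambda>t. exp (- c * (y - t)))"
    by (rule set_integrable_subset) auto
  have "(LBINT t:{y0<..y}. exp (- c * (y - t))) \<le> (LBINT t:{y0..y}. exp (- c * (y - t)))"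
    unfolding set_lebesgue_integral_def
    using i i' by (intro integral_mono) (auto simp: set_integrable_def split: split_indicator)
  also have "\<dots> = ?F y - ?F y0"
    unfolding set_lebesgue_integral_def
    by (rule integral_FTC_atLeastAtMost)
       (use assms in \<open>auto intro!: continuous_intros derivative_eq_intros simp: has_real_derivative_iff_has_vector_derivative[symmetric]\<close>)
  also have "\<dots> \<le> 1 / c" using assms by (simp add: field_simps)
  finally show "(LBINT t:{y0<..y}. exp (- c * (y - t))) \<le> 1 / c" .
qed

text \<open>Telescoping: \<open>1 / k^2 \<le> 1 / (k - 1) - 1 / k\<close>. The factor 2 accounts for
  the two signs of \<open>m\<close>.\<close>

lemma sum_inverse_squares_tail:
  fixes A :: "int set" and R :: nat
  assumes "finite A" "0 < R" "\<And>m. m \<in> A \<Longrightarrow> int R < \<bar>m\<bar>"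
  shows "(\<Sum>m\<in>A. 1 / (of_int m)\<^sup>2) \<le> 2 / real R"
proof -
  have nat_tail: "(\<Sum>k\<in>{R<..R+n}. 1 / (real k)\<^sup>2) \<le> 1 / real R - 1 / real (R + n)" for n
  proof (induction n)
    case (Suc n)
    have "{R<..R + Suc n} = insert (R + Suc n) {R<..R+n}" by auto
    then have "(\<Sum>k\<in>{R<..R + Suc n}. 1 / (real k)\<^sup>2) \<le> 1 / (real (R + Suc n))\<^sup>2 + (1 / real R - 1 / real (R + n))"
      using Suc by simp
    also have "1 / (real (R + Suc n))\<^sup>2 \<le> 1 / real (R + n) - 1 / real (R + Suc n)"
    proof -
      have "1 / real (R + n) - 1 / real (R + Suc n) = 1 / (real (R + n) * real (R + Suc n))"
        using assms(2) by (simp add: field_simps)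
      moreover have "real (R + n) * real (R + Suc n) \<le> (real (R + Suc n))\<^sup>2"
        by (simp add: power2_eq_square mult_right_mono)
      ultimately show ?thesis using assms(2) by (simp add: frac_le)
    qed
    finally show ?case by simp
  qed simp
  obtain N where N: "\<And>m. m \<in> A \<Longrightarrow> nat \<bar>m\<bar> \<le> N"
    using finite_imageI[OF assms(1), of "\<lambda>m. nat \<bar>m\<bar>"] by (metis finite_nat_set_iff_bounded_le image_eqI)
  have half: "(\<Sum>m\<in>B. 1 / (of_int m)\<^sup>2) \<le> 1 / real R"
    if B: "B \<subseteq> A" "inj_on (\<lambda>m. nat \<bar>m\<bar>) B" for B
  proof -
    have "(\<Sum>m\<in>B. 1 / (of_int m)\<^sup>2) = (\<Sum>k\<in>(\<lambda>m. nat \<bar>m\<bar>) ` B. 1 / (real k)\<^sup>2)"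
      by (subst sum.reindex[OF B(2)]) simp
    also have "\<dots> \<le> (\<Sum>k\<in>{R<..R+N}. 1 / (real k)\<^sup>2)"
      using B N assms(3) by (intro sum_mono2) (auto simp: subset_iff trans_le_add2, fastforce+)
    also have "\<dots> \<le> 1 / real R" using nat_tail[of N] by (rule order.trans) simp
    finally show ?thesis .
  qed
  have "A = {m\<in>A. 0 \<le> m} \<union> {m\<in>A. m < 0}" by auto
  then have "(\<Sum>m\<in>A. 1 / (of_int m)\<^sup>2) = (\<Sum>m\<in>{m\<in>A. 0 \<le> m}. 1 / (real_of_int m)\<^sup>2) + (\<Sum>m\<in>{m\<in>A. m < 0}. 1 / (of_int m)\<^sup>2)"
    using assms(1) by (subst sum.union_disjoint[symmetric]) auto
  also have "\<dots> \<le> 1 / real R + 1 / real R"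
    by (intro add_mono half) (auto simp: inj_on_def)
  finally show ?thesis by simp
qed

text \<open>Variation of constants for \<open>g' + \<alpha> g = f\<close>. The integrated form makes
  sense for a source that is merely integrable, and it passes to pointwise limits by dominated
  convergence.\<close>

definition lsol :: "complex \<Rightarrow> (real \<Rightarrow> complex) \<Rightarrow> (real \<Rightarrow> complex) \<Rightarrow> bool" where
  "lsol \<alpha> f g \<longleftrightarrow> (\<forall>y0 y. y0 \<le> y \<longrightarrow>
     g y = exp (- \<alpha> * of_real (y - y0)) * g y0 + (LBINT t:{y0<..y}. exp (- \<alpha> * of_real (y - t)) * f t))"

lemma norm_exp_real_mult: "norm (exp (- \<alpha> * complex_of_real s)) = exp (- Re \<alpha> * s)"
  by simp

lemma norm_set_integral_le:
  fixes f :: "'a \<Rightarrow> 'b::{banach, second_countable_topology}"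
  assumes "set_integrable M A h" "\<And>t. t \<in> A \<Longrightarrow> norm (f t) \<le> h t"
  shows "norm (LINT t:A|M. f t) \<le> (LINT t:A|M. h t)"
proof -
  have "norm (LINT t:A|M. f t) \<le> (LINT t|M. norm (indicator A t *\<^sub>R f t))"
    unfolding set_lebesgue_integral_def by (rule integral_norm_bound)
  also have "\<dots> \<le> (LINT t:A|M. h t)"
  proof (cases "integrable M (\<lambda>t. norm (indicator A t *\<^sub>R f t))")
    case True
    then show ?thesis unfolding set_lebesgue_integral_def
      using assms by (intro integral_mono) (auto simp: set_integrable_def split: split_indicator)
  next
    \<comment> \<open>The integral of a non-integrable function is 0 by convention, which lies below
      the nonnegative right-hand side.\<close>
    case False
    have "0 \<le> (LINT t:A|M. h t)" unfolding set_lebesgue_integral_def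
      using assms(2) by (intro Bochner_Integration.integral_nonneg) (auto split: split_indicator intro: order.trans[OF norm_ge_zero])
    then show ?thesis using False by (simp add: not_integrable_integral_eq)
  qed
  finally show ?thesis .
qed

section \<open>The mode equations\<close>

text \<open>\<open>U\<close> stands for a Borel representative of \<open>u\<close>, corrected on a
  null set of \<open>t\<close>: the conditions on slices then hold for every \<open>t\<close>, and
  no exceptional sets enter the mode equations.\<close>

locale potential = period l for l :: real +
  fixes U :: "real \<Rightarrow> real \<Rightarrow> complex"
  assumes U_meas [measurable]: "case_prod U \<in> borel_measurable (borel \<Otimes>\<^sub>M borel)"
    and U_1: "\<And>t. integrable X (\<lambda>x. U x t)"
    and U_2: "\<And>t. integrable X (\<lambda>x. (norm (U x t))\<^sup>2)"
    and U_0: "\<And>t. (LINT x|X. U x t) = 0"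
    and phi_int: "integrable lborel (\<lambda>t. LINT x|X. norm (U x t))"
    and v2_int: "integrable lborel (\<lambda>t. LINT x|X. (norm (U x t))\<^sup>2)"
begin

definition phi :: "real \<Rightarrow> real" where "phi t = (LINT x|X. norm (U x t))"
definition v2 :: "real \<Rightarrow> real" where "v2 t = (LINT x|X. (norm (U x t))\<^sup>2)"
definition V :: real where "V = (LINT t|lborel. v2 t)"
definition Phi :: "real \<Rightarrow> real" where "Phi y = (LBINT t:{..y}. phi t)"
definition Phi_inf :: real where "Phi_inf = (LINT t|lborel. phi t)"
text \<open>The symbol of \<open>- \<partial>_x^2 - 2 i z \<partial>_x\<close> at frequency
  \<open>w m\<close>, hence the decay rate of mode \<open>m\<close> in the direction of increasing
  \<open>y\<close>.\<close>

definition a :: "complex \<Rightarrow> int \<Rightarrow> complex" where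
  "a z m = of_real (w\<^sup>2 * (of_int m)\<^sup>2) + 2 * z * of_real (w * of_int m)"
definition mode :: "int \<Rightarrow> (real \<Rightarrow> real \<Rightarrow> complex) \<Rightarrow> real \<Rightarrow> complex" where
  "mode m M y = md m (\<lambda>x. M x y)"
definition src :: "int \<Rightarrow> (real \<Rightarrow> real \<Rightarrow> complex) \<Rightarrow> real \<Rightarrow> complex" where
  "src m M t = md m (\<lambda>x. U x t * M x t)"
text \<open>Continuity is asked in \<open>x\<close> only, since limits of solutions are obtained
  uniformly in \<open>x\<close> for each single \<open>y\<close>. Joint measurability is what makes
  the modes and sources measurable in \<open>y\<close>.\<close>

definition slice :: "(real \<Rightarrow> real \<Rightarrow> complex) \<Rightarrow> bool" where
  "slice M \<longleftrightarrow> case_prod M \<in> borel_measurable (borel \<Otimes>\<^sub>M borel) \<and>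
     (\<forall>y. continuous_on UNIV (\<lambda>x. M x y)) \<and> (\<forall>x y. M (x + 2 * l) y = M x y)"
definition evo :: "complex \<Rightarrow> (real \<Rightarrow> real \<Rightarrow> complex) \<Rightarrow> bool" where
  "evo z M \<longleftrightarrow> (\<forall>m. lsol (a z m) (src m M) (mode m M))"

lemma phi_nonneg: "0 \<le> phi t" and v2_nonneg: "0 \<le> v2 t"
  by (auto simp: phi_def v2_def)

lemma phi_integrable: "integrable lborel phi" and v2_integrable: "integrable lborel v2"
  using phi_int v2_int by (auto simp: phi_def[abs_def] v2_def[abs_def])

lemma phi_set: "A \<in> sets borel \<Longrightarrow> set_integrable lborel A phi"
  and v2_set: "A \<in> sets borel \<Longrightarrow> set_integrable lborel A v2"
  using integrable_mult_indicator[OF _ phi_integrable, of A] integrable_mult_indicator[OF _ v2_integrable, of A]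
  by (simp_all add: set_integrable_def)

lemma V_nonneg: "0 \<le> V" by (simp add: V_def v2_nonneg)

lemma set_v2_le: "A \<in> sets borel \<Longrightarrow> (LBINT t:A. v2 t) \<le> V"
  unfolding V_def set_lebesgue_integral_def
  using v2_set[of A] v2_integrable v2_nonneg
  by (intro integral_mono) (auto simp: set_integrable_def split: split_indicator)

lemma Phi_diff: "y0 \<le> y \<Longrightarrow> (LBINT t:{y0<..y}. phi t) = Phi y - Phi y0"
proof -
  assume "y0 \<le> y"
  then have "{..y} = {..y0} \<union> {y0<..y}" by auto
  then show ?thesis unfolding Phi_def
    by (simp, subst set_integral_Un) (auto intro!: phi_set)
qed

lemma Phi_mono: "y0 \<le> y \<Longrightarrow> Phi y0 \<le> Phi y"
proof -
  assume "y0 \<le> y"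
  moreover have "0 \<le> (LBINT t:{y0<..y}. phi t)"
    by (auto simp: set_lebesgue_integral_def phi_nonneg intro!: Bochner_Integration.integral_nonneg)
  ultimately show ?thesis using Phi_diff by fastforce
qed

lemma Phi_top: "(Phi \<longlongrightarrow> Phi_inf) at_top"
  unfolding Phi_def[abs_def] Phi_inf_def set_lebesgue_integral_def
  by (rule tendsto_integral_at_top) (auto simp: phi_integrable)

lemma Phi_seq_limit:
  assumes "AE t in lborel. (\<lambda>n. indicator {..Y n} t *\<^sub>R phi t) \<longlonglongrightarrow> h t"
    and [measurable]: "h \<in> borel_measurable lborel"
  shows "(\<lambda>n. Phi (Y n)) \<longlonglongrightarrow> (LINT t|lborel. h t)"
  unfolding Phi_def set_lebesgue_integral_def
proof (rule integral_dominated_convergence[where w = phi])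
  show "AE t in lborel. norm (indicator {..Y n} t *\<^sub>R phi t) \<le> phi t" for n
    by (auto simp: phi_nonneg split: split_indicator)
qed (use assms(1) phi_integrable in auto)

lemma Phi_bot: "(Phi \<longlongrightarrow> 0) at_bot"
proof (rule tendsto_at_botI_sequentially)
  fix Y :: "nat \<Rightarrow> real" assume Y: "filterlim Y at_bot sequentially"
  have "(\<lambda>n. Phi (Y n)) \<longlonglongrightarrow> (LINT t::real|lborel. 0)"
  proof (rule Phi_seq_limit)
    show "AE t in lborel. (\<lambda>n. indicator {..Y n} t *\<^sub>R phi t) \<longlonglongrightarrow> 0"
    proof
      fix t
      have "eventually (\<lambda>n. Y n < t) sequentially" using Y unfolding filterlim_at_bot_dense by auto
      then show "(\<lambda>n. indicator {..Y n} t *\<^sub>R phi t) \<longlonglongrightarrow> 0"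
        by (intro tendsto_eventually) (auto elim: eventually_mono)
    qed
  qed simp
  then show "(\<lambda>n. Phi (Y n)) \<longlonglongrightarrow> 0" by simp
qed

text \<open>The mass has no atoms. Short intervals of \<open>y\<close> hence carry little of it,
  which yields both the equicontinuity of the modes and the slabs of the uniqueness proof.\<close>

lemma Phi_isCont: "isCont Phi y"
  unfolding continuous_at_sequentially
proof (intro allI impI)
  fix Y :: "nat \<Rightarrow> real" assume "Y \<longlonglongrightarrow> y"
  note Y = order_tendstoD[OF this]
  have [measurable]: "phi \<in> borel_measurable borel" using phi_integrable by auto
  have "(\<lambda>n. Phi (Y n)) \<longlonglongrightarrow> (LINT t|lborel. indicator {..y} t *\<^sub>R phi t)"
  proof (rule Phi_seq_limit)
    have "(\<lambda>n. indicator {..Y n} t *\<^sub>R phi t) \<longlonglongrightarrow> indicator {..y} t *\<^sub>R phi t" if "t \<noteq> y" for t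
    proof (cases "t < y")
      case True
      then show ?thesis
        by (intro tendsto_eventually eventually_mono[OF Y(1)[OF True]]) auto
    next
      case False
      then have "y < t" using that by auto
      then show ?thesis
        by (intro tendsto_eventually eventually_mono[OF Y(2)[of t]]) auto
    qed
    then show "AE t in lborel. (\<lambda>n. indicator {..Y n} t *\<^sub>R phi t) \<longlonglongrightarrow> indicator {..y} t *\<^sub>R phi t"
      using AE_lborel_singleton[of y] by (auto elim!: eventually_mono)
  qed simp
  then show "(Phi \<circ> Y) \<longlonglongrightarrow> Phi y" by (simp add: Phi_def set_lebesgue_integral_def o_def)
qed

lemma Phi_nonneg: "0 \<le> Phi y"
  by (auto simp: Phi_def set_lebesgue_integral_def phi_nonneg intro!: Bochner_Integration.integral_nonneg)

lemma Phi_le_inf: "Phi y \<le> Phi_inf"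
  by (rule tendsto_lowerbound[OF Phi_top]) (auto intro: eventually_mono[OF eventually_ge_at_top[of y]] Phi_mono)

lemma sliceD:
  assumes "slice M"
  shows "case_prod M \<in> borel_measurable (borel \<Otimes>\<^sub>M borel)" "continuous_on UNIV (\<lambda>x. M x y)" "M (x + 2 * l) y = M x y"
    "integrable X (\<lambda>x. M x y)" "(\<lambda>x. M x y) \<in> borel_measurable borel"
  using assms by (auto simp: slice_def intro: integrable_X_continuous borel_measurable_continuous_onI)

lemma slice_src_integrable:
  assumes "slice M"
  shows "integrable X (\<lambda>x. U x t * M x t)"
proof -
  have "compact ((\<lambda>x. M x t) ` {-l..l})"
    by (rule compact_continuous_image[OF continuous_on_subset[OF sliceD(2)[OF assms] subset_UNIV] compact_Icc])
  then have "bounded ((\<lambda>x. M x t) ` {-l..l})" by (rule compact_imp_bounded)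
  then obtain B where "\<forall>x\<in>{-l..l}. norm (M x t) \<le> B" unfolding bounded_iff by fast
  then have B: "\<And>x. x \<in> {-l..l} \<Longrightarrow> norm (M x t) \<le> B" by blast
  show ?thesis
  proof (rule Bochner_Integration.integrable_bound[of X "\<lambda>x. norm (U x t) * B"])
    show "AE x in X. norm (U x t * M x t) \<le> norm (norm (U x t) * B)"
      by (rule AE_mp[OF AE_X_in], rule AE_I2) (auto simp: norm_mult intro!: order.trans[OF mult_left_mono[OF B norm_ge_zero] abs_ge_self])
  qed (use U_1[of t] sliceD(5)[OF assms, of t] in auto)
qed

lemma norm_src_le:
  assumes M: "slice M" and B: "\<And>x. norm (M x t) \<le> B"
  shows "norm (src m M t) \<le> B * phi t"
proof -
  have "norm (src m M t) \<le> (LINT x|X. norm (U x t * M x t))"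
    unfolding src_def by (rule norm_md_le[OF slice_src_integrable[OF M]])
  also have "\<dots> \<le> (LINT x|X. B * norm (U x t))"
    using U_1[of t] B
    by (intro integral_mono[OF integrable_norm[OF slice_src_integrable[OF M]]])
       (auto simp: norm_mult mult.commute[of B] intro!: mult_left_mono)
  finally show ?thesis by (simp add: phi_def)
qed

lemma sum_src_le:
  assumes M: "slice M" and B: "\<And>x. norm (M x t) \<le> B" and A: "finite A"
  shows "(\<Sum>m\<in>A. (norm (src m M t))\<^sup>2) \<le> B\<^sup>2 * v2 t"
proof -
  have pt: "(norm (U x t * M x t))\<^sup>2 \<le> B\<^sup>2 * (norm (U x t))\<^sup>2" for x
    using power_mono[OF B[of x] norm_ge_zero, of 2]
    by (simp add: norm_mult power_mult_distrib mult.commute mult_right_mono)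
  have i: "integrable X (\<lambda>x. (norm (U x t * M x t))\<^sup>2)"
    by (rule Bochner_Integration.integrable_bound[of X "\<lambda>x. B\<^sup>2 * (norm (U x t))\<^sup>2"])
       (use U_2[of t] U_1[of t] sliceD(5)[OF M, of t] pt in auto)
  have "(\<Sum>m\<in>A. (norm (src m M t))\<^sup>2) \<le> (LINT x|X. (norm (U x t * M x t))\<^sup>2)"
    unfolding src_def by (rule bessel[OF slice_src_integrable[OF M] i A])
  also have "\<dots> \<le> (LINT x|X. B\<^sup>2 * (norm (U x t))\<^sup>2)"
    using i U_2[of t] pt by (intro integral_mono) auto
  finally show ?thesis by (simp add: v2_def)
qed

lemma src_measurable [measurable (raw)]:
  assumes "slice M"
  shows "src m M \<in> borel_measurable borel" and "mode m M \<in> borel_measurable borel"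
proof -
  have [measurable]: "case_prod M \<in> borel_measurable (borel \<Otimes>\<^sub>M borel)" using assms by (rule sliceD)
  have [measurable]: "(\<lambda>p. U (snd p) (fst p)) \<in> borel_measurable (borel \<Otimes>\<^sub>M borel)"
    "(\<lambda>p. M (snd p) (fst p)) \<in> borel_measurable (borel \<Otimes>\<^sub>M borel)"
    by measurable
  show "src m M \<in> borel_measurable borel" unfolding src_def[abs_def] md_def by measurable
  show "mode m M \<in> borel_measurable borel" unfolding mode_def[abs_def] md_def by measurable
qed

lemma norm_mode_le:
  assumes "slice M" "\<And>x. norm (M x t) \<le> B"
  shows "norm (mode m M t) \<le> B"
  unfolding mode_def by (rule norm_md_le_bound) (use assms in \<open>auto intro: sliceD\<close>)

lemma src_integrable:
  assumes M: "slice M" and B: "\<And>x t. t \<in> S \<Longrightarrow> norm (M x t) \<le> B" and [measurable]: "S \<in> sets borel"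
    and E: "e \<in> borel_measurable borel" "\<And>t. t \<in> S \<Longrightarrow> norm (e t) \<le> C"
  shows "set_integrable lborel S (\<lambda>t. e t * src m M t)"
proof (rule set_integrable_bound[of _ _ "\<lambda>t. C * (B * phi t)"])
  show "set_borel_measurable lborel S (\<lambda>t. e t * src m M t)"
    unfolding set_borel_measurable_def using src_measurable(1)[OF M] E(1) by measurable
  show "AE t in lborel. t \<in> S \<longrightarrow> norm (e t * src m M t) \<le> norm (C * (B * phi t))"
  proof (intro AE_I2 impI)
    fix t assume "t \<in> S"
    then have "norm (e t * src m M t) \<le> C * (B * phi t)"
      unfolding norm_mult using norm_src_le[OF M B, of t m] E(2)[of t]
      by (intro mult_mono) (auto intro: order.trans[OF norm_ge_zero])
    then show "norm (e t * src m M t) \<le> norm (C * (B * phi t))" by simp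
  qed
qed (intro set_integrable_mult_right phi_set, simp)

lemma Re_a: "Re (a z m) = w * of_int m * (w * of_int m + 2 * Re z)"
  by (simp add: a_def power2_eq_square algebra_simps)

text \<open>The threshold is chosen so that the drift \<open>2 w m Re z\<close> consumes at most
  half of the quadratic term.\<close>

lemma Re_a_large:
  assumes "\<bar>Re z\<bar> \<le> S" "4 * S \<le> w * \<bar>of_int m\<bar>"
  shows "w\<^sup>2 * (of_int m)\<^sup>2 / 2 \<le> Re (a z m)"
proof -
  have "2 * \<bar>Re z\<bar> \<le> w * \<bar>of_int m\<bar> / 2" using assms by linarith
  then have "w * \<bar>of_int m\<bar> * (2 * \<bar>Re z\<bar>) \<le> w * \<bar>of_int m\<bar> * (w * \<bar>of_int m\<bar> / 2)"
    using w_pos by (intro mult_left_mono) auto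
  also have "\<dots> = w\<^sup>2 * (of_int m)\<^sup>2 / 2" by (simp add: power2_eq_square)
  finally have "\<bar>w * of_int m * (2 * Re z)\<bar> \<le> w\<^sup>2 * (of_int m)\<^sup>2 / 2"
    using w_pos by (simp add: abs_mult)
  moreover have "Re (a z m) = w\<^sup>2 * (of_int m)\<^sup>2 + w * of_int m * (2 * Re z)"
    by (simp add: Re_a power2_eq_square algebra_simps)
  ultimately show ?thesis by linarith
qed

lemma exp_src_integrable:
  assumes M: "slice M" and B: "\<And>x t. y0 < t \<Longrightarrow> t \<le> y \<Longrightarrow> norm (M x t) \<le> B"
  shows "set_integrable lborel {y0<..y} (\<lambda>t. exp (- r * (y - t)) * norm (src m M t))"
proof -
  have "set_integrable lborel {y0<..y} (\<lambda>t. of_real (exp (- r * (y - t))) * src m M t)"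
  proof (rule src_integrable[OF M])
    show "norm (M x t) \<le> B" if "t \<in> {y0<..y}" for x t using B that by auto
    show "norm (complex_of_real (exp (- r * (y - t)))) \<le> exp (\<bar>r\<bar> * (y - y0))" if "t \<in> {y0<..y}" for t
    proof -
      have "- r * (y - t) \<le> \<bar>r\<bar> * (y - y0)"
        using that by (intro mult_mono) auto
      then show ?thesis by simp
    qed
  qed measurable
  then have "set_integrable lborel {y0<..y} (\<lambda>t. norm (of_real (exp (- r * (y - t))) * src m M t))"
    by (rule set_integrable_norm)
  then show ?thesis by (simp add: norm_mult)
qed

lemma evo_norm_le:
  assumes M: "slice M" "evo z M" and B: "\<And>x t. y0 < t \<Longrightarrow> t \<le> y \<Longrightarrow> norm (M x t) \<le> B" and y: "y0 \<le> y"
  shows "norm (mode m M y) \<le> exp (- Re (a z m) * (y - y0)) * norm (mode m M y0)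
           + (LBINT t:{y0<..y}. exp (- Re (a z m) * (y - t)) * norm (src m M t))"
proof -
  have "norm (LBINT t:{y0<..y}. exp (- a z m * of_real (y - t)) * src m M t)
      \<le> (LBINT t:{y0<..y}. exp (- Re (a z m) * (y - t)) * norm (src m M t))"
    by (rule norm_set_integral_le[OF exp_src_integrable[OF M(1) B]]) (auto simp: norm_mult)
  moreover have "mode m M y = exp (- a z m * of_real (y - y0)) * mode m M y0
      + (LBINT t:{y0<..y}. exp (- a z m * of_real (y - t)) * src m M t)"
    using M(2) y by (auto simp: evo_def lsol_def)
  ultimately show ?thesis
    by (metis (no_types, lifting) norm_exp_real_mult norm_mult norm_triangle_mono order_refl)
qed

lemma src_square_integrable:
  assumes M: "slice M" and B: "\<And>x t. t \<in> S \<Longrightarrow> norm (M x t) \<le> B" and [measurable]: "S \<in> sets borel"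
  shows "set_integrable lborel S (\<lambda>t. (norm (src m M t))\<^sup>2)"
proof (rule set_integrable_bound[of _ _ "\<lambda>t. B\<^sup>2 * v2 t"])
  show "set_borel_measurable lborel S (\<lambda>t. (norm (src m M t))\<^sup>2)"
    unfolding set_borel_measurable_def using src_measurable(1)[OF M] by measurable
  show "AE t in lborel. t \<in> S \<longrightarrow> norm ((norm (src m M t))\<^sup>2) \<le> norm (B\<^sup>2 * v2 t)"
  proof (intro AE_I2 impI)
    fix t assume "t \<in> S"
    then show "norm ((norm (src m M t))\<^sup>2) \<le> norm (B\<^sup>2 * v2 t)"
      using sum_src_le[OF M B, of t "{m}"] by (auto intro: order.trans[OF _ abs_ge_self])
  qed
qed (intro set_integrable_mult_right v2_set, simp)

text \<open>The high modes are small, uniformly in \<open>z\<close>: by AM-GM, \<open>e s \<le> Z e\<^sup>2 / (2 \<lambda>) + \<lambda> s\<^sup>2 / (2 Z)\<close>,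
  the first part is summable because the decay rate grows like \<open>m\<^sup>2\<close>, the second one by Bessel's inequality.\<close>

lemma mode_tail:
  assumes \<delta>: "0 < \<delta>"
  obtains R :: nat where
    "\<And>z m. \<bar>Re z\<bar> \<le> S \<Longrightarrow> int R < \<bar>m\<bar> \<Longrightarrow> 0 < Re (a z m)"
    "\<And>z M Z y1 A. \<bar>Re z\<bar> \<le> S \<Longrightarrow> slice M \<Longrightarrow> evo z M \<Longrightarrow> 0 < Z \<Longrightarrow> (\<And>x t. t \<le> y1 \<Longrightarrow> norm (M x t) \<le> Z) \<Longrightarrow>
       finite A \<Longrightarrow> (\<And>m. m \<in> A \<Longrightarrow> int R < \<bar>m\<bar>) \<Longrightarrow> (\<Sum>m\<in>A. norm (mode m M y1)) \<le> \<delta> * Z"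
proof -
  \<comment> \<open>The AM-GM weight. The Bessel part contributes at most
    \<open>lam V Z / 2\<close>, that is at most \<open>\<delta> Z / 2\<close>; the summand 1 covers
    the case \<open>V = 0\<close>.\<close>
  define lam where "lam = \<delta> / (V + 1)"
  have lam: "0 < lam" "lam * V \<le> \<delta>"
    using \<delta> V_nonneg by (auto simp: lam_def field_simps add_pos_nonneg)
  \<comment> \<open>Three demands on \<open>R\<close>: it is positive, the rates beyond it are at
    least half the quadratic term, and the tail of \<open>1 / m^2\<close> makes the first AM-GM part
    at most \<open>\<delta> Z / 2\<close>.\<close>
  obtain R :: nat where R: "max 1 (max (4 * S / w) (2 / (lam * w\<^sup>2 * \<delta>))) \<le> R"
    using real_arch_simple by blast
  have R1: "1 \<le> R" "0 < R" and R2: "4 * S \<le> w * R" and R3: "2 \<le> lam * w\<^sup>2 * \<delta> * R"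
    using R w_pos lam \<delta> by (auto simp: field_simps)
  have big: "w\<^sup>2 * (of_int m)\<^sup>2 / 2 \<le> Re (a z m)" "0 < w\<^sup>2 * (of_int m)\<^sup>2" if "\<bar>Re z\<bar> \<le> S" "int R < \<bar>m\<bar>" for z m
  proof -
    have "real R \<le> \<bar>of_int m\<bar>" using that by linarith
    then have "4 * S \<le> w * \<bar>of_int m\<bar>" using R2 w_pos mult_left_mono[of "real R" "\<bar>of_int m\<bar>" w] by linarith
    then show "w\<^sup>2 * (of_int m)\<^sup>2 / 2 \<le> Re (a z m)" using that(1) by (intro Re_a_large) auto
    show "0 < w\<^sup>2 * (of_int m)\<^sup>2" using w_pos R1 that by auto
  qed
  show thesis
  proof (rule that)
    show "0 < Re (a z m)" if "\<bar>Re z\<bar> \<le> S" "int R < \<bar>m\<bar>" for z m using big[OF that] by linarith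
  next
    fix z :: complex and M Z y1 and A :: "int set"
    assume z: "\<bar>Re z\<bar> \<le> S" and M: "slice M" "evo z M" and Z: "0 < Z"
      and B: "\<And>x t. t \<le> y1 \<Longrightarrow> norm (M x t) \<le> Z"
      and A: "finite A" "\<And>m. m \<in> A \<Longrightarrow> int R < \<bar>m\<bar>"
    define r where "r m = Re (a z m)" for m
    have r: "0 < r m" "w\<^sup>2 * (of_int m)\<^sup>2 \<le> 2 * r m" "0 < w\<^sup>2 * (of_int m)\<^sup>2" if "m \<in> A" for m
      using big[OF z A(2)[OF that]] unfolding r_def by linarith+
    \<comment> \<open>The estimate is made from an arbitrary starting point \<open>y0\<close>; only
      the contribution of the data at \<open>y0\<close> depends on it.\<close>
    have step: "(\<Sum>m\<in>A. norm (mode m M y1)) \<le> (\<Sum>m\<in>A. exp (- r m * (y1 - y0)) * Z) + \<delta> * Z" if y0: "y0 \<le> y1" for y0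
    proof -
      let ?I = "{y0<..y1}"
      have sq: "set_integrable lborel ?I (\<lambda>t. (norm (src m M t))\<^sup>2)" for m
        by (rule src_square_integrable[OF M(1)]) (use B in auto)
      have one: "norm (mode m M y1) \<le> exp (- r m * (y1 - y0)) * Z + Z / (2 * lam) * (1 / (w\<^sup>2 * (of_int m)\<^sup>2))
          + lam / (2 * Z) * (LBINT t:?I. (norm (src m M t))\<^sup>2)" if m: "m \<in> A" for m
      proof -
        note e = exp_integral_le[of "2 * r m", OF _ y0]
        have "norm (mode m M y1) \<le> exp (- r m * (y1 - y0)) * norm (mode m M y0)
            + (LBINT t:?I. exp (- r m * (y1 - t)) * norm (src m M t))"
          unfolding r_def by (rule evo_norm_le[OF M, where B = Z]) (use B y0 in auto)
        also have "exp (- r m * (y1 - y0)) * norm (mode m M y0) \<le> exp (- r m * (y1 - y0)) * Z"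
          by (intro mult_left_mono norm_mode_le[OF M(1)]) (use B y0 in auto)
        also have "(LBINT t:?I. exp (- r m * (y1 - t)) * norm (src m M t))
           \<le> (LBINT t:?I. Z / (2 * lam) * exp (- (2 * r m) * (y1 - t)) + lam / (2 * Z) * (norm (src m M t))\<^sup>2)"
        proof (rule set_integral_mono)
          show "set_integrable lborel ?I (\<lambda>t. exp (- r m * (y1 - t)) * norm (src m M t))"
            by (rule exp_src_integrable[OF M(1)]) (use B in auto)
          show "set_integrable lborel ?I (\<lambda>t. Z / (2 * lam) * exp (- (2 * r m) * (y1 - t)) + lam / (2 * Z) * (norm (src m M t))\<^sup>2)"
            using e(1) r[OF m] sq by (intro set_integral_add set_integrable_mult_right) auto
          fix t
          let ?e = "exp (- r m * (y1 - t))" and ?s = "norm (src m M t)"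
          have "0 \<le> (Z * ?e - lam * ?s)\<^sup>2 / (2 * lam * Z)" using Z lam by auto
          also have "\<dots> = Z / (2 * lam) * ?e\<^sup>2 + lam / (2 * Z) * ?s\<^sup>2 - ?e * ?s"
            using Z lam by (simp add: power2_diff field_simps power2_eq_square)
          also have "?e\<^sup>2 = exp (- (2 * r m) * (y1 - t))"
            by (simp add: exp_double[symmetric] power2_eq_square exp_add[symmetric] algebra_simps)
          finally show "?e * ?s \<le> Z / (2 * lam) * exp (- (2 * r m) * (y1 - t)) + lam / (2 * Z) * ?s\<^sup>2" by simp
        qed
        also have "\<dots> = Z / (2 * lam) * (LBINT t:?I. exp (- (2 * r m) * (y1 - t))) + lam / (2 * Z) * (LBINT t:?I. (norm (src m M t))\<^sup>2)"
          using e(1) r[OF m] sq[of m] by (subst set_integral_add) auto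
        also have "(LBINT t:?I. exp (- (2 * r m) * (y1 - t))) \<le> 1 / (w\<^sup>2 * (of_int m)\<^sup>2)"
          using e(2) r[OF m] by (intro order.trans[OF e(2)] frac_le) auto
        finally show ?thesis using Z lam by (simp add: mult_left_mono divide_right_mono add.assoc)
      qed
      have "(\<Sum>m\<in>A. norm (mode m M y1)) \<le> (\<Sum>m\<in>A. exp (- r m * (y1 - y0)) * Z)
          + Z / (2 * lam * w\<^sup>2) * (\<Sum>m\<in>A. 1 / (of_int m)\<^sup>2)
          + lam / (2 * Z) * (\<Sum>m\<in>A. LBINT t:?I. (norm (src m M t))\<^sup>2)"
      proof -
        have "(\<Sum>m\<in>A. norm (mode m M y1)) \<le> (\<Sum>m\<in>A. exp (- r m * (y1 - y0)) * Z + Z / (2 * lam) * (1 / (w\<^sup>2 * (of_int m)\<^sup>2))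
          + lam / (2 * Z) * (LBINT t:?I. (norm (src m M t))\<^sup>2))"
          by (rule sum_mono[OF one])
        also have "\<dots> = (\<Sum>m\<in>A. exp (- r m * (y1 - y0)) * Z)
          + Z / (2 * lam * w\<^sup>2) * (\<Sum>m\<in>A. 1 / (of_int m)\<^sup>2)
          + lam / (2 * Z) * (\<Sum>m\<in>A. LBINT t:?I. (norm (src m M t))\<^sup>2)"
          by (simp add: sum.distrib sum_distrib_left mult.assoc)
        finally show ?thesis .
      qed
      also have "Z / (2 * lam * w\<^sup>2) * (\<Sum>m\<in>A. 1 / (of_int m)\<^sup>2) \<le> Z / (2 * lam * w\<^sup>2) * (2 / real R)"
        using Z lam A R1 by (intro mult_left_mono sum_inverse_squares_tail) auto
      also have "\<dots> \<le> \<delta> * Z / 2"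
        using Z lam w_pos R3 R1 mult_right_mono[OF R3, of Z] by (simp add: field_simps)
      also have "(\<Sum>m\<in>A. LBINT t:?I. (norm (src m M t))\<^sup>2) = (LBINT t:?I. (\<Sum>m\<in>A. (norm (src m M t))\<^sup>2))"
        unfolding set_lebesgue_integral_def scaleR_sum_right
        using sq by (subst Bochner_Integration.integral_sum) (auto simp: set_integrable_def)
      also have "\<dots> \<le> (LBINT t:?I. Z\<^sup>2 * v2 t)"
      proof (rule set_integral_mono)
        show "set_integrable lborel ?I (\<lambda>t. \<Sum>m\<in>A. (norm (src m M t))\<^sup>2)"
          unfolding set_integrable_def scaleR_sum_right
          using sq by (intro Bochner_Integration.integrable_sum) (auto simp: set_integrable_def)
        show "set_integrable lborel ?I (\<lambda>t. Z\<^sup>2 * v2 t)" by (intro set_integrable_mult_right v2_set) auto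
        show "(\<Sum>m\<in>A. (norm (src m M t))\<^sup>2) \<le> Z\<^sup>2 * v2 t" if "t \<in> ?I" for t
          by (rule sum_src_le[OF M(1) _ A(1)]) (use B that in auto)
      qed
      also have "\<dots> \<le> Z\<^sup>2 * V" using set_v2_le[of ?I] by (simp add: mult_left_mono)
      finally have "(\<Sum>m\<in>A. norm (mode m M y1)) \<le> (\<Sum>m\<in>A. exp (- r m * (y1 - y0)) * Z) + \<delta> * Z / 2 + lam / (2 * Z) * (Z\<^sup>2 * V)"
        using Z lam by (simp add: mult_left_mono divide_right_mono)
      also have "lam / (2 * Z) * (Z\<^sup>2 * V) \<le> \<delta> * Z / 2"
        using Z mult_right_mono[OF lam(2), of Z] by (simp add: power2_eq_square field_simps)
      finally show ?thesis by (simp add: mult.commute)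
    qed
    \<comment> \<open>Moving the starting point to -\<infinity> extinguishes the data at
      \<open>y0\<close>, because all rates are positive and \<open>A\<close> is finite.\<close>
    have "(\<lambda>n. (\<Sum>m\<in>A. exp (- r m * (y1 - (y1 - real n))) * Z) + \<delta> * Z) \<longlonglongrightarrow> (\<Sum>m\<in>A. 0 * Z) + \<delta> * Z"
    proof (intro tendsto_intros)
      fix m assume "m \<in> A"
      then have "0 < r m" by (rule r)
      then have "filterlim (\<lambda>n. - (r m * real n)) at_bot sequentially"
        by (simp add: filterlim_uminus_at_bot) (intro filterlim_tendsto_pos_mult_at_top[OF tendsto_const] filterlim_real_sequentially)
      then have "(\<lambda>n. exp (- (r m * real n))) \<longlonglongrightarrow> 0"
        by (rule filterlim_compose[OF exp_at_bot])
      then show "(\<lambda>n. exp (- r m * (y1 - (y1 - real n)))) \<longlonglongrightarrow> 0" by simp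
    qed
    moreover have "\<exists>N. \<forall>n\<ge>N. (\<Sum>m\<in>A. norm (mode m M y1)) \<le> (\<Sum>m\<in>A. exp (- r m * (y1 - (y1 - real n))) * Z) + \<delta> * Z"
      by (intro exI allI impI step) simp
    ultimately have "(\<Sum>m\<in>A. norm (mode m M y1)) \<le> (\<Sum>m\<in>A. 0 * Z) + \<delta> * Z"
      by (rule LIMSEQ_le_const)
    then show "(\<Sum>m\<in>A. norm (mode m M y1)) \<le> \<delta> * Z" by simp
  qed
qed

end

text \<open>Gaussian elimination by induction on the equations. Arbitrary finite index sets are
  allowed because the unknowns will be the functions of the uniqueness proof and the equations its
  unstable modes.\<close>

lemma homogeneous_system_nontrivial:
  fixes A :: "'e \<Rightarrow> 'i \<Rightarrow> 'f::field"
  assumes "finite E" "finite I" "card E < card I"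
  obtains v where "\<exists>i\<in>I. v i \<noteq> 0" "\<And>e. e \<in> E \<Longrightarrow> (\<Sum>i\<in>I. v i * A e i) = 0"
proof -
  have "\<exists>v. (\<exists>i\<in>I. v i \<noteq> 0) \<and> (\<forall>e\<in>E. (\<Sum>i\<in>I. v i * A e i) = 0)"
    using assms
  proof (induction E arbitrary: I A)
    case empty
    then have "I \<noteq> {}" by auto
    then show ?case by (intro exI[of _ "\<lambda>_. 1"]) auto
  next
    case (insert e E)
    show ?case
    proof (cases "\<forall>i\<in>I. A e i = 0")
      case True
      then show ?thesis using insert.IH[of I A] insert.prems insert.hyps by auto
    next
      case False
      then obtain k where k: "k \<in> I" "A e k \<noteq> 0" by auto
      \<comment> \<open>The remaining equations after the unknown \<open>k\<close> has been
        eliminated with the pivot \<open>A e k\<close>.\<close>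
      define A' where "A' e' i = A e' i - A e' k * A e i / A e k" for e' i
      have "card E < card (I - {k})" using insert.prems insert.hyps k by simp
      then obtain v where v: "\<exists>i\<in>I - {k}. v i \<noteq> 0" "\<forall>e'\<in>E. (\<Sum>i\<in>I - {k}. v i * A' e' i) = 0"
        using insert.IH[of "I - {k}" A'] insert.prems by auto
      define s where "s = (\<Sum>i\<in>I - {k}. v i * A e i)"
      \<comment> \<open>Back substitution: the value at \<open>k\<close> is forced by equation
        \<open>e\<close>.\<close>
      define u where "u = v(k := - s / A e k)"
      have split: "(\<Sum>i\<in>I. u i * A e' i) = - s / A e k * A e' k + (\<Sum>i\<in>I - {k}. v i * A e' i)" for e'
      proof -
        have "(\<Sum>i\<in>I. u i * A e' i) = u k * A e' k + (\<Sum>i\<in>I - {k}. u i * A e' i)"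
          using insert.prems k by (subst sum.remove[of _ k]) auto
        also have "(\<Sum>i\<in>I - {k}. u i * A e' i) = (\<Sum>i\<in>I - {k}. v i * A e' i)"
          by (intro sum.cong) (auto simp: u_def)
        finally show ?thesis by (simp add: u_def)
      qed
      have "(\<Sum>i\<in>I. u i * A e i) = 0" unfolding split using k by (simp add: s_def)
      moreover have "(\<Sum>i\<in>I. u i * A e' i) = 0" if "e' \<in> E" for e'
      proof -
        have "(\<Sum>i\<in>I - {k}. v i * A' e' i) = (\<Sum>i\<in>I - {k}. v i * A e' i) - A e' k / A e k * s"
          unfolding A'_def s_def sum_distrib_left sum_subtractf[symmetric]
          by (intro sum.cong) (auto simp: algebra_simps)
        then show ?thesis unfolding split using v(2) that by simp
      qed
      moreover have "\<exists>i\<in>I. u i \<noteq> 0" using v(1) by (auto simp: u_def)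
      ultimately show ?thesis by auto
    qed
  qed
  then show thesis using that by blast
qed

section \<open>Solutions bounded to the left: contraction and continuation\<close>

context potential begin

text \<open>The homogeneous problem is posed in a linear space of functions that are bounded on left
  half-cylinders only, since the gauge-transformed solutions may grow exponentially as
  \<open>y\<close> tends to +\<infinity>.\<close>

definition adm :: "complex \<Rightarrow> (real \<Rightarrow> real \<Rightarrow> complex) \<Rightarrow> bool" where
  "adm z M \<longleftrightarrow> slice M \<and> evo z M \<and> (\<forall>y1. \<exists>B. \<forall>x. \<forall>t\<le>y1. norm (M x t) \<le> B)"

lemma slice_cmult: "slice M \<Longrightarrow> slice (\<lambda>x y. c * M x y)"
  unfolding slice_def by (auto intro!: continuous_intros)

lemma slice_add: "slice M \<Longrightarrow> slice N \<Longrightarrow> slice (\<lambda>x y. M x y + N x y)"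
  unfolding slice_def by (auto intro!: continuous_intros)

lemma mode_add: "slice M \<Longrightarrow> slice N \<Longrightarrow> mode m (\<lambda>x y. M x y + N x y) y = mode m M y + mode m N y"
  by (simp add: mode_def md_add sliceD)

lemma mode_cmult: "mode m (\<lambda>x y. c * M x y) y = c * mode m M y"
  by (simp add: mode_def md_cmult)

lemma src_add: "slice M \<Longrightarrow> slice N \<Longrightarrow> src m (\<lambda>x y. M x y + N x y) t = src m M t + src m N t"
  by (simp add: src_def ring_distribs md_add slice_src_integrable)

lemma src_cmult: "src m (\<lambda>x y. c * M x y) t = c * src m M t"
  using md_cmult[of m c "\<lambda>x. U x t * M x t"] by (simp add: src_def mult_ac)

lemma exp_src_integrable_complex:
  fixes \<alpha> :: complex
  assumes M: "slice M" and B: "\<And>x t. y0 < t \<Longrightarrow> t \<le> y \<Longrightarrow> norm (M x t) \<le> B"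
  shows "set_integrable lborel {y0<..y} (\<lambda>t. exp (- \<alpha> * of_real (y - t)) * src m M t)"
proof (rule src_integrable[OF M])
  show "norm (M x t) \<le> B" if "t \<in> {y0<..y}" for x t using B that by auto
  show "norm (exp (- \<alpha> * complex_of_real (y - t))) \<le> exp (\<bar>Re \<alpha>\<bar> * (y - y0))" if "t \<in> {y0<..y}" for t
  proof -
    have "- Re \<alpha> * (y - t) \<le> \<bar>Re \<alpha>\<bar> * (y - y0)" using that by (intro mult_mono) auto
    then show ?thesis by simp
  qed
  show "(\<lambda>t. exp (- \<alpha> * complex_of_real (y - t))) \<in> borel_measurable borel"
    by (intro borel_measurable_continuous_onI continuous_intros)
qed simp

lemma adm_exp_src_integrable:
  fixes \<alpha> :: complex
  assumes "adm z M"
  shows "set_integrable lborel {y0<..y} (\<lambda>t. exp (- \<alpha> * of_real (y - t)) * src m M t)"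
proof -
  obtain B where "\<forall>x. \<forall>t\<le>y. norm (M x t) \<le> B" using assms unfolding adm_def by blast
  then show ?thesis using assms by (intro exp_src_integrable_complex[where B=B]) (auto simp: adm_def)
qed

lemma adm_cmult:
  assumes "adm z M"
  shows "adm z (\<lambda>x y. c * M x y)"
  unfolding adm_def
proof (intro conjI allI)
  show "slice (\<lambda>x y. c * M x y)" using assms by (auto simp: adm_def slice_cmult)
  have 1: "src m (\<lambda>x y. c * M x y) = (\<lambda>t. c * src m M t)" "mode m (\<lambda>x y. c * M x y) = (\<lambda>y. c * mode m M y)" for m
    by (auto simp: src_cmult mode_cmult)
  have "lsol \<alpha> (\<lambda>t. c * f t) (\<lambda>y. c * g y)" if "lsol \<alpha> f g" for \<alpha> f g
    unfolding lsol_def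
  proof (intro allI impI)
    fix y0 y :: real assume "y0 \<le> y"
    have "(LBINT t:{y0<..y}. exp (- \<alpha> * of_real (y - t)) * (c * f t)) = (LBINT t:{y0<..y}. c * (exp (- \<alpha> * of_real (y - t)) * f t))"
      by (simp add: mult_ac)
    also have "\<dots> = c * (LBINT t:{y0<..y}. exp (- \<alpha> * of_real (y - t)) * f t)" by simp
    finally show "c * g y = exp (- \<alpha> * of_real (y - y0)) * (c * g y0) + (LBINT t:{y0<..y}. exp (- \<alpha> * of_real (y - t)) * (c * f t))"
      using that \<open>y0 \<le> y\<close> by (simp add: lsol_def ring_distribs mult_ac)
  qed
  then show "evo z (\<lambda>x y. c * M x y)" using assms by (auto simp: adm_def evo_def 1)
  fix y1
  obtain B where "\<forall>x. \<forall>t\<le>y1. norm (M x t) \<le> B" using assms unfolding adm_def by blast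
  then show "\<exists>B. \<forall>x. \<forall>t\<le>y1. norm (c * M x t) \<le> B"
    by (intro exI[of _ "norm c * B"]) (auto simp: norm_mult intro!: mult_left_mono)
qed

lemma adm_add:
  assumes M: "adm z M" and N: "adm z N"
  shows "adm z (\<lambda>x y. M x y + N x y)"
  unfolding adm_def
proof (intro conjI allI)
  have s: "slice M" "slice N" using assms by (auto simp: adm_def)
  show "slice (\<lambda>x y. M x y + N x y)" using s by (rule slice_add)
  show "evo z (\<lambda>x y. M x y + N x y)"
    unfolding evo_def lsol_def
  proof (intro allI impI)
    fix m and y0 y :: real assume y: "y0 \<le> y"
    have eq: "mode m K y = exp (- a z m * of_real (y - y0)) * mode m K y0 + (LBINT t:{y0<..y}. exp (- a z m * of_real (y - t)) * src m K t)"
      if "adm z K" for K using that y unfolding adm_def evo_def lsol_def by blast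
    have "(LBINT t:{y0<..y}. exp (- a z m * of_real (y - t)) * src m (\<lambda>x y. M x y + N x y) t)
       = (LBINT t:{y0<..y}. exp (- a z m * of_real (y - t)) * src m M t) + (LBINT t:{y0<..y}. exp (- a z m * of_real (y - t)) * src m N t)"
      unfolding src_add[OF s] ring_distribs by (intro set_integral_add(2) adm_exp_src_integrable[OF M] adm_exp_src_integrable[OF N])
    then show "mode m (\<lambda>x y. M x y + N x y) y = exp (- a z m * of_real (y - y0)) * mode m (\<lambda>x y. M x y + N x y) y0
       + (LBINT t:{y0<..y}. exp (- a z m * of_real (y - t)) * src m (\<lambda>x y. M x y + N x y) t)"
      using eq[OF M] eq[OF N] by (simp add: mode_add[OF s] ring_distribs)
  qed
  fix y1
  obtain B C where "\<forall>x. \<forall>t\<le>y1. norm (M x t) \<le> B" "\<forall>x. \<forall>t\<le>y1. norm (N x t) \<le> C"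
    using assms unfolding adm_def by blast
  then show "\<exists>B. \<forall>x. \<forall>t\<le>y1. norm (M x t + N x t) \<le> B"
    by (intro exI[of _ "B + C"]) (auto intro!: norm_triangle_mono)
qed

lemma adm_0: "adm z (\<lambda>x y. 0)"
proof -
  have "md m (\<lambda>x. 0) = 0" for m using md_const[of m 0] by simp
  then show ?thesis
    by (auto simp: adm_def slice_def evo_def lsol_def mode_def src_def set_lebesgue_integral_def)
qed

lemma adm_sum:
  assumes "finite I" "\<And>i. i \<in> I \<Longrightarrow> adm z (F i)"
  shows "adm z (\<lambda>x y. \<Sum>i\<in>I. v i * F i x y)"
    and "mode m (\<lambda>x y. \<Sum>i\<in>I. v i * F i x y) y = (\<Sum>i\<in>I. v i * mode m (F i) y)"
proof -
  have "adm z (\<lambda>x y. \<Sum>i\<in>I. v i * F i x y) \<and>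
    mode m (\<lambda>x y. \<Sum>i\<in>I. v i * F i x y) y = (\<Sum>i\<in>I. v i * mode m (F i) y)"
    using assms
  proof (induction I)
    case empty
    then show ?case using md_const[of m 0] by (simp add: adm_0 mode_def)
  next
    case (insert i I)
    then have "adm z (F i)" and *: "adm z (\<lambda>x y. \<Sum>i\<in>I. v i * F i x y)" by auto
    then have i: "adm z (\<lambda>x y. v i * F i x y)" by (intro adm_cmult)
    then show ?case using adm_add[OF i *] mode_add[of "\<lambda>x y. v i * F i x y" "\<lambda>x y. \<Sum>i\<in>I. v i * F i x y"] * insert
      by (simp add: adm_def mode_cmult)
  qed
  then show "adm z (\<lambda>x y. \<Sum>i\<in>I. v i * F i x y)"
    "mode m (\<lambda>x y. \<Sum>i\<in>I. v i * F i x y) y = (\<Sum>i\<in>I. v i * mode m (F i) y)" by auto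
qed

lemma norm_src_integral_le:
  assumes M: "slice M" and B: "\<And>x t. t \<in> {y0<..y} \<Longrightarrow> norm (M x t) \<le> Z"
    and e: "\<And>t. t \<in> {y0<..y} \<Longrightarrow> norm (e t) \<le> C" and y: "y0 \<le> y" and C: "0 \<le> C"
  shows "norm (LBINT t:{y0<..y}. e t * src m M t) \<le> C * Z * (Phi y - Phi y0)"
proof -
  have "norm (LBINT t:{y0<..y}. e t * src m M t) \<le> (LBINT t:{y0<..y}. C * Z * phi t)"
  proof (rule norm_set_integral_le)
    show "norm (e t * src m M t) \<le> C * Z * phi t" if "t \<in> {y0<..y}" for t
      unfolding norm_mult mult.assoc by (intro mult_mono e norm_src_le M B that C) auto
  qed (intro set_integrable_mult_right phi_set, simp)
  then show ?thesis using y by (simp add: Phi_diff)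
qed

text \<open>Only a negative real part of the rate can amplify, hence the \<open>min 0\<close>; for a
  stable mode \<open>C = 1\<close> is admissible.\<close>

lemma mode_step_le:
  assumes M: "slice M" "evo z M" and B: "\<And>x t. t \<in> {y0<..y} \<Longrightarrow> norm (M x t) \<le> Z"
    and y: "y0 \<le> y" and C: "exp (\<bar>min 0 (Re (a z m))\<bar> * (y - y0)) \<le> C"
  shows "norm (mode m M y) \<le> C * norm (mode m M y0) + C * Z * (Phi y - Phi y0)"
proof -
  have e: "exp (- Re (a z m) * s) \<le> C" if "0 \<le> s" "s \<le> y - y0" for s
  proof -
    have "- Re (a z m) * s \<le> \<bar>min 0 (Re (a z m))\<bar> * (y - y0)" using that by (intro mult_mono) auto
    then show ?thesis using C by (meson exp_le_cancel_iff order.trans)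
  qed
  have C0: "0 \<le> C" using e[of 0] y by simp
  have "mode m M y = exp (- a z m * of_real (y - y0)) * mode m M y0 + (LBINT t:{y0<..y}. exp (- a z m * of_real (y - t)) * src m M t)"
    using M(2) y unfolding evo_def lsol_def by blast
  moreover have "norm (LBINT t:{y0<..y}. exp (- a z m * of_real (y - t)) * src m M t) \<le> C * Z * (Phi y - Phi y0)"
    by (rule norm_src_integral_le[OF M(1) B _ y C0]) (use e in auto)
  moreover have "norm (exp (- a z m * of_real (y - y0)) * mode m M y0) \<le> C * norm (mode m M y0)"
    unfolding norm_mult norm_exp_real_mult by (intro mult_right_mono e) (use y in auto)
  ultimately show ?thesis using norm_triangle_mono by fastforce
qed

text \<open>Follow the mode from a starting point \<open>s\<close> that recedes to -\<infinity>: the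
  data vanish in the limit, and the source contributes at most the mass to the left of
  \<open>y0\<close>.\<close>

lemma low_mode_stable:
  assumes M: "slice M" "evo z M" and B: "\<And>x t. t \<le> y0 \<Longrightarrow> norm (M x t) \<le> Z" and Z: "0 < Z"
    and r: "0 \<le> Re (a z m)" and lim: "((\<lambda>y. mode m M y) \<longlongrightarrow> 0) at_bot" and y: "y \<le> y0"
  shows "norm (mode m M y) \<le> Z * Phi y0"
proof -
  have "norm (mode m M y) \<le> norm (mode m M s) + Z * Phi y0" if "s \<le> y" for s
  proof -
    have "norm (mode m M y) \<le> 1 * norm (mode m M s) + 1 * Z * (Phi y - Phi s)"
      by (rule mode_step_le[OF M]) (use B r y that in auto)
    moreover have "Z * (Phi y - Phi s) \<le> Z * Phi y0"
      using Z Phi_mono[OF y] Phi_nonneg[of s] by (intro mult_left_mono) auto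
    ultimately show ?thesis by simp
  qed
  then have ev: "eventually (\<lambda>s. norm (mode m M y) \<le> norm (mode m M s) + Z * Phi y0) at_bot"
    by (auto intro: eventually_mono[OF eventually_le_at_bot[of y]])
  have "((\<lambda>s. norm (mode m M s) + Z * Phi y0) \<longlongrightarrow> norm (0::complex) + Z * Phi y0) at_bot"
    by (intro tendsto_intros lim)
  from tendsto_lowerbound[OF this ev] show ?thesis by simp
qed

text \<open>The formula is solved backwards from \<open>y0\<close>, where the mode vanishes. The
  growth factor of the source is at most that of the data, and the two cancel.\<close>

lemma low_mode_unstable:
  assumes M: "slice M" "evo z M" and B: "\<And>x t. t \<le> y0 \<Longrightarrow> norm (M x t) \<le> Z" and Z: "0 < Z"
    and r: "Re (a z m) \<le> 0" and zero: "mode m M y0 = 0" and y: "y \<le> y0"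
  shows "norm (mode m M y) \<le> Z * Phi y0"
proof -
  let ?C = "exp (- Re (a z m) * (y0 - y))"
  have "mode m M y0 = exp (- a z m * of_real (y0 - y)) * mode m M y + (LBINT t:{y<..y0}. exp (- a z m * of_real (y0 - t)) * src m M t)"
    using M(2) y unfolding evo_def lsol_def by blast
  then have "exp (- a z m * of_real (y0 - y)) * mode m M y = - (LBINT t:{y<..y0}. exp (- a z m * of_real (y0 - t)) * src m M t)"
    using zero by (simp add: eq_neg_iff_add_eq_0)
  then have "norm (exp (- a z m * of_real (y0 - y)) * mode m M y) = norm (LBINT t:{y<..y0}. exp (- a z m * of_real (y0 - t)) * src m M t)"
    by (metis norm_minus_cancel)
  also have "\<dots> \<le> ?C * Z * (Phi y0 - Phi y)"
  proof (rule norm_src_integral_le[OF M(1)])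
    show "norm (exp (- a z m * complex_of_real (y0 - t))) \<le> ?C" if "t \<in> {y<..y0}" for t
    proof -
      have "- Re (a z m) * (y0 - t) \<le> - Re (a z m) * (y0 - y)"
        using r that by (intro mult_left_mono) auto
      then show ?thesis by simp
    qed
  qed (use B y in auto)
  finally have "?C * norm (mode m M y) \<le> ?C * (Z * (Phi y0 - Phi y))"
    unfolding norm_mult norm_exp_real_mult by (simp add: mult.assoc)
  then have "norm (mode m M y) \<le> Z * (Phi y0 - Phi y)" by simp
  also have "\<dots> \<le> Z * Phi y0" using Z Phi_nonneg[of y] by (intro mult_left_mono) auto
  finally show ?thesis .
qed

text \<open>The conclusion of \<open>mode_tail\<close> for \<open>\<delta> = 1/4\<close>. One
  quarter for the tail and one quarter for the low modes will halve any bound.\<close>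

definition tail_index :: "real \<Rightarrow> nat \<Rightarrow> bool" where
  "tail_index S R \<longleftrightarrow> (\<forall>z m. \<bar>Re z\<bar> \<le> S \<longrightarrow> int R < \<bar>m\<bar> \<longrightarrow> 0 < Re (a z m)) \<and>
    (\<forall>z M Z y1 A. \<bar>Re z\<bar> \<le> S \<longrightarrow> slice M \<longrightarrow> evo z M \<longrightarrow> 0 < Z \<longrightarrow> (\<forall>x. \<forall>t\<le>y1. norm (M x t) \<le> Z) \<longrightarrow>
       finite A \<longrightarrow> (\<forall>m\<in>A. int R < \<bar>m\<bar>) \<longrightarrow> (\<Sum>m\<in>A. norm (mode m M y1)) \<le> Z / 4)"

lemma ex_tail_index: "\<exists>R. tail_index S R"
  using mode_tail[of "1/4" S] unfolding tail_index_def by (metis divide_inverse_commute inverse_eq_divide zero_less_divide_1_iff zero_less_numeral)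

text \<open>The at most \<open>2 R + 1\<close> low modes and the tail each contribute
  \<open>Z / 4\<close> to the sum of moduli, so a bound \<open>Z\<close> improves to
  \<open>Z / 2\<close>. Iteration starts from any bound on the left half-cylinder and ends at
  0.\<close>

lemma contraction_zero:
  assumes \<zeta>: "adm z \<zeta>" and R: "tail_index \<bar>Re z\<bar> R" and \<epsilon>: "(2 * real R + 1) * \<epsilon> \<le> 1/4"
    and low: "\<And>Z m y. 0 < Z \<Longrightarrow> (\<And>x t. t \<le> y1 \<Longrightarrow> norm (\<zeta> x t) \<le> Z) \<Longrightarrow> \<bar>m\<bar> \<le> int R \<Longrightarrow> y \<le> y1 \<Longrightarrow>
        norm (mode m \<zeta> y) \<le> Z * \<epsilon>"
    and y: "y \<le> y1"
  shows "\<zeta> x y = 0"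
proof -
  have sl: "slice \<zeta>" and ev: "evo z \<zeta>" using \<zeta> by (auto simp: adm_def)
  have half: "norm (\<zeta> x y) \<le> Z / 2"
    if Z: "0 < Z" and B: "\<And>x t. t \<le> y1 \<Longrightarrow> norm (\<zeta> x t) \<le> Z" and y: "y \<le> y1" for Z x y
  proof (rule norm_le_sum_fourier[of "\<lambda>x. \<zeta> x y"])
    fix A :: "int set" assume A: "finite A"
    let ?L = "{m\<in>A. \<bar>m\<bar> \<le> int R}" and ?H = "{m\<in>A. int R < \<bar>m\<bar>}"
    have "(\<Sum>m\<in>?L. norm (mode m \<zeta> y)) \<le> (\<Sum>m\<in>?L. Z * \<epsilon>)"
      by (intro sum_mono low Z B y) auto
    also have "\<dots> = real (card ?L) * (Z * \<epsilon>)" by simp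
    also have "\<dots> \<le> (2 * real R + 1) * (Z * \<epsilon>)"
    proof (rule mult_right_mono)
      have "card ?L \<le> card {- int R..int R}" by (intro card_mono) auto
      then show "real (card ?L) \<le> 2 * real R + 1" by simp
      \<comment> \<open>The sign of \<epsilon> is not assumed; it follows from \<open>low\<close>
        itself, applied to mode 0.\<close>
      have "0 \<le> Z * \<epsilon>" using low[OF Z B, of 0 y] y by (auto intro: order.trans[OF norm_ge_zero])
      then show "0 \<le> Z * \<epsilon>" .
    qed
    also have "\<dots> \<le> Z / 4" using mult_right_mono[OF \<epsilon>, of Z] Z by (simp add: mult_ac)
    finally have L: "(\<Sum>m\<in>?L. norm (mode m \<zeta> y)) \<le> Z / 4" .
    have H: "(\<Sum>m\<in>?H. norm (mode m \<zeta> y)) \<le> Z / 4"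
      using R A sl ev Z B y unfolding tail_index_def by auto
    have "A = ?L \<union> ?H" by auto
    then have "(\<Sum>m\<in>A. norm (mode m \<zeta> y)) = (\<Sum>m\<in>?L. norm (mode m \<zeta> y)) + (\<Sum>m\<in>?H. norm (mode m \<zeta> y))"
      using A by (subst sum.union_disjoint[symmetric]) auto
    then show "(\<Sum>m\<in>A. norm (md m (\<lambda>x. \<zeta> x y))) \<le> Z / 2" using L H by (simp add: mode_def)
  qed (use sliceD[OF sl] in auto)
  obtain B0 where B0: "\<forall>x. \<forall>t\<le>y1. norm (\<zeta> x t) \<le> B0" using \<zeta> unfolding adm_def by blast
  define B where "B = \<bar>B0\<bar> + 1"
  have "\<forall>x. \<forall>t\<le>y1. norm (\<zeta> x t) \<le> B / 2 ^ n" for n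
  proof (induction n)
    case 0
    have "norm (\<zeta> x t) \<le> \<bar>B0\<bar> + 1" if "t \<le> y1" for x t
      using B0 that abs_ge_self[of B0] by (smt (verit))
    then show ?case by (simp add: B_def)
  next
    case (Suc n)
    then show ?case using half[of "B / 2 ^ n"] by (auto simp: B_def mult.commute)
  qed
  moreover have "(\<lambda>n. B / 2 ^ n) \<longlonglongrightarrow> 0"
    using LIMSEQ_divide_realpow_zero[of 2 B] by simp
  ultimately have "norm (\<zeta> x y) \<le> 0" using y by (intro LIMSEQ_le_const[of "\<lambda>n. B / 2 ^ n"]) auto
  then show ?thesis by simp
qed

text \<open>On a slab of height at most 1 an unstable mode grows by at most \<open>exp K\<close>, so
  starting from zero data the low modes are controlled by the mass in the slab.\<close>

lemma forward_step:
  assumes \<zeta>: "adm z \<zeta>" and R: "tail_index \<bar>Re z\<bar> R" and K: "\<And>m. \<bar>m\<bar> \<le> int R \<Longrightarrow> \<bar>Re (a z m)\<bar> \<le> K"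
    and zero: "\<And>x t. t \<le> y0 \<Longrightarrow> \<zeta> x t = 0"
    and y: "y0 \<le> y1" "y1 \<le> y0 + 1" and \<epsilon>: "(2 * real R + 1) * (exp K * (Phi y1 - Phi y0)) \<le> 1/4"
    and t: "t \<le> y1"
  shows "\<zeta> x t = 0"
proof (rule contraction_zero[OF \<zeta> R \<epsilon> _ t])
  fix Z m s assume Z: "0 < Z" and B: "\<And>x t. t \<le> y1 \<Longrightarrow> norm (\<zeta> x t) \<le> Z" and m: "\<bar>m\<bar> \<le> int R" and s: "s \<le> y1"
  have K0: "0 \<le> K" using K[OF m] by linarith
  show "norm (mode m \<zeta> s) \<le> Z * (exp K * (Phi y1 - Phi y0))"
  proof (cases "s \<le> y0")
    case True
    then have "mode m \<zeta> s = 0" using zero md_const[of m 0] by (simp add: mode_def)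
    then show ?thesis using Z Phi_mono[OF y(1)] by simp
  next
    case False
    have "mode m \<zeta> y0 = 0" using zero md_const[of m 0] by (simp add: mode_def)
    moreover have "norm (mode m \<zeta> s) \<le> exp K * norm (mode m \<zeta> y0) + exp K * Z * (Phi s - Phi y0)"
    proof (rule mode_step_le[of _ z])
      have "\<bar>min 0 (Re (a z m))\<bar> * (s - y0) \<le> K * 1"
        using K[OF m] False s y K0 by (intro mult_mono) auto
      then show "exp (\<bar>min 0 (Re (a z m))\<bar> * (s - y0)) \<le> exp K" by simp
    qed (use \<zeta> B s False in \<open>auto simp: adm_def\<close>)
    moreover have "exp K * Z * (Phi s - Phi y0) \<le> exp K * Z * (Phi y1 - Phi y0)"
      using Z Phi_mono[OF s] by (intro mult_left_mono) auto
    ultimately show ?thesis by (simp add: mult_ac)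
  qed
qed

text \<open>Continuity method: the supremum of the heights below which \<zeta> vanishes cannot be
  finite, since a slab with little mass reaches beyond it.\<close>

lemma forward_uniqueness:
  assumes \<zeta>: "adm z \<zeta>" and zero: "\<And>x t. t \<le> y0 \<Longrightarrow> \<zeta> x t = 0"
  shows "\<zeta> x y = 0"
proof (rule ccontr)
  assume nz: "\<zeta> x y \<noteq> 0"
  obtain R where R: "tail_index \<bar>Re z\<bar> R" using ex_tail_index by blast
  define K where "K = Max ((\<lambda>m. \<bar>Re (a z m)\<bar>) ` {- int R..int R})"
  have K: "\<bar>Re (a z m)\<bar> \<le> K" if "\<bar>m\<bar> \<le> int R" for m
    unfolding K_def by (rule Max_ge[OF _ imageI]) (use that in auto)
  define S where "S = {s. \<forall>t\<le>s. \<forall>x. \<zeta> x t = 0}"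
  have S: "y0 \<in> S" "s < y" if "s \<in> S" for s
    using zero nz that unfolding S_def by (auto simp: not_less[symmetric])
  have y0S: "y0 \<in> S" using zero by (auto simp: S_def)
  have bdd: "bdd_above S" using S(2) by (auto intro!: bdd_aboveI[of _ y] less_imp_le)
  define s where "s = Sup S"
  have below: "r \<in> S" if "r < s" for r
  proof -
    have "\<exists>r'\<in>S. r < r'" using that less_cSup_iff[OF _ bdd, of r] y0S unfolding s_def by blast
    then obtain r' where "r' \<in> S" "r < r'" by blast
    then show ?thesis by (auto simp: S_def)
  qed
  \<comment> \<open>Exactly the slab mass for which the smallness condition of
    \<open>forward_step\<close> becomes an equality; half of it is allowed on either side of
    \<open>s\<close>.\<close>
  define \<epsilon> where "\<epsilon> = 1 / (4 * (2 * real R + 1) * exp K)"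
  have \<epsilon>: "0 < \<epsilon>" by (auto simp: \<epsilon>_def intro!: divide_pos_pos mult_pos_pos)
  obtain d where d: "0 < d" "\<And>r. \<bar>r - s\<bar> < d \<Longrightarrow> \<bar>Phi r - Phi s\<bar> < \<epsilon> / 2"
    using Phi_isCont[of s] \<epsilon> unfolding continuous_at_eps_delta dist_real_def by (metis half_gt_zero)
  define h where "h = min (d/2) (1/2)"
  have h: "0 < h" "h < d" "h \<le> 1/2" using d by (auto simp: h_def)
  \<comment> \<open>The slab starts at \<open>s - h\<close>, strictly inside the region of
    vanishing, so it does not matter whether the supremum is attained.\<close>
  have "\<zeta> x' t = 0" if "t \<le> s + h" for x' t
  proof (rule forward_step[OF \<zeta> R K _ _ _ _ that])
    show "\<zeta> x t = 0" if "t \<le> s - h" for x t using below[of "s - h"] h that by (auto simp: S_def)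
    have "Phi (s + h) - Phi (s - h) \<le> \<epsilon>"
    proof -
      have "\<bar>Phi (s + h) - Phi s\<bar> < \<epsilon> / 2" "\<bar>Phi (s - h) - Phi s\<bar> < \<epsilon> / 2" using h by (intro d(2); simp)+
      then show ?thesis by linarith
    qed
    then have "(2 * real R + 1) * (exp K * (Phi (s + h) - Phi (s - h))) \<le> (2 * real R + 1) * (exp K * \<epsilon>)"
      by (intro mult_left_mono) auto
    also have "\<dots> = 1/4" by (simp add: \<epsilon>_def field_simps add_nonneg_eq_0_iff)
    finally show "(2 * real R + 1) * (exp K * (Phi (s + h) - Phi (s - h))) \<le> 1/4" .
  qed (use h in auto)
  then have "s + h \<in> S" by (auto simp: S_def)
  then have "s + h \<le> s" unfolding s_def using bdd by (rule cSup_upper)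
  then show False using h by simp
qed

section \<open>Uniqueness\<close>

text \<open>The side from which a resonance line is approached is encoded by the sign of \<open>\<rho>\<close>: on the line a
  mode with \<open>Re (a z m) = 0\<close> is stable or unstable according to the sign of \<open>\<rho> m\<close>. Lexicographically,
  \<open>(Re (a z m), \<rho> m)\<close> is additive in the sense of \<open>a_gauge\<close>.\<close>

definition pos :: "complex \<Rightarrow> real \<Rightarrow> int \<Rightarrow> bool" where
  "pos z \<rho> m \<longleftrightarrow> 0 < Re (a z m) \<or> (Re (a z m) = 0 \<and> 0 < \<rho> * of_int m)"
definition neg :: "complex \<Rightarrow> real \<Rightarrow> int \<Rightarrow> bool" where
  "neg z \<rho> m \<longleftrightarrow> Re (a z m) < 0 \<or> (Re (a z m) = 0 \<and> \<rho> * of_int m < 0)"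

text \<open>A solution with its normalisation at infinity written as bounds at each single
  \<open>y\<close>, which survive pointwise limits. Mode 0 has rate zero whatever \<open>z\<close>
  is and is therefore pinned to 1 from both ends.\<close>

definition sol :: "complex \<Rightarrow> real \<Rightarrow> real \<Rightarrow> (real \<Rightarrow> real \<Rightarrow> complex) \<Rightarrow> bool" where
  "sol z \<rho> B M \<longleftrightarrow> slice M \<and> evo z M \<and> (\<forall>x y. norm (M x y) \<le> B) \<and>
     (\<forall>m y. pos z \<rho> m \<longrightarrow> norm (mode m M y) \<le> B * Phi y) \<and>
     (\<forall>m y. neg z \<rho> m \<longrightarrow> norm (mode m M y) \<le> B * (Phi_inf - Phi y)) \<and>
     (\<forall>y. norm (mode 0 M y - 1) \<le> B * Phi y \<and> norm (mode 0 M y - 1) \<le> B * (Phi_inf - Phi y))"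

text \<open>Since \<open>a z m = (z + w m)^2 - z^2\<close>, the identity is telescoping of
  squares.\<close>

lemma a_gauge: "a z m = a z j + a (z + of_real (w * of_int j)) (m - j)"
  by (simp add: a_def power2_eq_square algebra_simps)

lemma a_0: "a z 0 = 0" by (simp add: a_def)

lemma pos_neg_cases: "\<rho> \<noteq> 0 \<Longrightarrow> m = 0 \<or> pos z \<rho> m \<or> neg z \<rho> m"
  by (auto simp: pos_def neg_def not_less linorder_not_less le_less mult_less_0_iff zero_less_mult_iff)

lemma not_pos_0: "\<not> pos z \<rho> 0" and not_neg_0: "\<not> neg z \<rho> 0"
  by (auto simp: pos_def neg_def a_0)

text \<open>The factor \<open>em j x * exp (- a z j y)\<close> solves the equation without potential
  at \<open>z\<close>. Multiplication by it carries solutions at \<open>z + w j\<close> to solutions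
  at \<open>z\<close>, moving mode 0 to mode \<open>j\<close>.\<close>

definition gauge :: "complex \<Rightarrow> int \<Rightarrow> (real \<Rightarrow> real \<Rightarrow> complex) \<Rightarrow> real \<Rightarrow> real \<Rightarrow> complex" where
  "gauge z j N x y = exp (- a z j * of_real y) * (em j x * N x y)"

lemma mode_gauge: "mode m (gauge z j N) y = exp (- a z j * of_real y) * mode (m - j) N y"
  by (simp add: mode_def gauge_def md_cmult md_em_mult)

lemma src_gauge: "src m (gauge z j N) t = exp (- a z j * of_real t) * src (m - j) N t"
proof -
  have "(\<lambda>x. U x t * gauge z j N x t) = (\<lambda>x. exp (- a z j * of_real t) * (em j x * (U x t * N x t)))"
    by (simp add: gauge_def mult_ac)
  then show ?thesis by (simp only: src_def md_cmult md_em_mult)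
qed

lemma slice_gauge: "slice N \<Longrightarrow> slice (gauge z j N)"
  unfolding slice_def gauge_def[abs_def]
  by (auto intro!: continuous_intros simp: em_period)

lemma evo_gauge:
  assumes N: "evo (z + of_real (w * of_int j)) N"
  shows "evo z (gauge z j N)"
  unfolding evo_def lsol_def
proof (intro allI impI)
  fix m and y0 y :: real assume y: "y0 \<le> y"
  let ?b = "a (z + of_real (w * of_int j)) (m - j)"
  have eq: "mode (m - j) N y = exp (- ?b * of_real (y - y0)) * mode (m - j) N y0
      + (LBINT t:{y0<..y}. exp (- ?b * of_real (y - t)) * src (m - j) N t)"
    using N y unfolding evo_def lsol_def by blast
  have e: "exp (- a z m * of_real (y - t)) * exp (- a z j * of_real t) = exp (- a z j * of_real y) * exp (- ?b * of_real (y - t))" for t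
    unfolding a_gauge[of z m j] by (simp add: exp_add[symmetric] algebra_simps)
  have "(LBINT t:{y0<..y}. exp (- a z m * of_real (y - t)) * src m (gauge z j N) t)
      = (LBINT t:{y0<..y}. exp (- a z j * of_real y) * (exp (- ?b * of_real (y - t)) * src (m - j) N t))"
    unfolding src_gauge mult.assoc[symmetric] e ..
  also have "\<dots> = exp (- a z j * of_real y) * (LBINT t:{y0<..y}. exp (- ?b * of_real (y - t)) * src (m - j) N t)"
    by simp
  finally show "mode m (gauge z j N) y = exp (- a z m * of_real (y - y0)) * mode m (gauge z j N) y0
      + (LBINT t:{y0<..y}. exp (- a z m * of_real (y - t)) * src m (gauge z j N) t)"
    unfolding mode_gauge mult.assoc[symmetric] e[of y0] using eq by (simp add: ring_distribs mult.assoc)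
qed

lemma solD:
  assumes "sol z \<rho> B M"
  shows "slice M" "evo z M" "norm (M x y) \<le> B"
    "pos z \<rho> m \<Longrightarrow> norm (mode m M y) \<le> B * Phi y"
    "neg z \<rho> m \<Longrightarrow> norm (mode m M y) \<le> B * (Phi_inf - Phi y)"
    "norm (mode 0 M y - 1) \<le> B * Phi y" "norm (mode 0 M y - 1) \<le> B * (Phi_inf - Phi y)"
  using assms by (auto simp: sol_def)

lemma adm_gauge:
  assumes N: "sol (z + of_real (w * of_int j)) \<rho> B N" and r: "Re (a z j) \<le> 0"
  shows "adm z (gauge z j N)"
  unfolding adm_def
proof (intro conjI allI)
  show "slice (gauge z j N)" "evo z (gauge z j N)"
    using solD[OF N] by (auto intro: slice_gauge evo_gauge)
  fix y1
  show "\<exists>C. \<forall>x. \<forall>t\<le>y1. norm (gauge z j N x t) \<le> C"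
  proof (intro exI allI impI)
    fix x t assume t: "t \<le> y1"
    have "- Re (a z j) * t \<le> - Re (a z j) * y1" using r t by (intro mult_left_mono) auto
    then have "norm (exp (- a z j * of_real t)) \<le> exp (- Re (a z j) * y1)" by simp
    then show "norm (gauge z j N x t) \<le> exp (- Re (a z j) * y1) * B"
      unfolding gauge_def norm_mult using solD(3)[OF N, of x t] by (intro mult_mono) auto
  qed
qed

lemma Phi_lim_bot: "((\<lambda>y. B * Phi y) \<longlongrightarrow> 0) at_bot"
  using tendsto_mult[OF tendsto_const[of B] Phi_bot] by simp

lemma Phi_lim_top: "((\<lambda>y. B * (Phi_inf - Phi y)) \<longlongrightarrow> 0) at_top"
  using tendsto_mult[OF tendsto_const[of B] tendsto_diff[OF tendsto_const[of Phi_inf] Phi_top]] by simp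

lemma sol_limits:
  assumes "sol z \<rho> B M"
  shows "pos z \<rho> m \<Longrightarrow> (mode m M \<longlongrightarrow> 0) at_bot"
    "neg z \<rho> m \<Longrightarrow> (mode m M \<longlongrightarrow> 0) at_top"
    "(mode 0 M \<longlongrightarrow> 1) at_bot" "(mode 0 M \<longlongrightarrow> 1) at_top"
proof -
  show "(mode m M \<longlongrightarrow> 0) at_bot" if "pos z \<rho> m"
    by (rule Lim_null_comparison[OF _ Phi_lim_bot[of B]]) (use solD(4)[OF assms that] in auto)
  show "(mode m M \<longlongrightarrow> 0) at_top" if "neg z \<rho> m"
    by (rule Lim_null_comparison[OF _ Phi_lim_top[of B]]) (use solD(5)[OF assms that] in auto)
  have "((\<lambda>y. mode 0 M y - 1) \<longlongrightarrow> 0) at_bot"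
    by (rule Lim_null_comparison[OF _ Phi_lim_bot[of B]]) (use solD(6)[OF assms] in auto)
  then show "(mode 0 M \<longlongrightarrow> 1) at_bot" by (simp add: Lim_null[symmetric])
  have "((\<lambda>y. mode 0 M y - 1) \<longlongrightarrow> 0) at_top"
    by (rule Lim_null_comparison[OF _ Phi_lim_top[of B]]) (use solD(7)[OF assms] in auto)
  then show "(mode 0 M \<longlongrightarrow> 1) at_top" by (simp add: Lim_null[symmetric])
qed

lemma tendsto_0_bounded_mult:
  fixes f g :: "'a \<Rightarrow> complex"
  assumes "(g \<longlongrightarrow> 0) F" "eventually (\<lambda>y. norm (f y) \<le> 1) F"
  shows "((\<lambda>y. f y * g y) \<longlongrightarrow> 0) F"
proof (rule Lim_null_comparison[OF _ tendsto_norm_zero[OF assms(1)]])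
  show "\<forall>\<^sub>F x in F. norm (f x * g x) \<le> norm (g x)"
    using assms(2) by eventually_elim (auto simp: norm_mult intro: mult_left_le_one_le)
qed

lemma exists_lex_min:
  fixes f g :: "'b \<Rightarrow> real"
  assumes "finite P" "P \<noteq> {}"
  obtains j where "j \<in> P" "\<And>k. k \<in> P \<Longrightarrow> f j < f k \<or> (f j = f k \<and> g j \<le> g k)"
proof -
  have minimum: "\<exists>i\<in>Q. \<forall>k\<in>Q. h i \<le> h k" if "finite Q" "Q \<noteq> {}" for h :: "'b \<Rightarrow> real" and Q
  proof -
    have "Min (h ` Q) \<in> h ` Q" using that by (intro Min_in) auto
    then obtain i where "i \<in> Q" "h i = Min (h ` Q)" by auto
    then show ?thesis using that by (intro bexI[of _ i]) auto
  qed
  obtain i where i: "i \<in> P" "\<And>k. k \<in> P \<Longrightarrow> f i \<le> f k" using minimum[of P f] assms by blast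
  let ?Q = "{k\<in>P. f k = f i}"
  have "finite ?Q" "?Q \<noteq> {}" using assms i by auto
  then obtain j where j: "j \<in> ?Q" "\<And>k. k \<in> ?Q \<Longrightarrow> g j \<le> g k" using minimum[of ?Q g] by blast
  show thesis
  proof (rule that[of j])
    show "j \<in> P" using j by auto
    fix k assume k: "k \<in> P"
    show "f j < f k \<or> (f j = f k \<and> g j \<le> g k)"
      using i(2)[OF k] j k by (cases "f k = f i") auto
  qed
qed

text \<open>For every unstable mode \<open>j\<close> the gauge-transformed solution at \<open>z + \<omega> j\<close> solves the homogeneous equation
  at \<open>z\<close> and behaves like a pure mode at \<open>+\<infinity>\<close>. Some linear combination \<open>\<zeta>\<close> of these and of the difference
  of two solutions has vanishing unstable modes at a point far to the left, hence vanishes identically,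
  and the behaviour at \<open>+\<infinity>\<close> shows that only the difference occurs in it.\<close>

theorem sol_unique:
  assumes \<rho>: "\<rho> \<noteq> 0" and M1: "sol z \<rho> B1 M1" and M2: "sol z \<rho> B2 M2"
    and N: "\<And>j. neg z \<rho> j \<Longrightarrow> \<exists>B N. sol (z + of_real (w * of_int j)) \<rho> B N"
  shows "M1 x y = M2 x y"
proof -
  obtain R where R: "tail_index \<bar>Re z\<bar> R" using ex_tail_index by blast
  define Neg where "Neg = {j. neg z \<rho> j}"
  \<comment> \<open>Beyond the tail index all rates are positive, so only finitely many modes are
    unstable.\<close>
  have NegR: "Neg \<subseteq> {- int R..int R}"
  proof
    fix j assume "j \<in> Neg"
    then have "\<not> 0 < Re (a z j)" by (auto simp: Neg_def neg_def)
    then have "\<not> int R < \<bar>j\<bar>" using R by (auto simp: tail_index_def)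
    then show "j \<in> {- int R..int R}" by auto
  qed
  then have finN: "finite Neg" by (rule finite_subset) simp
  from N obtain B N where N: "\<And>j. j \<in> Neg \<Longrightarrow> sol (z + of_real (w * of_int j)) \<rho> (B j) (N j)"
    unfolding Neg_def by (metis mem_Collect_eq)
  have Re_neg: "Re (a z j) \<le> 0" if "j \<in> Neg" for j using that by (auto simp: Neg_def neg_def)
  define D where "D = (\<lambda>x y. M1 x y + (-1) * M2 x y)"
  \<comment> \<open>\<open>None\<close> indexes the difference of the two solutions and
    \<open>Some j\<close> the gauge-transformed solution attached to the unstable mode
    \<open>j\<close>.\<close>
  define F where "F i = (case i of None \<Rightarrow> D | Some j \<Rightarrow> gauge z j (N j))" for i
  define I where "I = insert None (Some ` Neg)"
  have finI: "finite I" using finN by (simp add: I_def)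
  have sl: "slice M1" "slice (\<lambda>x y. (-1) * M2 x y)" by (rule solD(1)[OF M1]) (rule slice_cmult[OF solD(1)[OF M2]])
  have modeD: "mode m D y = mode m M1 y - mode m M2 y" for m y
    unfolding D_def mode_add[OF sl] mode_cmult by simp
  have bounded: "\<exists>C. \<forall>x. \<forall>t\<le>y1. norm (M x t) \<le> C" if "sol z \<rho> C M" for C M y1
    using solD(3)[OF that] by blast
  have admD: "adm z D"
    unfolding D_def by (intro adm_add adm_cmult) (use solD[OF M1] solD[OF M2] bounded[OF M1] bounded[OF M2] in \<open>auto simp: adm_def\<close>)
  have adm: "adm z (F i)" if "i \<in> I" for i
    using that admD adm_gauge[OF N Re_neg] by (auto simp: I_def F_def)
  \<comment> \<open>To the left of \<open>y0\<close> there is so little mass that the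
    \<open>2 R + 1\<close> low modes together get a quarter.\<close>
  have "((\<lambda>y. (2 * real R + 1) * Phi y) \<longlongrightarrow> 0) at_bot" by (rule Phi_lim_bot)
  then have "eventually (\<lambda>y. (2 * real R + 1) * Phi y < 1/4) at_bot"
    by (rule order_tendstoD) simp
  then obtain y0 where y0: "(2 * real R + 1) * Phi y0 \<le> 1/4"
    by (metis eventually_at_bot_linorder less_imp_le order_refl)
  \<comment> \<open>One equation for each unstable mode, namely its vanishing at \<open>y0\<close>,
    and one unknown more.\<close>
  have "card Neg < card I"
    using finN by (simp add: I_def card_image)
  then obtain v where v: "\<exists>i\<in>I. v i \<noteq> 0" and veq: "\<And>m. m \<in> Neg \<Longrightarrow> (\<Sum>i\<in>I. v i * mode m (F i) y0) = 0"
    using homogeneous_system_nontrivial[OF finN finI, of "\<lambda>m i. mode m (F i) y0"] by metis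
  define \<zeta> where "\<zeta> = (\<lambda>x y. \<Sum>i\<in>I. v i * F i x y)"
  have adm\<zeta>: "adm z \<zeta>" and mode\<zeta>: "mode m \<zeta> y = (\<Sum>i\<in>I. v i * mode m (F i) y)" for m y
    unfolding \<zeta>_def by (rule adm_sum[OF finI adm], assumption)+
  have sum_I: "(\<Sum>i\<in>I. h i) = h None + (\<Sum>j\<in>Neg. h (Some j))" for h :: "int option \<Rightarrow> complex"
    unfolding I_def using finN by (subst sum.insert) (auto simp: sum.reindex)
  \<comment> \<open>The remaining modes of each ingredient die out at -\<infinity>, as
    \<open>low_mode_stable\<close> requires; for mode 0 of the difference the two limits 1
    cancel.\<close>
  have bot: "(mode m \<zeta> \<longlongrightarrow> 0) at_bot" if m: "m \<notin> Neg" for m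
  proof -
    have pm: "m = 0 \<or> pos z \<rho> m" using pos_neg_cases[OF \<rho>, of m z] m by (auto simp: Neg_def)
    have "(mode m (F i) \<longlongrightarrow> 0) at_bot" if "i \<in> I" for i
    proof (cases i)
      case None
      have "((\<lambda>y. mode m M1 y - mode m M2 y) \<longlongrightarrow> 0) at_bot"
      proof (cases "m = 0")
        case True
        then show ?thesis using tendsto_diff[OF sol_limits(3)[OF M1] sol_limits(3)[OF M2]] by simp
      next
        case False
        then show ?thesis using pm tendsto_diff[OF sol_limits(1)[OF M1] sol_limits(1)[OF M2]] by simp
      qed
      then show ?thesis using None by (simp add: F_def modeD[abs_def])
    next
      case (Some j)
      then have j: "j \<in> Neg" using that by (auto simp: I_def)
      have "Re (a z m) = Re (a z j) + Re (a (z + of_real (w * of_int j)) (m - j))"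
        by (subst a_gauge[of z m j]) simp
      \<comment> \<open>The tie on a resonance line: if both rates vanish, \<open>m\<close> is 0 or
        stable and \<open>j\<close> is unstable, and \<rho> orders them.\<close>
      moreover have "0 < \<rho> * of_int (m - j)" if "Re (a z j) = 0" "Re (a z m) = 0"
        using pm j that by (auto simp: Neg_def neg_def pos_def algebra_simps)
      moreover have "0 \<le> Re (a z m)" using pm by (auto simp: pos_def a_0)
      ultimately have "pos (z + of_real (w * of_int j)) \<rho> (m - j)"
        using Re_neg[OF j] unfolding pos_def by linarith
      then have "(mode (m - j) (N j) \<longlongrightarrow> 0) at_bot" by (rule sol_limits(1)[OF N[OF j]])
      moreover have "eventually (\<lambda>y. norm (exp (- a z j * of_real y)) \<le> 1) at_bot"
        using eventually_le_at_bot[of 0] by eventually_elim (use Re_neg[OF j] in \<open>simp add: mult_nonpos_nonpos\<close>)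
      ultimately have "((\<lambda>y. exp (- a z j * of_real y) * mode (m - j) (N j) y) \<longlongrightarrow> 0) at_bot"
        by (rule tendsto_0_bounded_mult)
      then show ?thesis using Some by (simp add: F_def mode_gauge[abs_def])
    qed
    then have "((\<lambda>y. \<Sum>i\<in>I. v i * mode m (F i) y) \<longlongrightarrow> (\<Sum>i\<in>I. v i * 0)) at_bot"
      by (intro tendsto_intros)
    then show ?thesis by (simp add: mode\<zeta>[abs_def])
  qed
  have left: "\<zeta> x t = 0" if t: "t \<le> y0" for x t
  proof (rule contraction_zero[OF adm\<zeta> R y0 _ t])
    fix Z m y
    assume Z: "0 < Z" and Zb: "\<And>x t. t \<le> y0 \<Longrightarrow> norm (\<zeta> x t) \<le> Z" and y: "y \<le> y0"
    have s\<zeta>: "slice \<zeta>" "evo z \<zeta>" using adm\<zeta> by (auto simp: adm_def)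
    show "norm (mode m \<zeta> y) \<le> Z * Phi y0"
    proof (cases "m \<in> Neg")
      case True
      show ?thesis
        by (rule low_mode_unstable[OF s\<zeta> Zb Z Re_neg[OF True] _ y]) (use veq[OF True] in \<open>simp_all add: mode\<zeta>\<close>)
    next
      case False
      then have "0 \<le> Re (a z m)" using pos_neg_cases[OF \<rho>, of m z] by (auto simp: Neg_def pos_def a_0)
      then show ?thesis by (intro low_mode_stable[OF s\<zeta> _ Z _ bot[OF False] y] Zb)
    qed
  qed
  then have zero: "\<zeta> x y = 0" for x y by (rule forward_uniqueness[OF adm\<zeta>])
  \<comment> \<open>Suppose some gauge coefficient survives. Among the surviving ones the
    lexicographically smallest rate belongs to the dominant growth at +\<infinity>; no other
    ingredient can cancel it.\<close>
  have vj: "v (Some j) = 0" if "j \<in> Neg" for j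
  proof (rule ccontr)
    assume "v (Some j) \<noteq> 0"
    define P where "P = {j\<in>Neg. v (Some j) \<noteq> 0}"
    have "finite P" "P \<noteq> {}" using finN that \<open>v (Some j) \<noteq> 0\<close> by (auto simp: P_def)
    then obtain k where k: "k \<in> P"
      and kmin: "\<And>i. i \<in> P \<Longrightarrow> Re (a z k) < Re (a z i) \<or> (Re (a z k) = Re (a z i) \<and> \<rho> * of_int k \<le> \<rho> * of_int i)"
      using exists_lex_min[of P "\<lambda>i. Re (a z i)" "\<lambda>i. \<rho> * of_int i"] by metis
    have kN: "k \<in> Neg" using k by (auto simp: P_def)
    \<comment> \<open>Mode \<open>k\<close> normalised by its own growth: the ingredient
      \<open>Some k\<close> contributes mode 0 of \<open>N k\<close>, which tends to 1, and every
      other one tends to 0.\<close>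
    let ?T = "\<lambda>y i. exp (a z k * of_real y) * mode k (F i) y"
    have lim: "((\<lambda>y. ?T y i) \<longlongrightarrow> 0) at_top" if i: "i \<in> I" "i \<noteq> Some k" "v i \<noteq> 0" for i
    proof (cases i)
      case None
      have "((\<lambda>y. mode k M1 y - mode k M2 y) \<longlongrightarrow> 0) at_top"
        using tendsto_diff[OF sol_limits(2)[OF M1, of k] sol_limits(2)[OF M2, of k]] kN by (simp add: Neg_def)
      moreover have "eventually (\<lambda>y. norm (exp (a z k * of_real y)) \<le> 1) at_top"
        using eventually_ge_at_top[of 0] by eventually_elim (use Re_neg[OF kN] in \<open>simp add: mult_nonpos_nonneg\<close>)
      ultimately have "((\<lambda>y. exp (a z k * of_real y) * (mode k M1 y - mode k M2 y)) \<longlongrightarrow> 0) at_top"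
        by (rule tendsto_0_bounded_mult)
      then show ?thesis using None by (simp add: F_def modeD)
    next
      case (Some j)
      then have j: "j \<in> Neg" "j \<in> P" "j \<noteq> k" using i by (auto simp: I_def P_def)
      let ?b = "a (z + of_real (w * of_int j)) (k - j)"
      have b: "a z k = a z j + ?b" by (rule a_gauge)
      \<comment> \<open>For equal rates the minimality of \<open>k\<close> gives a weak inequality;
        it is strict because \<rho> is nonzero and \<open>j\<close> differs from
        \<open>k\<close>.\<close>
      have "\<rho> * of_int (k - j) < 0" if "Re (a z k) = Re (a z j)"
      proof -
        have "\<rho> * of_int (k - j) \<le> 0" using kmin[OF j(2)] that by (auto simp: algebra_simps)
        moreover have "\<rho> * of_int (k - j) \<noteq> 0" using \<rho> j(3) by simp
        ultimately show ?thesis by linarith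
      qed
      then have "neg (z + of_real (w * of_int j)) \<rho> (k - j)"
        using kmin[OF j(2)] b unfolding neg_def by auto
      then have "(mode (k - j) (N j) \<longlongrightarrow> 0) at_top" by (rule sol_limits(2)[OF N[OF j(1)]])
      moreover have "eventually (\<lambda>y. norm (exp (?b * of_real y)) \<le> 1) at_top"
        using eventually_ge_at_top[of 0]
      proof eventually_elim
        case (elim y)
        have "Re ?b \<le> 0" using kmin[OF j(2)] b by auto
        then show ?case using elim by (simp add: mult_nonpos_nonneg)
      qed
      ultimately have "((\<lambda>y. exp (?b * of_real y) * mode (k - j) (N j) y) \<longlongrightarrow> 0) at_top"
        by (rule tendsto_0_bounded_mult)
      moreover have "?T y i = exp (?b * of_real y) * mode (k - j) (N j) y" for y
        by (simp add: Some F_def mode_gauge b mult.assoc[symmetric] exp_add[symmetric] algebra_simps)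
      ultimately show ?thesis by simp
    qed
    have limk: "((\<lambda>y. ?T y (Some k)) \<longlongrightarrow> 1) at_top"
    proof -
      have "?T y (Some k) = mode 0 (N k) y" for y
        by (simp add: F_def mode_gauge mult.assoc[symmetric] exp_add[symmetric])
      then show ?thesis using sol_limits(4)[OF N[OF kN]] by simp
    qed
    have "((\<lambda>y. \<Sum>i\<in>I. v i * ?T y i) \<longlongrightarrow> (\<Sum>i\<in>I. if i = Some k then v i else 0)) at_top"
    proof (rule tendsto_sum)
      fix i assume i: "i \<in> I"
      show "((\<lambda>y. v i * ?T y i) \<longlongrightarrow> (if i = Some k then v i else 0)) at_top"
      proof (cases "i = Some k")
        case True
        then show ?thesis using tendsto_mult[OF tendsto_const limk, of "v i"] by simp
      next
        case False
        then show ?thesis using tendsto_mult[OF tendsto_const lim[OF i False], of "v i"] by (cases "v i = 0") auto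
      qed
    qed
    moreover have "(\<Sum>i\<in>I. v i * ?T y i) = exp (a z k * of_real y) * mode k \<zeta> y" for y
      unfolding mode\<zeta> sum_distrib_left by (intro sum.cong) (auto simp: mult_ac)
    moreover have "mode k \<zeta> y = 0" for y using zero md_const[of k 0] by (simp add: mode_def)
    moreover have "(\<Sum>i\<in>I. if i = Some k then v i else 0) = v (Some k)"
      using finI kN by (simp add: I_def)
    ultimately have "((\<lambda>y::real. 0) \<longlongrightarrow> v (Some k)) at_top" by simp
    then have "v (Some k) = 0" using tendsto_unique[OF _ tendsto_const, of "at_top :: real filter" "0::complex"]
      by (metis trivial_limit_at_top_linorder)
    then show False using k by (simp add: P_def)
  qed
  then have v0: "v None \<noteq> 0" using v by (auto simp: I_def)
  have "\<zeta> x y = v None * (M1 x y - M2 x y)"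
    unfolding \<zeta>_def sum_I using vj by (simp add: F_def D_def)
  then show ?thesis using zero v0 by simp
qed

end

section \<open>Compactness\<close>

text \<open>The Arzela-Ascoli argument in pointwise form: a diagonal subsequence converges for all
  indices and all rational \<open>y\<close>, and equicontinuity carries the Cauchy property to every
  real \<open>y\<close>. The countable index will be the mode number.\<close>

lemma equicontinuous_pointwise_subsequence:
  fixes g :: "nat \<Rightarrow> 'i::countable \<Rightarrow> real \<Rightarrow> complex"
  assumes B: "\<And>n i y. norm (g n i y) \<le> B"
    and eq: "\<And>i y \<epsilon>. 0 < \<epsilon> \<Longrightarrow> \<exists>d>0. \<forall>n y'. \<bar>y' - y\<bar> < d \<longrightarrow> norm (g n i y' - g n i y) < \<epsilon>"
  obtains r h where "strict_mono (r :: nat \<Rightarrow> nat)" "\<And>i y. (\<lambda>n. g (r n) i y) \<longlonglongrightarrow> h i y"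
proof -
  have "countable (UNIV \<times> \<rat> :: ('i \<times> real) set)" by (intro countable_SIGMA) (auto simp: countable_rat)
  then obtain r where r: "strict_mono (r :: nat \<Rightarrow> nat)"
    and conv: "\<And>p. p \<in> UNIV \<times> \<rat> \<Longrightarrow> \<exists>l. (\<lambda>n. g (r n) (fst p) (snd p)) \<longlonglongrightarrow> l"
    using function_convergent_subsequence[of "UNIV \<times> \<rat> :: ('i \<times> real) set" "\<lambda>n p. g n (fst p) (snd p)" B] B by blast
  have "\<exists>l. (\<lambda>n. g (r n) i y) \<longlonglongrightarrow> l" for i y
  proof -
    have "Cauchy (\<lambda>n. g (r n) i y)"
    proof (rule metric_CauchyI)
      fix e :: real assume "0 < e"
      then have e: "0 < e / 3" by simp
      from eq[OF e, of y i] obtain d where d: "0 < d" "\<And>n y'. \<bar>y' - y\<bar> < d \<Longrightarrow> norm (g n i y' - g n i y) < e / 3" by blast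
      obtain q where q: "q \<in> \<rat>" "y < q" "q < y + d" using Rats_dense_in_real[of y "y + d"] d(1) by auto
      have "\<exists>l. (\<lambda>n. g (r n) i q) \<longlonglongrightarrow> l" using conv[of "(i, q)"] q by auto
      then have "Cauchy (\<lambda>n. g (r n) i q)" by (auto intro: LIMSEQ_imp_Cauchy)
      then obtain N where N: "\<And>m n. m \<ge> N \<Longrightarrow> n \<ge> N \<Longrightarrow> dist (g (r m) i q) (g (r n) i q) < e / 3"
        using metric_CauchyD[OF _ e] by blast
      show "\<exists>N. \<forall>m\<ge>N. \<forall>n\<ge>N. dist (g (r m) i y) (g (r n) i y) < e"
      proof (intro exI allI impI)
        fix m n assume mn: "m \<ge> N" "n \<ge> N"
        have a: "norm (g k i q - g k i y) < e / 3" for k using d(2)[of q k] q by auto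
        have "g (r m) i y - g (r n) i y = (g (r m) i y - g (r m) i q) + ((g (r m) i q - g (r n) i q) + (g (r n) i q - g (r n) i y))"
          by simp
        also have "norm \<dots> \<le> norm (g (r m) i y - g (r m) i q) + (norm (g (r m) i q - g (r n) i q) + norm (g (r n) i q - g (r n) i y))"
          by (intro norm_triangle_mono) auto
        also have "\<dots> < e" using a[of "r m"] a[of "r n"] N[OF mn] norm_minus_commute[of "g (r m) i y" "g (r m) i q"] unfolding dist_norm by linarith
        finally show "dist (g (r m) i y) (g (r n) i y) < e" by (simp add: dist_norm)
      qed
    qed
    then show ?thesis by (simp add: Cauchy_convergent_iff convergent_def)
  qed
  then obtain h where "\<And>i y. (\<lambda>n. g (r n) i y) \<longlonglongrightarrow> h i y" by metis
  then show thesis using that r by blast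
qed

context potential begin

lemma lsol_norm_diff:
  assumes L: "lsol \<alpha> f g" and K: "norm \<alpha> \<le> K" and f: "\<And>t. norm (f t) \<le> B * phi t" and g: "\<And>t. norm (g t) \<le> B"
    and y: "y0 \<le> y" "y \<le> y0 + 1"
  shows "norm (g y - g y0) \<le> norm (exp (- \<alpha> * of_real (y - y0)) - 1) * B + exp K * B * (Phi y - Phi y0)"
proof -
  have "g y - g y0 = (exp (- \<alpha> * of_real (y - y0)) - 1) * g y0 + (LBINT t:{y0<..y}. exp (- \<alpha> * of_real (y - t)) * f t)"
    using L y unfolding lsol_def by (simp add: algebra_simps)
  moreover have "norm ((exp (- \<alpha> * of_real (y - y0)) - 1) * g y0) \<le> norm (exp (- \<alpha> * of_real (y - y0)) - 1) * B"
    unfolding norm_mult by (intro mult_left_mono g) auto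
  moreover have "norm (LBINT t:{y0<..y}. exp (- \<alpha> * of_real (y - t)) * f t) \<le> exp K * B * (Phi y - Phi y0)"
  proof -
    have "norm (LBINT t:{y0<..y}. exp (- \<alpha> * of_real (y - t)) * f t) \<le> (LBINT t:{y0<..y}. exp K * B * phi t)"
    proof (rule norm_set_integral_le)
      fix t assume t: "t \<in> {y0<..y}"
      have "- Re \<alpha> * (y - t) \<le> norm \<alpha> * 1"
        using abs_Re_le_cmod[of \<alpha>] t y by (intro mult_mono) auto
      then have "norm (exp (- \<alpha> * of_real (y - t))) \<le> exp K" using K by simp
      then show "norm (exp (- \<alpha> * of_real (y - t)) * f t) \<le> exp K * B * phi t"
        unfolding norm_mult mult.assoc by (intro mult_mono f) auto
    qed (intro set_integrable_mult_right phi_set, simp)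
    then show ?thesis using y by (simp add: Phi_diff)
  qed
  ultimately show ?thesis by (metis norm_triangle_mono)
qed

text \<open>The modulus of continuity depends only on bounds for rate, source and solution, not on
  these objects. The source enters through the increment of \<open>Phi\<close>, so its domination by
  the integrable \<open>phi\<close> is enough.\<close>

lemma lsol_equicontinuous:
  assumes "0 < \<epsilon>" "0 < B" "0 \<le> K"
  shows "\<exists>d>0. \<forall>\<alpha> f g y'. lsol \<alpha> f g \<longrightarrow> norm \<alpha> \<le> K \<longrightarrow> (\<forall>t. norm (f t) \<le> B * phi t) \<longrightarrow> (\<forall>t. norm (g t) \<le> B) \<longrightarrow>
     \<bar>y' - y\<bar> < d \<longrightarrow> norm (g y' - g y) < \<epsilon>"
proof -
  have "isCont (exp :: complex \<Rightarrow> complex) 0" by simp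
  then obtain \<eta> where \<eta>: "0 < \<eta>" "\<And>x::complex. norm x < \<eta> \<Longrightarrow> norm (exp x - 1) < \<epsilon> / (2 * B)"
    using assms unfolding continuous_at_eps_delta dist_norm
    by (metis diff_zero divide_pos_pos exp_zero mult_pos_pos zero_less_numeral)
  have "0 < \<epsilon> / (2 * exp K * B)" using assms by simp
  then obtain d1 where d1: "0 < d1" "\<And>y'. \<bar>y' - y\<bar> < d1 \<Longrightarrow> \<bar>Phi y' - Phi y\<bar> < \<epsilon> / (2 * exp K * B)"
    using Phi_isCont[of y] unfolding continuous_at_eps_delta dist_real_def by metis
  \<comment> \<open>The parts of \<open>d\<close> control the increment of \<open>Phi\<close>, keep
    the step below 1 and make \<open>\<alpha> (y' - y)\<close> smaller than \<eta>; dividing by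
    \<open>K + 1\<close> covers \<open>K = 0\<close>.\<close>
  define d where "d = min (min d1 1) (\<eta> / (K + 1))"
  have d: "0 < d" "d \<le> d1" "d \<le> 1" "d \<le> \<eta> / (K + 1)" using d1 \<eta> assms by (auto simp: d_def)
  show ?thesis
  proof (intro exI[of _ d] conjI d(1) allI impI)
    fix \<alpha> f g y'
    assume L: "lsol \<alpha> f g" and K: "norm \<alpha> \<le> K" and f: "\<forall>t. norm (f t) \<le> B * phi t"
      and g: "\<forall>t. norm (g t) \<le> B" and y': "\<bar>y' - y\<bar> < d"
    have main: "norm (g t - g s) < \<epsilon>" if st: "s \<le> t" "t - s < d" and P: "Phi t - Phi s < \<epsilon> / (2 * exp K * B)" for s t
    proof -
      have "norm (- \<alpha> * of_real (t - s)) \<le> K * (t - s)"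
        using K st mult_right_mono[OF K, of "t - s"] unfolding norm_mult norm_of_real by simp
      also have "\<dots> \<le> (K + 1) * (t - s)" using st by (simp add: algebra_simps)
      also have "\<dots> < (K + 1) * (\<eta> / (K + 1))" using st d(4) assms by (intro mult_strict_left_mono) auto
      also have "\<dots> = \<eta>" using assms by simp
      finally have "norm (exp (- \<alpha> * of_real (t - s)) - 1) < \<epsilon> / (2 * B)" by (rule \<eta>)
      then have "norm (exp (- \<alpha> * of_real (t - s)) - 1) * B < \<epsilon> / (2 * B) * B"
        using assms by (intro mult_strict_right_mono)
      moreover have "exp K * B * (Phi t - Phi s) < exp K * B * (\<epsilon> / (2 * exp K * B))"
        using P assms by (intro mult_strict_left_mono) auto
      moreover have "norm (g t - g s) \<le> norm (exp (- \<alpha> * of_real (t - s)) - 1) * B + exp K * B * (Phi t - Phi s)"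
        by (rule lsol_norm_diff[OF L K]) (use f g st d(3) in auto)
      ultimately show ?thesis using assms by simp
    qed
    have "\<bar>Phi y' - Phi y\<bar> < \<epsilon> / (2 * exp K * B)" using d1(2) y' d(2) by simp
    then show "norm (g y' - g y) < \<epsilon>"
      using main[of y y'] main[of y' y] y' by (cases "y \<le> y'") (auto simp: norm_minus_commute abs_if split: if_splits)
  qed
qed

lemma low_high_sum_le:
  fixes A :: "int set"
  assumes "finite A" "(\<Sum>m\<in>{m\<in>A. int R < \<bar>m\<bar>}. f m) \<le> H" "\<And>m. 0 \<le> f m"
  shows "(\<Sum>m\<in>A. f m) \<le> (\<Sum>m\<in>{- int R..int R}. f m) + (H::real)"
proof -
  have "A = {m\<in>A. \<bar>m\<bar> \<le> int R} \<union> {m\<in>A. int R < \<bar>m\<bar>}" by auto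
  then have "(\<Sum>m\<in>A. f m) = (\<Sum>m\<in>{m\<in>A. \<bar>m\<bar> \<le> int R}. f m) + (\<Sum>m\<in>{m\<in>A. int R < \<bar>m\<bar>}. f m)"
    using assms(1) by (subst sum.union_disjoint[symmetric]) auto
  moreover have "(\<Sum>m\<in>{m\<in>A. \<bar>m\<bar> \<le> int R}. f m) \<le> (\<Sum>m\<in>{- int R..int R}. f m)"
    using assms by (intro sum_mono2) auto
  ultimately show ?thesis using assms(2) by linarith
qed

text \<open>Turns convergence of finitely many modes into convergence uniform in \<open>x\<close>;
  the tails are estimated separately because \<open>mode_tail\<close> applies to each
  solution.\<close>

lemma norm_slice_diff_le:
  assumes M: "slice M" and N: "slice N"
    and H: "\<And>A. finite A \<Longrightarrow> (\<forall>m\<in>A. int R < \<bar>m\<bar>) \<Longrightarrow> (\<Sum>m\<in>A. norm (mode m M y)) \<le> H"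
      "\<And>A. finite A \<Longrightarrow> (\<forall>m\<in>A. int R < \<bar>m\<bar>) \<Longrightarrow> (\<Sum>m\<in>A. norm (mode m N y)) \<le> H'"
  shows "norm (M x y - N x y) \<le> (\<Sum>m\<in>{- int R..int R}. norm (mode m M y - mode m N y)) + (H + H')"
proof (rule norm_le_sum_fourier[of "\<lambda>x. M x y - N x y"])
  show "continuous_on UNIV (\<lambda>x. M x y - N x y)" by (intro continuous_intros sliceD M N)
  fix A :: "int set" assume A: "finite A"
  let ?H = "{m\<in>A. int R < \<bar>m\<bar>}"
  have eq: "md m (\<lambda>x. M x y - N x y) = mode m M y - mode m N y" for m
    unfolding mode_def by (intro md_diff sliceD M N)
  have "(\<Sum>m\<in>?H. norm (mode m M y - mode m N y)) \<le> (\<Sum>m\<in>?H. norm (mode m M y) + norm (mode m N y))"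
    by (intro sum_mono norm_triangle_ineq4)
  also have "\<dots> \<le> H + H'" unfolding sum.distrib by (intro add_mono H) (use A in auto)
  finally show "(\<Sum>m\<in>A. norm (md m (\<lambda>x. M x y - N x y)))
      \<le> (\<Sum>m\<in>{- int R..int R}. norm (mode m M y - mode m N y)) + (H + H')"
    unfolding eq by (intro low_high_sum_le A) auto
qed (use sliceD(3)[OF M] sliceD(3)[OF N] in auto)

lemma tendsto_a: "zn \<longlonglongrightarrow> z \<Longrightarrow> (\<lambda>n. a (zn n) m) \<longlonglongrightarrow> a z m"
  unfolding a_def by (intro tendsto_intros)

lemma tendsto_mode:
  assumes M: "\<And>n. slice (M n)" and B: "\<And>n x. norm (M n x y) \<le> B" and lim: "\<And>x. (\<lambda>n. M n x y) \<longlonglongrightarrow> N x"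
    and N: "N \<in> borel_measurable borel"
  shows "(\<lambda>n. mode m (M n) y) \<longlonglongrightarrow> md m N"
  unfolding mode_def md_def
proof (rule integral_dominated_convergence[where w = "\<lambda>_. B"])
  show "AE x in X. (\<lambda>n. M n x y * em (- m) x) \<longlonglongrightarrow> N x * em (- m) x"
    by (intro AE_I2 tendsto_intros lim)
  show "(\<lambda>x. M n x y * em (- m) x) \<in> borel_measurable X" for n
    using sliceD(5)[OF M, of n y] by simp
qed (use B N in \<open>auto simp: norm_mult\<close>)

lemma tendsto_src:
  assumes M: "\<And>n. slice (M n)" and B: "\<And>n x. norm (M n x t) \<le> B" and lim: "\<And>x. (\<lambda>n. M n x t) \<longlonglongrightarrow> N x t"
    and N: "slice N"
  shows "(\<lambda>n. src m (M n) t) \<longlonglongrightarrow> src m N t"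
  unfolding src_def md_def
proof (rule integral_dominated_convergence[where w = "\<lambda>x. norm (U x t) * B"])
  show "AE x in X. (\<lambda>n. U x t * M n x t * em (- m) x) \<longlonglongrightarrow> U x t * N x t * em (- m) x"
    by (intro AE_I2 tendsto_intros lim)
  show "(\<lambda>x. U x t * M n x t * em (- m) x) \<in> borel_measurable X" for n
    using sliceD(5)[OF M, of n t] U_1[of t] by auto
  show "(\<lambda>x. U x t * N x t * em (- m) x) \<in> borel_measurable X"
    using sliceD(5)[OF N, of t] U_1[of t] by auto
  show "integrable X (\<lambda>x. norm (U x t) * B)" using U_1[of t] by auto
qed (use B in \<open>auto simp: norm_mult intro!: mult_left_mono\<close>)

text \<open>The modes are equicontinuous in \<open>y\<close> because the rates converge, and the
  tails are uniformly small. Signs of rates are required only eventually along the sequence, mode by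
  mode; that is how the side of approach enters.\<close>

theorem sol_compact:
  assumes S: "\<And>n. sol (zn n) \<rho> B (M n)" and z: "zn \<longlonglongrightarrow> z" and B: "0 < B"
    and p: "\<And>m. pos z \<rho> m \<Longrightarrow> eventually (\<lambda>n. pos (zn n) \<rho> m) sequentially"
    and q: "\<And>m. neg z \<rho> m \<Longrightarrow> eventually (\<lambda>n. neg (zn n) \<rho> m) sequentially"
  obtains r N where "strict_mono (r :: nat \<Rightarrow> nat)" "sol z \<rho> B N" "\<And>x y. (\<lambda>n. M (r n) x y) \<longlonglongrightarrow> N x y"
proof -
  have sl: "slice (M n)" and ev: "evo (zn n) (M n)" and Mb: "norm (M n x y) \<le> B" for n x y
    using solD[OF S] by auto
  have srcb: "norm (src m (M n) t) \<le> B * phi t" for m n t by (rule norm_src_le[OF sl Mb])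
  have modeb: "norm (mode m (M n) y) \<le> B" for m n y by (rule norm_mode_le[OF sl Mb])
  have abound: "\<exists>K\<ge>0. \<forall>n. norm (a (zn n) m) \<le> K" for m
  proof -
    have "Bseq (\<lambda>n. a (zn n) m)" using tendsto_a[OF z] by (intro convergent_imp_Bseq convergentI)
    then show ?thesis unfolding Bseq_def by (metis less_imp_le)
  qed
  have eqc: "\<exists>d>0. \<forall>n y'. \<bar>y' - y\<bar> < d \<longrightarrow> norm (mode m (M n) y' - mode m (M n) y) < \<epsilon>" if "0 < \<epsilon>" for m y \<epsilon>
  proof -
    obtain K where K: "0 \<le> K" "\<And>n. norm (a (zn n) m) \<le> K" using abound by blast
    from lsol_equicontinuous[OF that B K(1), of y]
    obtain d where d: "d > 0" "\<And>\<alpha> f g y'. lsol \<alpha> f g \<Longrightarrow> norm \<alpha> \<le> K \<Longrightarrow> (\<forall>t. norm (f t) \<le> B * phi t) \<Longrightarrow> (\<forall>t. norm (g t) \<le> B) \<Longrightarrow>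
       \<bar>y' - y\<bar> < d \<Longrightarrow> norm (g y' - g y) < \<epsilon>" by blast
    show ?thesis
    proof (intro exI[of _ d] conjI d(1) allI impI)
      fix n y' assume "\<bar>y' - y\<bar> < d"
      then show "norm (mode m (M n) y' - mode m (M n) y) < \<epsilon>"
        using ev[of n] srcb modeb K by (intro d(2)[of "a (zn n) m" "src m (M n)"]) (auto simp: evo_def)
    qed
  qed
  obtain r h where r: "strict_mono (r :: nat \<Rightarrow> nat)" and h: "\<And>m y. (\<lambda>n. mode m (M (r n)) y) \<longlonglongrightarrow> h m y"
    using equicontinuous_pointwise_subsequence[of "\<lambda>n m y. mode m (M n) y", OF modeb eqc] by metis
  have zr: "(\<lambda>n. zn (r n)) \<longlonglongrightarrow> z" using LIMSEQ_subseq_LIMSEQ[OF z r] by (simp add: o_def)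
  obtain s where s: "\<And>n. \<bar>Re (zn n)\<bar> \<le> s"
  proof -
    have "Bseq zn" using z by (intro convergent_imp_Bseq convergentI)
    then obtain K where "\<And>n. norm (zn n) \<le> K" unfolding Bseq_def by blast
    then show thesis using that abs_Re_le_cmod order.trans by metis
  qed
  \<comment> \<open>The limits \<open>h\<close> of the low modes account for half of \<epsilon>, the
    two tails for a quarter each. The estimate is uniform in \<open>x\<close>, so that the limit
    function is continuous in \<open>x\<close>.\<close>
  have unif: "\<exists>N. \<forall>n\<ge>N. \<forall>k\<ge>N. \<forall>x. norm (M (r n) x y - M (r k) x y) \<le> \<epsilon>" if \<epsilon>: "0 < \<epsilon>" for y \<epsilon>
  proof -
    obtain R where R: "\<And>z M Z y1 A. \<bar>Re z\<bar> \<le> s \<Longrightarrow> slice M \<Longrightarrow> evo z M \<Longrightarrow> 0 < Z \<Longrightarrow> (\<And>x t. t \<le> y1 \<Longrightarrow> norm (M x t) \<le> Z) \<Longrightarrow>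
       finite A \<Longrightarrow> (\<And>m. m \<in> A \<Longrightarrow> int R < \<bar>m\<bar>) \<Longrightarrow> (\<Sum>m\<in>A. norm (mode m M y1)) \<le> \<epsilon> / (4 * B) * Z"
      using mode_tail[of "\<epsilon> / (4 * B)" s] \<epsilon> B by (metis divide_pos_pos mult_pos_pos zero_less_numeral)
    have H: "(\<Sum>m\<in>A. norm (mode m (M n) y)) \<le> \<epsilon> / 4" if "finite A" "\<forall>m\<in>A. int R < \<bar>m\<bar>" for A n
      using R[OF s sl ev B, of y n A] Mb that B by auto
    have "(\<lambda>n. \<Sum>m\<in>{- int R..int R}. norm (mode m (M (r n)) y - h m y)) \<longlonglongrightarrow> (\<Sum>m\<in>{- int R..int R}. norm (h m y - h m y))"
      by (intro tendsto_intros h)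
    then have "eventually (\<lambda>n. (\<Sum>m\<in>{- int R..int R}. norm (mode m (M (r n)) y - h m y)) < \<epsilon> / 4) sequentially"
      by (rule order_tendstoD) (use \<epsilon> in auto)
    then obtain N where N: "\<And>n. n \<ge> N \<Longrightarrow> (\<Sum>m\<in>{- int R..int R}. norm (mode m (M (r n)) y - h m y)) < \<epsilon> / 4"
      by (auto simp: eventually_sequentially)
    show ?thesis
    proof (intro exI[of _ N] allI impI)
      fix n k x assume nk: "n \<ge> N" "k \<ge> N"
      have "norm (M (r n) x y - M (r k) x y) \<le> (\<Sum>m\<in>{- int R..int R}. norm (mode m (M (r n)) y - mode m (M (r k)) y)) + (\<epsilon> / 4 + \<epsilon> / 4)"
        by (rule norm_slice_diff_le[OF sl sl H H])
      also have "(\<Sum>m\<in>{- int R..int R}. norm (mode m (M (r n)) y - mode m (M (r k)) y))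
        \<le> (\<Sum>m\<in>{- int R..int R}. norm (mode m (M (r n)) y - h m y) + norm (mode m (M (r k)) y - h m y))"
        by (intro sum_mono) (metis dist_norm dist_triangle2)
      also have "\<dots> \<le> \<epsilon> / 4 + \<epsilon> / 4" unfolding sum.distrib using N[OF nk(1)] N[OF nk(2)] by linarith
      finally show "norm (M (r n) x y - M (r k) x y) \<le> \<epsilon>" by simp
    qed
  qed
  define N where "N x y = lim (\<lambda>n. M (r n) x y)" for x y
  have lim: "(\<lambda>n. M (r n) x y) \<longlonglongrightarrow> N x y" for x y
  proof -
    have "Cauchy (\<lambda>n. M (r n) x y)"
    proof (rule CauchyI)
      fix e :: real assume e: "0 < e"
      show "\<exists>K. \<forall>m\<ge>K. \<forall>n\<ge>K. norm (M (r m) x y - M (r n) x y) < e"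
      proof -
        obtain K where "\<forall>n\<ge>K. \<forall>k\<ge>K. \<forall>x. norm (M (r n) x y - M (r k) x y) \<le> e / 2"
          using unif[of "e/2" y] e by auto
        moreover have "e / 2 < e" using e by simp
        ultimately show ?thesis by (intro exI[of _ K]) (blast intro: le_less_trans)
      qed
    qed
    then show ?thesis unfolding N_def by (simp add: Cauchy_convergent_iff convergent_LIMSEQ_iff)
  qed
  have contN: "continuous_on UNIV (\<lambda>x. N x y)" for y
  proof (rule uniform_limit_theorem[where F = sequentially])
    show "uniform_limit UNIV (\<lambda>n x. M (r n) x y) (\<lambda>x. N x y) sequentially"
      unfolding uniform_limit_iff
    proof (intro allI impI)
      fix e :: real assume "0 < e"
      then obtain K where K: "\<And>n k x. n \<ge> K \<Longrightarrow> k \<ge> K \<Longrightarrow> norm (M (r n) x y - M (r k) x y) \<le> e / 2"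
        using unif[of "e/2" y] by (auto simp: half_gt_zero)
      have "norm (M (r n) x y - N x y) \<le> e / 2" if "n \<ge> K" for n x
      proof (rule LIMSEQ_le_const2)
        show "(\<lambda>k. norm (M (r n) x y - M (r k) x y)) \<longlonglongrightarrow> norm (M (r n) x y - N x y)"
          by (intro tendsto_intros lim)
      qed (use K[OF that] in blast)
      then have "norm (M (r n) x y - N x y) < e" if "n \<ge> K" for n x
        using that \<open>0 < e\<close> by (smt (verit) field_sum_of_halves)
      then show "\<forall>\<^sub>F n in sequentially. \<forall>x\<in>UNIV. dist (M (r n) x y) (N x y) < e"
        unfolding eventually_sequentially dist_norm by blast
    qed
  qed (auto simp: sliceD(2)[OF sl])
  have slN: "slice N"
    unfolding slice_def
  proof (intro conjI allI contN)
    show "case_prod N \<in> borel_measurable (borel \<Otimes>\<^sub>M borel)"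
    proof (rule borel_measurable_LIMSEQ_metric)
      show "case_prod (M (r n)) \<in> borel_measurable (borel \<Otimes>\<^sub>M borel)" for n by (rule sliceD(1)[OF sl])
      show "(\<lambda>n. case_prod (M (r n)) p) \<longlonglongrightarrow> case_prod N p" for p using lim by (cases p) simp
    qed
    show "N (x + 2 * l) y = N x y" for x y using sliceD(3)[OF sl] by (simp add: N_def)
  qed
  have Nb: "norm (N x y) \<le> B" for x y
    by (rule LIMSEQ_le_const2[OF tendsto_norm[OF lim]]) (use Mb in blast)
  have modeN: "(\<lambda>n. mode m (M (r n)) y) \<longlonglongrightarrow> mode m N y" for m y
    unfolding mode_def[of m N] by (rule tendsto_mode[OF sl Mb lim sliceD(5)[OF slN]])
  have srcN: "(\<lambda>n. src m (M (r n)) t) \<longlonglongrightarrow> src m N t" for m t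
    by (rule tendsto_src[OF sl Mb lim slN])
  have evN: "evo z N"
    unfolding evo_def lsol_def
  proof (intro allI impI)
    fix m and y0 y :: real assume y: "y0 \<le> y"
    obtain K where K: "0 \<le> K" "\<And>n. norm (a (zn n) m) \<le> K" using abound by blast
    have "(\<lambda>n. LBINT t:{y0<..y}. exp (- a (zn (r n)) m * of_real (y - t)) * src m (M (r n)) t)
       \<longlonglongrightarrow> (LBINT t:{y0<..y}. exp (- a z m * of_real (y - t)) * src m N t)"
      unfolding set_lebesgue_integral_def
    \<comment> \<open>Convergent rates are bounded by some \<open>K\<close>, which bounds the
      exponentials on the interval uniformly in \<open>n\<close>.\<close>
    proof (rule integral_dominated_convergence[where w = "\<lambda>t. exp (K * (y - y0)) * (B * phi t)"])
      show "integrable lborel (\<lambda>t. exp (K * (y - y0)) * (B * phi t))" using phi_integrable by simp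
      show "AE t in lborel. (\<lambda>n. indicat_real {y0<..y} t *\<^sub>R (exp (- a (zn (r n)) m * of_real (y - t)) * src m (M (r n)) t))
         \<longlonglongrightarrow> indicat_real {y0<..y} t *\<^sub>R (exp (- a z m * of_real (y - t)) * src m N t)"
        by (intro AE_I2 tendsto_intros srcN tendsto_a zr)
      have [measurable]: "(\<lambda>t. exp (- \<alpha> * complex_of_real (y - t))) \<in> borel_measurable borel" for \<alpha>
        by (intro borel_measurable_continuous_onI continuous_intros)
      show "(\<lambda>t. indicat_real {y0<..y} t *\<^sub>R (exp (- a (zn (r n)) m * of_real (y - t)) * src m (M (r n)) t)) \<in> borel_measurable lborel" for n
        using src_measurable(1)[OF sl] by measurable
      show "(\<lambda>t. indicat_real {y0<..y} t *\<^sub>R (exp (- a z m * of_real (y - t)) * src m N t)) \<in> borel_measurable lborel"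
        using src_measurable(1)[OF slN] by measurable
      show "AE t in lborel. norm (indicat_real {y0<..y} t *\<^sub>R (exp (- a (zn (r n)) m * of_real (y - t)) * src m (M (r n)) t)) \<le> exp (K * (y - y0)) * (B * phi t)" for n
      proof (rule AE_I2)
        fix t
        show "norm (indicat_real {y0<..y} t *\<^sub>R (exp (- a (zn (r n)) m * of_real (y - t)) * src m (M (r n)) t)) \<le> exp (K * (y - y0)) * (B * phi t)"
        proof (cases "t \<in> {y0<..y}")
          case True
          have "- Re (a (zn (r n)) m) * (y - t) \<le> K * (y - y0)"
            using abs_Re_le_cmod[of "a (zn (r n)) m"] K(2)[of "r n"] True by (intro mult_mono) auto
          then have "norm (exp (- a (zn (r n)) m * of_real (y - t))) \<le> exp (K * (y - y0))" by simp
          then have "norm (exp (- a (zn (r n)) m * of_real (y - t)) * src m (M (r n)) t) \<le> exp (K * (y - y0)) * (B * phi t)"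
            unfolding norm_mult by (intro mult_mono srcb) auto
          then show ?thesis using True by simp
        qed (use B phi_nonneg in auto)
      qed
    qed
    then have "(\<lambda>n. exp (- a (zn (r n)) m * of_real (y - y0)) * mode m (M (r n)) y0
        + (LBINT t:{y0<..y}. exp (- a (zn (r n)) m * of_real (y - t)) * src m (M (r n)) t))
      \<longlonglongrightarrow> exp (- a z m * of_real (y - y0)) * mode m N y0 + (LBINT t:{y0<..y}. exp (- a z m * of_real (y - t)) * src m N t)"
      by (intro tendsto_intros modeN tendsto_a zr)
    moreover have "mode m (M (r n)) y = exp (- a (zn (r n)) m * of_real (y - y0)) * mode m (M (r n)) y0
        + (LBINT t:{y0<..y}. exp (- a (zn (r n)) m * of_real (y - t)) * src m (M (r n)) t)" for n
      using ev[of "r n"] y unfolding evo_def lsol_def by blast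
    ultimately show "mode m N y = exp (- a z m * of_real (y - y0)) * mode m N y0
        + (LBINT t:{y0<..y}. exp (- a z m * of_real (y - t)) * src m N t)"
      using modeN[of m y] by (simp add: LIMSEQ_unique)
  qed
  have sub: "eventually (\<lambda>n. P (r n)) sequentially" if "eventually P sequentially" for P
    using that r by (rule eventually_subseq[rotated])
  have solN: "sol z \<rho> B N"
    unfolding sol_def
  proof (intro conjI allI impI slN evN Nb)
    show "norm (mode m N y) \<le> B * Phi y" if "pos z \<rho> m" for m y
      by (rule tendsto_upperbound[OF tendsto_norm[OF modeN] eventually_mono[OF sub[OF p[OF that]] solD(4)[OF S]]]) auto
    show "norm (mode m N y) \<le> B * (Phi_inf - Phi y)" if "neg z \<rho> m" for m y
      by (rule tendsto_upperbound[OF tendsto_norm[OF modeN] eventually_mono[OF sub[OF q[OF that]] solD(5)[OF S]]]) auto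
    have 0: "(\<lambda>n. norm (mode 0 (M (r n)) y - 1)) \<longlonglongrightarrow> norm (mode 0 N y - 1)" for y
      by (intro tendsto_intros modeN)
    show "norm (mode 0 N y - 1) \<le> B * Phi y" for y
      by (rule LIMSEQ_le_const2[OF 0]) (use solD(6)[OF S] in blast)
    show "norm (mode 0 N y - 1) \<le> B * (Phi_inf - Phi y)" for y
      by (rule LIMSEQ_le_const2[OF 0]) (use solD(7)[OF S] in blast)
  qed
  show thesis by (rule that[OF r solN lim])
qed

end

section \<open>Large imaginary part\<close>

lemma riemann_lebesgue_L1_limit:
  fixes f :: "real \<Rightarrow> complex" and s :: "nat \<Rightarrow> real \<Rightarrow> complex" and c :: "nat \<Rightarrow> real"
  assumes f: "integrable lborel f" and s: "\<And>i. integrable lborel (s i)"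
    and L1: "(\<lambda>i. LBINT t. norm (s i t - f t)) \<longlonglongrightarrow> 0"
    and RL: "\<And>i. (\<lambda>n. LBINT t. s i t * cis (c n * t)) \<longlonglongrightarrow> 0"
  shows "(\<lambda>n. LBINT t. f t * cis (c n * t)) \<longlonglongrightarrow> 0"
proof (rule LIMSEQ_I)
  fix e :: real assume e: "0 < e"
  have [measurable]: "(\<lambda>t. cis (c n * t)) \<in> borel_measurable borel" for n
    unfolding cis_conv_exp by (intro borel_measurable_continuous_onI continuous_intros)
  have int: "integrable lborel (\<lambda>t. g t * cis (c n * t))" if "integrable lborel g" for g n
    by (rule Bochner_Integration.integrable_bound[OF that]) (use that in \<open>auto simp: norm_mult\<close>)
  obtain i where "norm ((LBINT t. norm (s i t - f t)) - 0) < e / 2"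
    using LIMSEQ_D[OF L1, of "e/2"] e by auto
  then have i: "(LBINT t. norm (s i t - f t)) < e / 2" by simp
  obtain N where N: "\<And>n. n \<ge> N \<Longrightarrow> norm (LBINT t. s i t * cis (c n * t)) < e / 2"
    using LIMSEQ_D[OF RL[of i], of "e/2"] e by auto
  show "\<exists>N. \<forall>n\<ge>N. norm ((LBINT t. f t * cis (c n * t)) - 0) < e"
  proof (intro exI allI impI)
    fix n assume n: "n \<ge> N"
    have "(LBINT t. f t * cis (c n * t)) = (LBINT t. s i t * cis (c n * t)) - (LBINT t. (s i t - f t) * cis (c n * t))"
      using int[OF s[of i], of n] int[OF f, of n] by (simp add: left_diff_distrib)
    also have "norm \<dots> \<le> norm (LBINT t. s i t * cis (c n * t)) + norm (LBINT t. (s i t - f t) * cis (c n * t))"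
      by (rule norm_triangle_ineq4)
    also have "norm (LBINT t. (s i t - f t) * cis (c n * t)) \<le> (LBINT t. norm (s i t - f t))"
      by (rule order.trans[OF integral_norm_bound]) (simp add: norm_mult)
    finally show "norm ((LBINT t. f t * cis (c n * t)) - 0) < e" using N[OF n] i by simp
  qed
qed

text \<open>The functions satisfying the claim are closed under sums, multiples and dominated
  limits. Intervals are computed explicitly, Borel sets are reached through a class closed under
  complements and disjoint unions, and integrable functions through simple ones.\<close>

lemma riemann_lebesgue:
  fixes f :: "real \<Rightarrow> complex" and c :: "nat \<Rightarrow> real"
  assumes f: "integrable lborel f" and c: "filterlim (\<lambda>n. \<bar>c n\<bar>) at_top sequentially"
  shows "(\<lambda>n. LBINT t. f t * cis (c n * t)) \<longlonglongrightarrow> 0"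
proof -
  define P where "P f \<longleftrightarrow> integrable lborel f \<and> (\<lambda>n. LBINT t. f t * cis (c n * t)) \<longlonglongrightarrow> 0" for f
  have [measurable]: "(\<lambda>t. cis (c n * t)) \<in> borel_measurable borel" for n
    unfolding cis_conv_exp by (intro borel_measurable_continuous_onI continuous_intros)
  have int: "integrable lborel (\<lambda>t. g t * cis (c n * t))" if "integrable lborel g" for g n
    by (rule Bochner_Integration.integrable_bound[OF that]) (use that in \<open>auto simp: norm_mult\<close>)
  have P_add: "P (\<lambda>t. f t + g t)" if "P f" "P g" for f g
    using that int tendsto_add[of "\<lambda>n. LBINT t. f t * cis (c n * t)" 0 _ "\<lambda>n. LBINT t. g t * cis (c n * t)" 0]
    by (auto simp: P_def ring_distribs)
  have P_mult: "P (\<lambda>t. k * f t)" if "P f" for f k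
    using that tendsto_mult[OF tendsto_const[of k], of "\<lambda>n. LBINT t. f t * cis (c n * t)" 0]
    by (auto simp: P_def mult.assoc)
  \<comment> \<open>The factor 2 is the one in the limit case of \<open>integrable_induct\<close>;
    the triangle inequality then gives the majorant \<open>3 |f|\<close>.\<close>
  have P_lim: "P f" if f: "integrable lborel f" and s: "\<And>i. P (s i)" and pw: "\<And>t. (\<lambda>i. s i t) \<longlonglongrightarrow> f t"
    and bd: "\<And>i t. norm (s i t) \<le> 2 * norm (f t)" for f s
  proof -
    have "(\<lambda>i. LBINT t. norm (s i t - f t)) \<longlonglongrightarrow> (LBINT t::real. 0)"
    proof (rule integral_dominated_convergence[where w = "\<lambda>t. 3 * norm (f t)"])
      show "AE t in lborel. (\<lambda>i. norm (s i t - f t)) \<longlonglongrightarrow> 0"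
        using tendsto_norm[OF tendsto_diff[OF pw tendsto_const]] by (intro AE_I2) (metis cancel_comm_monoid_add_class.diff_cancel norm_zero)
      show "AE t in lborel. norm (norm (s i t - f t)) \<le> 3 * norm (f t)" for i
      proof (rule AE_I2)
        fix t
        have "norm (s i t - f t) \<le> 3 * norm (f t)" using bd[of i t] norm_triangle_ineq4[of "s i t" "f t"] by linarith
        then show "norm (norm (s i t - f t)) \<le> 3 * norm (f t)" by simp
      qed
      show "(\<lambda>t. norm (s i t - f t)) \<in> borel_measurable lborel" for i
        using f s[of i] by (auto simp: P_def)
    qed (use f in auto)
    then show ?thesis
      using riemann_lebesgue_L1_limit[OF f, of s c] s f by (auto simp: P_def)
  qed
  have int_ind: "integrable lborel (indicator A :: real \<Rightarrow> complex)" if "A \<in> sets borel" "emeasure lborel A < \<infinity>" for A :: "real set"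
  proof -
    have "integrable lborel (\<lambda>t. complex_of_real (indicator A t))"
      using that by (intro integrable_of_real integrable_real_indicator) auto
    moreover have "(\<lambda>t. complex_of_real (indicator A t)) = indicator A" by (auto simp: indicator_def)
    ultimately show ?thesis by simp
  qed
  have Icc: "P (indicator {p..q})" for p q :: real
  proof (cases "p \<le> q")
    case True
    have "(\<lambda>n. LBINT t. indicator {p..q} t * cis (c n * t)) \<longlonglongrightarrow> 0"
    proof (rule Lim_null_comparison)
      show "(\<lambda>n. 2 / \<bar>c n\<bar>) \<longlonglongrightarrow> 0"
        by (rule tendsto_divide_0[OF tendsto_const filterlim_at_top_imp_at_infinity[OF c]])
      show "\<forall>\<^sub>F n in sequentially. norm (LBINT t. indicator {p..q} t * cis (c n * t)) \<le> 2 / \<bar>c n\<bar>"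
        using filterlim_at_top_dense[THEN iffD1, OF c, rule_format, of 0]
      proof eventually_elim
        case (elim n)
        let ?F = "\<lambda>t. cis (c n * t) / (\<i> * c n)"
        have D: "(?F has_vector_derivative cis (c n * t)) (at t within {p..q})" for t
          unfolding cis_conv_exp
          by (rule has_vector_derivative_real_field derivative_eq_intros refl | use elim in \<open>simp add: field_simps\<close>)+
        have "(LBINT t. indicator {p..q} t * cis (c n * t)) = (LBINT t. indicator {p..q} t *\<^sub>R cis (c n * t))"
          by (intro Bochner_Integration.integral_cong) (auto simp: indicator_def)
        also have "\<dots> = ?F q - ?F p"
          by (rule integral_FTC_atLeastAtMost[OF True D]) (auto simp: cis_conv_exp intro!: continuous_intros)
        also have "\<dots> = (cis (c n * q) - cis (c n * p)) / (\<i> * c n)" by (simp add: diff_divide_distrib)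
        also have "norm \<dots> \<le> 2 / \<bar>c n\<bar>"
          unfolding norm_divide norm_mult
          using norm_triangle_ineq4[of "cis (c n * q)" "cis (c n * p)"] elim by (simp add: divide_right_mono)
        finally show ?case .
      qed
    qed
    then show ?thesis unfolding P_def using True by (auto intro!: int_ind)
  next
    case False
    then show ?thesis by (simp add: P_def int_ind)
  qed
  have P0: "P (indicator {})" by (simp add: P_def int_ind)
  \<comment> \<open>Cutting with a bounded interval keeps all indicators integrable, so that
    complements can be formed.\<close>
  have bounded_set: "P (indicator (A \<inter> {-k..k}))" if "A \<in> sets borel" for A and k :: real
  proof -
    have "Int_stable (range (\<lambda>a::real. {..a}))" by (auto simp: Int_stable_def)
    moreover have "range (\<lambda>a::real. {..a}) \<subseteq> Pow UNIV" by auto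
    moreover have "A \<in> sigma_sets UNIV (range (\<lambda>a::real. {..a}))"
      using that unfolding borel_eq_atMost by simp
    ultimately show ?thesis
    proof (induction rule: sigma_sets_induct_disjoint)
      case (basic A)
      then obtain a where "A = {..a}" by auto
      then have "A \<inter> {-k..k} = {-k..min a k}" by auto
      then show ?case using Icc by simp
    next
      case empty
      then show ?case by (simp add: P_def int_ind)
    next
      case (compl A)
      have "indicator ((UNIV - A) \<inter> {-k..k}) = (\<lambda>t. indicator {-k..k} t + (-1) * indicator (A \<inter> {-k..k}) t :: complex)"
        by (auto simp: indicator_def fun_eq_iff)
      then show ?case using P_add[OF Icc P_mult[OF compl.IH], of "-k" k "-1"] by simp
    next
      case (union A)
      have Am: "A i \<in> sets borel" for i using union(2) by (auto simp: borel_eq_atMost)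
      have fin: "P (indicator ((\<Union>i<n. A i) \<inter> {-k..k}))" for n
      proof (induction n)
        case 0
        have "(\<Union>i<0::nat. A i) \<inter> {-k..k} = {}" by auto
        then show ?case using P0 by (simp only:)
      next
        case (Suc n)
        have "indicator ((\<Union>i<Suc n. A i) \<inter> {-k..k}) = (\<lambda>t. indicator ((\<Union>i<n. A i) \<inter> {-k..k}) t + indicator (A n \<inter> {-k..k}) t :: complex)"
        proof (rule ext)
          fix t
          have "t \<notin> A n" if "t \<in> A i" "i < n" for i
            using disjoint_family_onD[OF union(1), of i n] that by auto
          then show "indicator ((\<Union>i<Suc n. A i) \<inter> {-k..k}) t = (indicator ((\<Union>i<n. A i) \<inter> {-k..k}) t + indicator (A n \<inter> {-k..k}) t :: complex)"
            by (auto simp: indicator_def less_Suc_eq)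
        qed
        then show ?case using P_add[OF Suc union(3)] by simp
      qed
      show ?case
      proof (rule P_lim[OF _ fin])
        show "integrable lborel (indicator ((\<Union>i. A i) \<inter> {-k..k}) :: real \<Rightarrow> complex)"
        proof (rule int_ind)
          show "(\<Union>i. A i) \<inter> {-k..k} \<in> sets borel" using Am by auto
          have "emeasure lborel ((\<Union>i. A i) \<inter> {-k..k}) \<le> emeasure lborel {-k..k}"
            by (rule emeasure_mono) auto
          also have "\<dots> < \<infinity>" by (simp add: emeasure_lborel_Icc_eq)
          finally show "emeasure lborel ((\<Union>i. A i) \<inter> {-k..k}) < \<infinity>" .
        qed
        fix t
        show "(\<lambda>n. indicator ((\<Union>i<n. A i) \<inter> {-k..k}) t :: complex) \<longlonglongrightarrow> indicator ((\<Union>i. A i) \<inter> {-k..k}) t"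
        proof (cases "t \<in> (\<Union>i. A i)")
          case True
          then obtain i where "t \<in> A i" by auto
          then show ?thesis
            by (intro tendsto_eventually eventually_mono[OF eventually_gt_at_top[of i]]) (auto simp: indicator_def)
        next
          case False
          then show ?thesis by (auto simp: indicator_def)
        qed
        show "norm (indicator ((\<Union>i<n. A i) \<inter> {-k..k}) t :: complex) \<le> 2 * norm (indicator ((\<Union>i. A i) \<inter> {-k..k}) t :: complex)" for n
          by (auto simp: indicator_def)
      qed
    qed
  qed
  have "P f" using f
  proof (induction rule: integrable_induct)
    case (base A k)
    have A: "A \<in> sets borel" using base by simp
    have "P (indicator A)"
    proof (rule P_lim[where s = "\<lambda>i. indicator (A \<inter> {- real i..real i})"])
      show "integrable lborel (indicator A :: real \<Rightarrow> complex)" using base by (intro int_ind) auto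
      show "P (indicator (A \<inter> {- real i..real i}))" for i by (rule bounded_set[OF A])
      fix t :: real
      obtain N :: nat where N: "\<bar>t\<bar> \<le> N" using real_arch_simple by blast
      show "(\<lambda>i. indicator (A \<inter> {- real i..real i}) t :: complex) \<longlonglongrightarrow> indicator A t"
        by (intro tendsto_eventually eventually_mono[OF eventually_ge_at_top[of N]]) (use N in \<open>auto simp: indicator_def abs_le_iff\<close>)
    qed (auto simp: indicator_def)
    then have "P (\<lambda>t. k * indicator A t)" by (rule P_mult)
    moreover have "(\<lambda>t. indicator A t *\<^sub>R k) = (\<lambda>t. k * indicator A t)" by (auto simp: indicator_def)
    ultimately show ?case by simp
  next
    case (add f g)
    then show ?case by (intro P_add)
  next
    case (lim f s)
    then show ?case by (intro P_lim[of f s]) auto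
  qed
  then show ?thesis by (simp add: P_def)
qed

text \<open>Passing to the moving frame leaves only the real part of the rate, which does not depend
  on \<open>Im z\<close>; without this no equicontinuity would be uniform as \<open>Im z\<close>
  grows.\<close>

lemma lsol_phase:
  assumes "lsol \<alpha> f g"
  shows "lsol (of_real (Re \<alpha>)) (\<lambda>t. cis (Im \<alpha> * t) * f t) (\<lambda>y. cis (Im \<alpha> * y) * g y)"
  unfolding lsol_def
proof (intro allI impI)
  fix y0 y :: real assume y: "y0 \<le> y"
  have e: "cis (Im \<alpha> * y) * exp (- \<alpha> * of_real (y - t)) = exp (- of_real (Re \<alpha>) * of_real (y - t)) * cis (Im \<alpha> * t)" for t
    unfolding cis_conv_exp exp_add[symmetric]
    by (rule arg_cong[where f = exp]) (simp add: complex_eq_iff algebra_simps)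
  have "(LBINT t:{y0<..y}. exp (- of_real (Re \<alpha>) * of_real (y - t)) * (cis (Im \<alpha> * t) * f t))
     = (LBINT t:{y0<..y}. cis (Im \<alpha> * y) * (exp (- \<alpha> * of_real (y - t)) * f t))"
    unfolding mult.assoc[symmetric] e ..
  also have "\<dots> = cis (Im \<alpha> * y) * (LBINT t:{y0<..y}. exp (- \<alpha> * of_real (y - t)) * f t)" by simp
  moreover have "g y = exp (- \<alpha> * of_real (y - y0)) * g y0 + (LBINT t:{y0<..y}. exp (- \<alpha> * of_real (y - t)) * f t)"
    using assms y unfolding lsol_def by blast
  ultimately show "cis (Im \<alpha> * y) * g y = exp (- of_real (Re \<alpha>) * of_real (y - y0)) * (cis (Im \<alpha> * y0) * g y0)
     + (LBINT t:{y0<..y}. exp (- of_real (Re \<alpha>) * of_real (y - t)) * (cis (Im \<alpha> * t) * f t))"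
    using e[of y0] by (simp add: ring_distribs mult.assoc[symmetric])
qed

context potential begin

definition ud :: "int \<Rightarrow> real \<Rightarrow> complex" where "ud k t = md k (\<lambda>x. U x t)"

lemma ud_0: "ud 0 t = 0" using U_0 by (simp add: ud_def md_def)

lemma norm_ud_le: "norm (ud k t) \<le> phi t"
  unfolding ud_def phi_def by (rule norm_md_le[OF U_1])

lemma slice_const: "slice (\<lambda>x y. 1)" by (simp add: slice_def)

lemma ud_measurable [measurable]: "ud k \<in> borel_measurable borel"
  using src_measurable(1)[OF slice_const, of k] by (simp add: src_def[abs_def] ud_def[abs_def])

text \<open>A mode of the product is a convolution of modes. Truncating \<open>M\<close> to its low
  modes leaves a remainder whose supremum is at most the tail sum \<open>H\<close>.\<close>

lemma src_expand:
  assumes M: "slice M" and H: "\<And>A. finite A \<Longrightarrow> (\<forall>m\<in>A. int R < \<bar>m\<bar>) \<Longrightarrow> (\<Sum>m\<in>A. norm (mode m M t)) \<le> H"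
  shows "norm (src m M t - (\<Sum>j\<in>{-int R..int R}. ud (m - j) t * mode j M t)) \<le> H * phi t"
proof -
  let ?L = "{-int R..int R}"
  define F where "F x = M x t - (\<Sum>j\<in>?L. mode j M t * em j x)" for x
  have iMt: "integrable X (\<lambda>x. M x t)" by (rule sliceD[OF M])
  have cP: "continuous_on UNIV (\<lambda>x. \<Sum>j\<in>?L. mode j M t * em j x)" by (intro continuous_intros)
  have cF: "continuous_on UNIV F" unfolding F_def by (intro continuous_intros cP sliceD(2)[OF M])
  have mdP: "md k (\<lambda>x. \<Sum>j\<in>?L. mode j M t * em j x) = (if k \<in> ?L then mode k M t else 0)" for k
  proof -
    have "md k (\<lambda>x. \<Sum>j\<in>?L. mode j M t * em j x) = (\<Sum>j\<in>?L. md k (\<lambda>x. mode j M t * em j x))"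
      by (intro md_sum integrable_X_continuous continuous_intros)
    also have "\<dots> = (\<Sum>j\<in>?L. if k = j then mode j M t else 0)"
      by (intro sum.cong) (auto simp: md_cmult md_em)
    finally show ?thesis by simp
  qed
  have mdF: "md k F = (if int R < \<bar>k\<bar> then mode k M t else 0)" for k
  proof -
    have "md k F = md k (\<lambda>x. M x t) - md k (\<lambda>x. \<Sum>j\<in>?L. mode j M t * em j x)"
      unfolding F_def[abs_def] by (rule md_diff[OF iMt integrable_X_continuous[OF cP]])
    then show ?thesis unfolding mdP by (auto simp: mode_def)
  qed
  have Fb: "norm (F x) \<le> H" for x
  proof (rule norm_le_sum_fourier[OF cF])
    show "F (x + 2 * l) = F x" for x using sliceD(3)[OF M] by (simp add: F_def em_period)
    fix A :: "int set" assume A: "finite A"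
    have "(\<Sum>k\<in>A. norm (md k F)) = (\<Sum>k\<in>{k\<in>A. int R < \<bar>k\<bar>}. norm (mode k M t))"
      using A by (simp add: mdF if_distrib[of norm] sum.inter_filter cong: if_cong)
    also have "\<dots> \<le> H" using A by (intro H) auto
    finally show "(\<Sum>k\<in>A. norm (md k F)) \<le> H" .
  qed
  \<comment> \<open>For fixed \<open>t\<close> the remainder is read as a function constant in
    \<open>y\<close>, so that the general bound on sources applies to it.\<close>
  have slF: "slice (\<lambda>x y. F x)"
  proof -
    have [measurable]: "F \<in> borel_measurable borel" using cF by (rule borel_measurable_continuous_onI)
    have "(\<lambda>q. F (fst q)) \<in> borel_measurable (borel \<Otimes>\<^sub>M borel)" by measurable
    then show ?thesis unfolding slice_def using cF sliceD(3)[OF M]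
      by (simp add: case_prod_beta' F_def em_period)
  qed
  have iUF: "integrable X (\<lambda>x. U x t * F x)" by (rule slice_src_integrable[OF slF])
  have iUe: "integrable X (\<lambda>x. em j x * U x t)" for j
    using integrable_em_mult[OF U_1[of t], of j] by (simp add: mult.commute)
  have "(\<lambda>x. U x t * M x t) = (\<lambda>x. U x t * F x + (\<Sum>j\<in>?L. mode j M t * (em j x * U x t)))"
    by (auto simp: F_def algebra_simps sum_distrib_left)
  then have "src m M t = md m (\<lambda>x. U x t * F x) + (\<Sum>j\<in>?L. md m (\<lambda>x. mode j M t * (em j x * U x t)))"
    unfolding src_def using iUF iUe by (simp add: md_add md_sum)
  also have "(\<Sum>j\<in>?L. md m (\<lambda>x. mode j M t * (em j x * U x t))) = (\<Sum>j\<in>?L. ud (m - j) t * mode j M t)"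
    by (simp only: md_cmult md_em_mult ud_def) (simp add: mult.commute)
  finally have "src m M t - (\<Sum>j\<in>?L. ud (m - j) t * mode j M t) = md m (\<lambda>x. U x t * F x)" by simp
  moreover have "norm (md m (\<lambda>x. U x t * F x)) \<le> H * phi t"
    using norm_src_le[OF slF Fb, where m = m] by (simp add: src_def)
  ultimately show ?thesis by simp
qed

text \<open>In the moving frame the modes \<open>p\<close> are equicontinuous, while the potential oscillates and, having mean
  zero in \<open>x\<close>, converges weakly to zero.\<close>

theorem vertical_limit_subsequence:
  fixes b :: "nat \<Rightarrow> real"
  assumes S: "\<And>n. sol (Complex x0 (b n)) \<rho> B (M n)" and B: "0 < B"
    and b: "filterlim (\<lambda>n. \<bar>b n\<bar>) at_top sequentially"
    and nr: "\<And>m. m \<noteq> 0 \<Longrightarrow> Re (a (Complex x0 0) m) \<noteq> 0"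
  obtains r where "strict_mono (r :: nat \<Rightarrow> nat)" "\<And>x y. (\<lambda>n. M (r n) x y) \<longlonglongrightarrow> 1"
proof -
  define rr where "rr m = Re (a (Complex x0 0) m)" for m
  \<comment> \<open>Imaginary part of the rate. It is linear in \<open>m\<close>, so phases of
    different modes differ by a nonzero multiple of \<open>b n\<close>.\<close>
  define \<theta> where "\<theta> n m = 2 * w * of_int m * b n" for n m
  have Rea: "Re (a (Complex x0 (b n)) m) = rr m" and Ima: "Im (a (Complex x0 (b n)) m) = \<theta> n m" for n m
    by (auto simp: rr_def Re_a) (simp add: a_def \<theta>_def power2_eq_square)
  have sl: "slice (M n)" and ev: "evo (Complex x0 (b n)) (M n)" and Mb: "norm (M n x y) \<le> B" for n x y
    using solD[OF S] by auto
  have srcb: "norm (src m (M n) t) \<le> B * phi t" for m n t by (rule norm_src_le[OF sl Mb])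
  have modeb: "norm (mode m (M n) y) \<le> B" for m n y by (rule norm_mode_le[OF sl Mb])
  define p where "p n m y = cis (\<theta> n m * y) * mode m (M n) y" for n m y
  have L: "lsol (of_real (rr m)) (\<lambda>t. cis (\<theta> n m * t) * src m (M n) t) (p n m)" for n m
    using lsol_phase[of "a (Complex x0 (b n)) m" "src m (M n)" "mode m (M n)"] ev[of n]
    by (simp add: evo_def Rea Ima p_def[abs_def])
  have pb: "norm (p n m y) \<le> B" for n m y using modeb by (simp add: p_def norm_mult)
  have eqc: "\<exists>d>0. \<forall>n y'. \<bar>y' - y\<bar> < d \<longrightarrow> norm (p n m y' - p n m y) < \<epsilon>" if "0 < \<epsilon>" for m y \<epsilon>
  proof -
    from lsol_equicontinuous[OF that B, of "\<bar>rr m\<bar>" y]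
    obtain d where d: "d > 0" "\<And>\<alpha> f g y'. lsol \<alpha> f g \<Longrightarrow> norm \<alpha> \<le> \<bar>rr m\<bar> \<Longrightarrow> (\<forall>t. norm (f t) \<le> B * phi t) \<Longrightarrow> (\<forall>t. norm (g t) \<le> B) \<Longrightarrow>
       \<bar>y' - y\<bar> < d \<Longrightarrow> norm (g y' - g y) < \<epsilon>" by auto
    show ?thesis
    proof (intro exI[of _ d] conjI d(1) allI impI)
      fix n y' assume "\<bar>y' - y\<bar> < d"
      then show "norm (p n m y' - p n m y) < \<epsilon>"
        by (intro d(2)[OF L]) (use srcb pb in \<open>auto simp: norm_mult\<close>)
    qed
  qed
  obtain r h where r: "strict_mono (r :: nat \<Rightarrow> nat)" and h: "\<And>m y. (\<lambda>n. p (r n) m y) \<longlonglongrightarrow> h m y"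
    using equicontinuous_pointwise_subsequence[of p, OF pb eqc] by metis
  have hb: "norm (h m y) \<le> B" for m y
    by (rule LIMSEQ_le_const2[OF tendsto_norm[OF h]]) (use pb in blast)
  have [measurable]: "(\<lambda>y. cis (c * y)) \<in> borel_measurable borel" for c :: real
    unfolding cis_conv_exp by (intro borel_measurable_continuous_onI continuous_intros)
  have pm [measurable]: "p n m \<in> borel_measurable borel" for n m
    unfolding p_def[abs_def] using src_measurable(2)[OF sl] by measurable
  have hm [measurable]: "h m \<in> borel_measurable borel" for m
    by (rule borel_measurable_LIMSEQ_metric[OF pm h])
  have [measurable]: "phi \<in> borel_measurable borel" using phi_integrable by simp
  have tailR: "\<exists>R. \<forall>n y A. finite A \<longrightarrow> (\<forall>m\<in>A. int R < \<bar>m\<bar>) \<longrightarrow> (\<Sum>m\<in>A. norm (mode m (M n) y)) \<le> \<epsilon>" if "0 < \<epsilon>" for \<epsilon>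
  proof -
    have eB: "0 < \<epsilon> / B" using that B by simp
    obtain R where R: "\<And>z M Z y1 A. \<bar>Re z\<bar> \<le> \<bar>x0\<bar> \<Longrightarrow> slice M \<Longrightarrow> evo z M \<Longrightarrow> 0 < Z \<Longrightarrow> (\<And>x t. t \<le> y1 \<Longrightarrow> norm (M x t) \<le> Z) \<Longrightarrow>
       finite A \<Longrightarrow> (\<And>m. m \<in> A \<Longrightarrow> int R < \<bar>m\<bar>) \<Longrightarrow> (\<Sum>m\<in>A. norm (mode m M y1)) \<le> \<epsilon> / B * Z"
      using mode_tail[OF eB, of "\<bar>x0\<bar>"] by metis
    show ?thesis
    proof (intro exI[of _ R] allI impI)
      fix n y and A :: "int set" assume A: "finite A" "\<forall>m\<in>A. int R < \<bar>m\<bar>"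
      have "(\<Sum>m\<in>A. norm (mode m (M n) y)) \<le> \<epsilon> / B * B"
        by (rule R[OF _ sl ev B Mb A(1)]) (use A(2) in auto)
      then show "(\<Sum>m\<in>A. norm (mode m (M n) y)) \<le> \<epsilon>" using B by simp
    qed
  qed
  have bc: "filterlim (\<lambda>n. \<bar>2 * w * of_int k * b (r n)\<bar>) at_top sequentially" if "k \<noteq> 0" for k :: int
  proof -
    have "filterlim (\<lambda>n. \<bar>b (r n)\<bar>) at_top sequentially"
      using filterlim_compose[OF b filterlim_subseq[OF r]] by (simp add: o_def)
    then have "filterlim (\<lambda>n. \<bar>2 * w * of_int k\<bar> * \<bar>b (r n)\<bar>) at_top sequentially"
      by (intro filterlim_tendsto_pos_mult_at_top[OF tendsto_const]) (use that w_pos in auto)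
    then show ?thesis by (simp add: abs_mult)
  qed
  \<comment> \<open>The whole source term of the moving-frame equation disappears in the limit: up
    to an arbitrarily small truncation error it is a finite sum of oscillatory integrals.\<close>
  have weak: "(\<lambda>n. LBINT t:{y0<..y}. exp (- of_real (rr m) * of_real (y - t)) * (cis (\<theta> (r n) m * t) * src m (M (r n)) t)) \<longlonglongrightarrow> 0"
    (is "?I \<longlonglongrightarrow> 0") if y: "y0 \<le> y" for m y0 y
  proof (rule LIMSEQ_I)
    fix \<epsilon> :: real assume \<epsilon>: "0 < \<epsilon>"
    define E where "E t = exp (- complex_of_real (rr m) * of_real (y - t))" for t
    define C where "C = exp (\<bar>rr m\<bar> * (y - y0))"
    have C: "0 < C" by (simp add: C_def)
    have EC: "norm (E t) \<le> C" if "t \<in> {y0<..y}" for t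
    proof -
      have "- rr m * (y - t) \<le> \<bar>rr m\<bar> * (y - y0)" using that by (intro mult_mono) auto
      then show ?thesis by (simp add: E_def C_def)
    qed
    have [measurable]: "E \<in> borel_measurable borel"
      unfolding E_def[abs_def] by (intro borel_measurable_continuous_onI continuous_intros)
    define \<delta> where "\<delta> = \<epsilon> / (2 * C * (Phi_inf + 1))"
    have Pinf: "0 \<le> Phi_inf" using Phi_nonneg[of 0] Phi_le_inf[of 0] by linarith
    have \<delta>: "0 < \<delta>" using \<epsilon> C Pinf by (simp add: \<delta>_def)
    obtain R where R: "\<And>n y A. finite A \<Longrightarrow> (\<forall>m\<in>A. int R < \<bar>m\<bar>) \<Longrightarrow> (\<Sum>m\<in>A. norm (mode m (M n) y)) \<le> \<delta>"
      using tailR[OF \<delta>] by blast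
    let ?L = "{-int R..int R}"
    \<comment> \<open>The contribution of mode \<open>j\<close> to the source of mode
      \<open>m\<close>, with the relative phase made explicit. For \<open>j = m\<close> there is no
      oscillation, but there the coefficient \<open>ud 0\<close> vanishes.\<close>
    define T where "T j n = (LBINT t:{y0<..y}. E t * ud (m - j) t * p (r n) j t * cis (2 * w * of_int (m - j) * b (r n) * t))" for j n
    have T0: "(\<lambda>n. T j n) \<longlonglongrightarrow> 0" for j
    proof (cases "m = j")
      case True
      then show ?thesis by (simp add: T_def ud_0)
    next
      case False
      let ?c = "\<lambda>n. 2 * w * of_int (m - j) * b (r n)"
      let ?g = "\<lambda>t. indicator {y0<..y} t *\<^sub>R (E t * ud (m - j) t * h j t)"
      have pt: "norm (indicator {y0<..y} t *\<^sub>R (E t * ud (m - j) t * q)) \<le> C * phi t * B" if "norm q \<le> B" for t q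
        using EC[of t] norm_ud_le[of "m - j" t] that C phi_nonneg[of t] B
        by (cases "t \<in> {y0<..y}") (auto simp: norm_mult intro!: mult_mono)
      have iC: "integrable lborel (\<lambda>t. C * phi t * B)" using phi_integrable by simp
      have ig: "integrable lborel ?g"
        by (rule Bochner_Integration.integrable_bound[OF iC]) (auto intro!: order.trans[OF pt[OF hb] abs_ge_self] simp del: norm_scaleR)
      have 1: "(\<lambda>n. LBINT t. ?g t * cis (?c n * t)) \<longlonglongrightarrow> 0"
        by (rule riemann_lebesgue[OF ig bc]) (use False in auto)
      \<comment> \<open>The Riemann-Lebesgue lemma needs a fixed amplitude, so \<open>p\<close> is
        replaced by its limit \<open>h\<close>; the error \<open>?d\<close> tends to 0 by dominated
        convergence.\<close>
      let ?d = "\<lambda>n t. indicator {y0<..y} t *\<^sub>R (E t * ud (m - j) t * (p (r n) j t - h j t)) * cis (?c n * t)"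
      have 2: "(\<lambda>n. LBINT t. ?d n t) \<longlonglongrightarrow> (LBINT t::real. 0)"
      proof (rule integral_dominated_convergence[where w = "\<lambda>t. C * phi t * B + C * phi t * B"])
        show "AE t in lborel. (\<lambda>n. ?d n t) \<longlonglongrightarrow> 0"
        proof (rule AE_I2)
          fix t
          have "(\<lambda>n. norm (indicator {y0<..y} t *\<^sub>R (E t * ud (m - j) t * (p (r n) j t - h j t)))) \<longlonglongrightarrow> norm (indicator {y0<..y} t *\<^sub>R (E t * ud (m - j) t * (h j t - h j t)))"
            by (intro tendsto_intros h)
          then show "(\<lambda>n. ?d n t) \<longlonglongrightarrow> 0"
            by (intro tendsto_norm_zero_cancel[of "\<lambda>n. ?d n t"]) (simp add: norm_mult)
        qed
        show "AE t in lborel. norm (?d n t) \<le> C * phi t * B + C * phi t * B" for n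
        proof (rule AE_I2)
          fix t
          have "?d n t = (indicator {y0<..y} t *\<^sub>R (E t * ud (m - j) t * p (r n) j t) - indicator {y0<..y} t *\<^sub>R (E t * ud (m - j) t * h j t)) * cis (?c n * t)"
            by (simp add: algebra_simps)
          then have "norm (?d n t) = norm (indicator {y0<..y} t *\<^sub>R (E t * ud (m - j) t * p (r n) j t) - indicator {y0<..y} t *\<^sub>R (E t * ud (m - j) t * h j t))"
            by (simp only: norm_mult norm_cis mult_1_right)
          also have "\<dots> \<le> C * phi t * B + C * phi t * B"
            by (rule order.trans[OF norm_triangle_ineq4 add_mono[OF pt[OF pb] pt[OF hb]]])
          finally show "norm (?d n t) \<le> C * phi t * B + C * phi t * B" .
        qed
        show "integrable lborel (\<lambda>t. C * phi t * B + C * phi t * B)" using iC by simp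
      qed measurable
      have ipn: "integrable lborel (\<lambda>t. ?d n t)" for n
      proof (rule Bochner_Integration.integrable_bound[of _ "\<lambda>t. C * phi t * B + C * phi t * B"])
        show "AE t in lborel. norm (?d n t) \<le> norm (C * phi t * B + C * phi t * B)"
        proof (rule AE_I2)
          fix t
          have "?d n t = (indicator {y0<..y} t *\<^sub>R (E t * ud (m - j) t * p (r n) j t) - indicator {y0<..y} t *\<^sub>R (E t * ud (m - j) t * h j t)) * cis (?c n * t)"
            by (simp add: algebra_simps)
          then have "norm (?d n t) = norm (indicator {y0<..y} t *\<^sub>R (E t * ud (m - j) t * p (r n) j t) - indicator {y0<..y} t *\<^sub>R (E t * ud (m - j) t * h j t))"
            by (simp only: norm_mult norm_cis mult_1_right)
          also have "\<dots> \<le> C * phi t * B + C * phi t * B"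
            by (rule order.trans[OF norm_triangle_ineq4 add_mono[OF pt[OF pb] pt[OF hb]]])
          finally show "norm (?d n t) \<le> norm (C * phi t * B + C * phi t * B)" by simp
        qed
        show "integrable lborel (\<lambda>t. C * phi t * B + C * phi t * B)" using iC by simp
      qed measurable
      have igc: "integrable lborel (\<lambda>t. ?g t * cis (?c n * t))" for n
        by (rule Bochner_Integration.integrable_bound[OF ig]) (auto simp: norm_mult)
      have "T j n = (LBINT t. ?g t * cis (?c n * t) + ?d n t)" for n
        unfolding T_def set_lebesgue_integral_def by (intro Bochner_Integration.integral_cong) (auto simp: algebra_simps)
      then have "T j n = (LBINT t. ?g t * cis (?c n * t)) + (LBINT t. ?d n t)" for n
        by (simp only: Bochner_Integration.integral_add[OF igc ipn])
      then show ?thesis using tendsto_add[OF 1 2] by simp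
    qed
    have main: "norm (?I n - (\<Sum>j\<in>?L. T j n)) \<le> C * \<delta> * Phi_inf" for n
    proof -
      define G where "G t = cis (\<theta> (r n) m * t) * (src m (M (r n)) t - (\<Sum>j\<in>?L. ud (m - j) t * mode j (M (r n)) t))" for t
      \<comment> \<open>The phase of mode \<open>m\<close> splits into the one absorbed in
        \<open>p\<close> for mode \<open>j\<close> and the relative phase of
        \<open>T\<close>.\<close>
      have cisprod: "cis (\<theta> (r n) m * t) * mode j (M (r n)) t = p (r n) j t * cis (2 * w * of_int (m - j) * b (r n) * t)" for j t
      proof -
        have "cis (\<theta> (r n) m * t) = cis (\<theta> (r n) j * t) * cis (2 * w * of_int (m - j) * b (r n) * t)"
          unfolding cis_mult by (rule arg_cong[where f = cis]) (simp add: \<theta>_def algebra_simps)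
        then show ?thesis by (simp add: p_def mult_ac)
      qed
      have iT: "set_integrable lborel {y0<..y} (\<lambda>t. E t * ud (m - j) t * p (r n) j t * cis (2 * w * of_int (m - j) * b (r n) * t))" for j
      proof (rule set_integrable_bound[of _ _ "\<lambda>t. C * B * phi t"])
        show "AE t in lborel. t \<in> {y0<..y} \<longrightarrow> norm (E t * ud (m - j) t * p (r n) j t * cis (2 * w * of_int (m - j) * b (r n) * t)) \<le> norm (C * B * phi t)"
        proof (intro AE_I2 impI)
          fix t assume t: "t \<in> {y0<..y}"
          have "norm (E t) * norm (ud (m - j) t) * norm (p (r n) j t) \<le> C * phi t * B"
            using EC[OF t] norm_ud_le[of "m - j" t] pb[of "r n" j t] C phi_nonneg[of t] by (intro mult_mono) auto
          then show "norm (E t * ud (m - j) t * p (r n) j t * cis (2 * w * of_int (m - j) * b (r n) * t)) \<le> norm (C * B * phi t)"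
            using abs_ge_self[of "C * B * phi t"] by (simp add: norm_mult mult_ac)
        qed
        show "set_borel_measurable lborel {y0<..y} (\<lambda>t. E t * ud (m - j) t * p (r n) j t * cis (2 * w * of_int (m - j) * b (r n) * t))"
          unfolding set_borel_measurable_def by measurable
      qed (intro set_integrable_mult_right phi_set, simp)
      have iS: "set_integrable lborel {y0<..y} (\<lambda>t. E t * (cis (\<theta> (r n) m * t) * src m (M (r n)) t))"
      proof -
        have "set_integrable lborel {y0<..y} (\<lambda>t. (E t * cis (\<theta> (r n) m * t)) * src m (M (r n)) t)"
          by (rule src_integrable[OF sl, where B = B and C = C]) (use Mb EC in \<open>auto simp: norm_mult\<close>)
        then show ?thesis by (simp add: mult.assoc)
      qed
      have "?I n - (\<Sum>j\<in>?L. T j n) = (LBINT t:{y0<..y}. E t * (cis (\<theta> (r n) m * t) * src m (M (r n)) t)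
          - (\<Sum>j\<in>?L. E t * ud (m - j) t * p (r n) j t * cis (2 * w * of_int (m - j) * b (r n) * t)))"
      proof -
        have "(\<Sum>j\<in>?L. T j n) = (LBINT t:{y0<..y}. (\<Sum>j\<in>?L. E t * ud (m - j) t * p (r n) j t * cis (2 * w * of_int (m - j) * b (r n) * t)))"
          unfolding T_def set_lebesgue_integral_def scaleR_sum_right
          using iT by (subst Bochner_Integration.integral_sum) (auto simp: set_integrable_def)
        moreover have "set_integrable lborel {y0<..y} (\<lambda>t. \<Sum>j\<in>?L. E t * ud (m - j) t * p (r n) j t * cis (2 * w * of_int (m - j) * b (r n) * t))"
          unfolding set_integrable_def scaleR_sum_right
          using iT by (intro Bochner_Integration.integrable_sum) (auto simp: set_integrable_def)
        ultimately show ?thesis using iS by (simp add: E_def)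
      qed
      also have "\<dots> = (LBINT t:{y0<..y}. E t * G t)"
      proof (intro set_lebesgue_integral_cong allI impI)
        fix t
        have "(\<Sum>j\<in>?L. E t * ud (m - j) t * p (r n) j t * cis (2 * w * of_int (m - j) * b (r n) * t))
            = E t * (cis (\<theta> (r n) m * t) * (\<Sum>j\<in>?L. ud (m - j) t * mode j (M (r n)) t))"
          unfolding sum_distrib_left
        proof (intro sum.cong refl)
          fix j
          have "E t * ud (m - j) t * p (r n) j t * cis (2 * w * of_int (m - j) * b (r n) * t)
              = E t * ud (m - j) t * (cis (\<theta> (r n) m * t) * mode j (M (r n)) t)"
            unfolding cisprod by (rule mult.assoc)
          then show "E t * ud (m - j) t * p (r n) j t * cis (2 * w * of_int (m - j) * b (r n) * t)
              = E t * (cis (\<theta> (r n) m * t) * (ud (m - j) t * mode j (M (r n)) t))"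
            by (simp only: mult_ac)
        qed
        then show "E t * (cis (\<theta> (r n) m * t) * src m (M (r n)) t)
            - (\<Sum>j\<in>?L. E t * ud (m - j) t * p (r n) j t * cis (2 * w * of_int (m - j) * b (r n) * t)) = E t * G t"
          by (simp only: G_def right_diff_distrib)
      qed simp
      also have "norm \<dots> \<le> (LBINT t:{y0<..y}. C * \<delta> * phi t)"
      proof (rule norm_set_integral_le)
        fix t assume t: "t \<in> {y0<..y}"
        have "norm (G t) \<le> \<delta> * phi t"
          unfolding G_def norm_mult norm_cis mult_1_left by (rule src_expand[OF sl R])
        then show "norm (E t * G t) \<le> C * \<delta> * phi t"
          unfolding norm_mult mult.assoc using EC[OF t] C by (intro mult_mono) auto
      qed (intro set_integrable_mult_right phi_set, simp)
      also have "\<dots> = C * \<delta> * (Phi y - Phi y0)" using y by (simp add: Phi_diff)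
      also have "\<dots> \<le> C * \<delta> * Phi_inf"
        using C \<delta> Phi_le_inf[of y] Phi_nonneg[of y0] by (intro mult_left_mono) auto
      finally show ?thesis .
    qed
    have "(\<lambda>n. \<Sum>j\<in>?L. T j n) \<longlonglongrightarrow> (\<Sum>j\<in>?L. 0)" by (intro tendsto_sum T0)
    then have "(\<lambda>n. \<Sum>j\<in>?L. T j n) \<longlonglongrightarrow> 0" by simp
    then obtain N where N: "\<And>n. n \<ge> N \<Longrightarrow> norm ((\<Sum>j\<in>?L. T j n) - 0) < \<epsilon> / 2"
      using LIMSEQ_D[of "\<lambda>n. \<Sum>j\<in>?L. T j n" 0 "\<epsilon> / 2"] \<epsilon> by auto
    have half: "C * \<delta> * Phi_inf \<le> \<epsilon> / 2"
    proof -
      have "C * \<delta> * Phi_inf = \<epsilon> / 2 * (Phi_inf / (Phi_inf + 1))" using C by (simp add: \<delta>_def)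
      also have "\<dots> \<le> \<epsilon> / 2 * 1" using Pinf \<epsilon> by (intro mult_left_mono) (auto simp: divide_le_eq)
      finally show ?thesis by simp
    qed
    show "\<exists>N. \<forall>n\<ge>N. norm (?I n - 0) < \<epsilon>"
    proof (intro exI[of _ N] allI impI)
      fix n assume n: "n \<ge> N"
      have "norm (?I n) \<le> norm (?I n - (\<Sum>j\<in>?L. T j n)) + norm (\<Sum>j\<in>?L. T j n)"
        using norm_triangle_ineq[of "?I n - (\<Sum>j\<in>?L. T j n)" "\<Sum>j\<in>?L. T j n"] by (simp only: diff_add_cancel)
      then show "norm (?I n - 0) < \<epsilon>"
        using main[of n] half N[OF n, unfolded diff_zero] unfolding diff_zero by linarith
    qed
  qed
  \<comment> \<open>The limit modes solve the equation without source.\<close>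
  have heq: "h m y = exp (- of_real (rr m) * of_real (y - y0)) * h m y0" if y: "y0 \<le> y" for m y0 y
  proof -
    have "p (r n) m y = exp (- of_real (rr m) * of_real (y - y0)) * p (r n) m y0
      + (LBINT t:{y0<..y}. exp (- of_real (rr m) * of_real (y - t)) * (cis (\<theta> (r n) m * t) * src m (M (r n)) t))" for n
      using L[of m "r n"] y unfolding lsol_def by blast
    moreover have "(\<lambda>n. exp (- of_real (rr m) * of_real (y - y0)) * p (r n) m y0
      + (LBINT t:{y0<..y}. exp (- of_real (rr m) * of_real (y - t)) * (cis (\<theta> (r n) m * t) * src m (M (r n)) t)))
      \<longlonglongrightarrow> exp (- of_real (rr m) * of_real (y - y0)) * h m y0 + 0"
      by (intro tendsto_intros h weak y)
    ultimately show ?thesis using h[of m y] by (simp add: LIMSEQ_unique)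
  qed
  \<comment> \<open>A bounded solution of the homogeneous equation with nonzero rate vanishes: its
    value at \<open>y\<close> is compared with that at \<open>y - n\<close> for a stable mode and at
    \<open>y + n\<close> for an unstable one.\<close>
  have h0: "h m y = 0" if "m \<noteq> 0" for m y
  proof -
    have rm: "rr m \<noteq> 0" using nr[OF that] by (simp add: rr_def)
    have "norm (h m y) \<le> exp (- \<bar>rr m\<bar> * real n) * B" for n
    proof (cases "rr m > 0")
      case True
      have "norm (h m y) = exp (- rr m * real n) * norm (h m (y - real n))"
        using heq[of "y - real n" y m] by (simp add: norm_mult)
      then show ?thesis using hb[of m "y - real n"] True by (simp add: mult_left_mono)
    next
      case False
      have "norm (h m (y + real n)) = exp (- rr m * real n) * norm (h m y)"
        using heq[of y "y + real n" m] by (simp add: norm_mult)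
      then have "exp (- rr m * real n) * norm (h m y) \<le> B" using hb[of m "y + real n"] by simp
      then have "exp (rr m * real n) * (exp (- rr m * real n) * norm (h m y)) \<le> exp (rr m * real n) * B"
        by (intro mult_left_mono) auto
      then show ?thesis using False by (simp add: mult.assoc[symmetric] exp_add[symmetric])
    qed
    moreover have "(\<lambda>n. exp (- \<bar>rr m\<bar> * real n) * B) \<longlonglongrightarrow> 0 * B"
    proof (intro tendsto_intros)
      have "filterlim (\<lambda>n. - (\<bar>rr m\<bar> * real n)) at_bot sequentially"
        unfolding filterlim_uminus_at_bot minus_minus
        by (rule filterlim_tendsto_pos_mult_at_top[OF tendsto_const]) (use rm filterlim_real_sequentially in auto)
      then show "(\<lambda>n. exp (- \<bar>rr m\<bar> * real n)) \<longlonglongrightarrow> 0"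
        using filterlim_compose[OF exp_at_bot, of "\<lambda>n. - (\<bar>rr m\<bar> * real n)"] by simp
    qed
    ultimately have "norm (h m y) \<le> 0 * B" by (intro LIMSEQ_le_const) auto
    then show ?thesis by simp
  qed
  \<comment> \<open>Mode 0 has no phase and rate zero, so its limit is constant; the mass bound at
    -\<infinity> identifies the constant as 1.\<close>
  have h1: "h 0 y = 1" for y
  proof -
    have c: "h 0 y = h 0 s" if "s \<le> y" for s using heq[OF that, of 0] by (simp add: rr_def a_0)
    have "norm (h 0 s - 1) \<le> B * Phi s" for s
    proof (rule LIMSEQ_le_const2)
      show "(\<lambda>n. norm (p (r n) 0 s - 1)) \<longlonglongrightarrow> norm (h 0 s - 1)" by (intro tendsto_intros h)
      show "\<exists>N. \<forall>n\<ge>N. norm (p (r n) 0 s - 1) \<le> B * Phi s"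
        using solD(6)[OF S] by (simp add: p_def \<theta>_def)
    qed
    then have "eventually (\<lambda>s. norm (h 0 y - 1) \<le> B * Phi s) at_bot"
      by (intro eventually_mono[OF eventually_le_at_bot[of y]]) (simp add: c)
    then have "norm (h 0 y - 1) \<le> 0"
      by (intro tendsto_lowerbound[OF Phi_lim_bot[of B]]) auto
    then show ?thesis by simp
  qed
  have "(\<lambda>n. M (r n) x y) \<longlonglongrightarrow> 1" for x y
  proof (rule LIMSEQ_I)
    fix \<epsilon> :: real assume \<epsilon>: "0 < \<epsilon>"
    obtain R where R: "\<And>n y A. finite A \<Longrightarrow> (\<forall>m\<in>A. int R < \<bar>m\<bar>) \<Longrightarrow> (\<Sum>m\<in>A. norm (mode m (M n) y)) \<le> \<epsilon> / 2"
      using tailR[of "\<epsilon>/2"] \<epsilon> by auto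
    let ?L = "{-int R..int R}"
    have mode1: "mode m (\<lambda>x y. 1) y = (if m = 0 then 1 else 0)" for m y by (simp add: mode_def md_const)
    have "(\<lambda>n. norm (mode m (M (r n)) y - mode m (\<lambda>x y. 1) y)) \<longlonglongrightarrow> 0" for m
    proof (cases "m = 0")
      case True
      have "(\<lambda>n. norm (p (r n) 0 y - 1)) \<longlonglongrightarrow> norm (h 0 y - 1)" by (intro tendsto_intros h)
      then show ?thesis using True by (simp add: mode1 h1 p_def \<theta>_def)
    next
      \<comment> \<open>The phases have modulus 1, so convergence to 0 in the moving frame is
        convergence to 0 of the modes themselves.\<close>
      case False
      then show ?thesis using tendsto_norm[OF h[of m y]] by (simp add: mode1 h0 p_def norm_mult)
    qed
    then have "(\<lambda>n. \<Sum>m\<in>?L. norm (mode m (M (r n)) y - mode m (\<lambda>x y. 1) y)) \<longlonglongrightarrow> (\<Sum>m\<in>?L. 0)"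
      by (rule tendsto_sum)
    then have "(\<lambda>n. \<Sum>m\<in>?L. norm (mode m (M (r n)) y - mode m (\<lambda>x y. 1) y)) \<longlonglongrightarrow> 0" by simp
    then obtain N where N: "\<And>n. n \<ge> N \<Longrightarrow> norm ((\<Sum>m\<in>?L. norm (mode m (M (r n)) y - mode m (\<lambda>x y. 1) y)) - 0) < \<epsilon> / 2"
      using LIMSEQ_D[of "\<lambda>n. \<Sum>m\<in>?L. norm (mode m (M (r n)) y - mode m (\<lambda>x y. 1) y)" 0 "\<epsilon> / 2"] \<epsilon> by auto
    show "\<exists>N. \<forall>n\<ge>N. norm (M (r n) x y - 1) < \<epsilon>"
    proof (intro exI[of _ N] allI impI)
      fix n assume n: "n \<ge> N"
      have "norm (M (r n) x y - 1) \<le> (\<Sum>m\<in>?L. norm (mode m (M (r n)) y - mode m (\<lambda>x y. 1) y)) + (\<epsilon> / 2 + 0)"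
      proof (rule norm_slice_diff_le[OF sl slice_const R])
        fix A :: "int set" assume "\<forall>m\<in>A. int R < \<bar>m\<bar>"
        then have "(\<Sum>m\<in>A. norm (mode m (\<lambda>x y. 1) y)) = (\<Sum>m\<in>A. 0)" by (intro sum.cong) (auto simp: mode1)
        then show "(\<Sum>m\<in>A. norm (mode m (\<lambda>x y. 1) y)) \<le> 0" by simp
      qed
      then show "norm (M (r n) x y - 1) < \<epsilon>" using N[OF n] by simp
    qed
  qed
  then show thesis by (rule that[OF r])
qed

end

section \<open>Test functions and the distributional equation\<close>

text \<open>A function is \<open>C\<^sup>\<infinity>\<close> if it belongs to a set of functions that is closed under differentiation.\<close>

definition csmooth :: "(real \<Rightarrow> complex) \<Rightarrow> bool" where
  "csmooth f \<longleftrightarrow> (\<exists>S. f \<in> S \<and> (\<forall>g\<in>S. \<exists>g'\<in>S. \<forall>t. (g has_vector_derivative g' t) (at t)))"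

lemma csmoothE:
  assumes "csmooth f"
  obtains S where "f \<in> S" "\<And>g. g \<in> S \<Longrightarrow> \<exists>g'\<in>S. \<forall>t. (g has_vector_derivative g' t) (at t)"
  using assms unfolding csmooth_def by (elim exE conjE) (rule that, assumption, blast)

lemma csmoothI:
  assumes "f \<in> S" "\<And>g. g \<in> S \<Longrightarrow> \<exists>g'\<in>S. \<forall>t. (g has_vector_derivative g' t) (at t)"
  shows "csmooth f"
  using assms unfolding csmooth_def by (intro exI[of _ S]) simp

lemma csmooth_derivatives:
  assumes "csmooth f"
  obtains d where "d 0 = f" "\<And>n t. (d n has_vector_derivative d (Suc n) t) (at t)"
proof -
  obtain S where S: "f \<in> S" "\<And>g. g \<in> S \<Longrightarrow> \<exists>g'\<in>S. \<forall>t. (g has_vector_derivative g' t) (at t)"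
    using csmoothE[OF assms(1)] by metis
  have "\<exists>d. \<forall>n. (d n \<in> S \<and> (n = 0 \<longrightarrow> d n = f)) \<and> (\<forall>t. (d n has_vector_derivative d (Suc n) t) (at t))"
    using S by (intro dependent_nat_choice) auto
  then show thesis using that by blast
qed

lemma csmooth_continuous:
  assumes "csmooth f"
  shows "continuous_on UNIV f"
proof -
  obtain d where d: "d 0 = f" "\<And>n t. (d n has_vector_derivative d (Suc n) t) (at t)"
    using csmooth_derivatives[OF assms] by metis
  have "isCont f t" for t using d(2)[of 0 t] unfolding d(1) by (rule has_vector_derivative_continuous)
  then show ?thesis by (simp add: continuous_at_imp_continuous_on)
qed

text \<open>Sums have to be included because the Leibniz rule leaves the set of plain
  products.\<close>

inductive_set products :: "(real \<Rightarrow> complex) set \<Rightarrow> (real \<Rightarrow> complex) set \<Rightarrow> (real \<Rightarrow> complex) set"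
  for S T where
  prod: "f \<in> S \<Longrightarrow> g \<in> T \<Longrightarrow> (\<lambda>t. f t * g t) \<in> products S T"
| add: "f \<in> products S T \<Longrightarrow> g \<in> products S T \<Longrightarrow> (\<lambda>t. f t + g t) \<in> products S T"

lemma csmooth_mult:
  assumes "csmooth f" "csmooth g"
  shows "csmooth (\<lambda>t. f t * g t)"
proof -
  obtain S where S: "f \<in> S" "\<And>g. g \<in> S \<Longrightarrow> \<exists>g'\<in>S. \<forall>t. (g has_vector_derivative g' t) (at t)"
    using csmoothE[OF assms(1)] by metis
  obtain T where T: "g \<in> T" "\<And>g. g \<in> T \<Longrightarrow> \<exists>g'\<in>T. \<forall>t. (g has_vector_derivative g' t) (at t)"
    using csmoothE[OF assms(2)] by metis
  have "\<exists>h'\<in>products S T. \<forall>t. (h has_vector_derivative h' t) (at t)" if "h \<in> products S T" for h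
    using that
  proof induction
    case (prod f g)
    obtain f' g' where *: "f' \<in> S" "g' \<in> T" "\<And>t. (f has_vector_derivative f' t) (at t)" "\<And>t. (g has_vector_derivative g' t) (at t)"
      using S(2)[OF prod(1)] T(2)[OF prod(2)] by blast
    show ?case
    proof (intro bexI allI)
      show "(\<lambda>t. f t * g' t + f' t * g t) \<in> products S T"
        by (intro products.add products.prod * prod)
      show "((\<lambda>t. f t * g t) has_vector_derivative f t * g' t + f' t * g t) (at t)" for t
        by (rule has_vector_derivative_mult[OF *(3,4)])
    qed
  next
    case (add f g)
    then obtain f' g' where *: "f' \<in> products S T" "g' \<in> products S T"
      "\<And>t. (f has_vector_derivative f' t) (at t)" "\<And>t. (g has_vector_derivative g' t) (at t)" by blast
    show ?case
      by (rule bexI[of _ "\<lambda>t. f' t + g' t"]) (auto intro: products.add * has_vector_derivative_add)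
  qed
  moreover have "(\<lambda>t. f t * g t) \<in> products S T" by (intro products.prod S(1) T(1))
  ultimately show ?thesis by (rule csmoothI[rotated])
qed

text \<open>The prefactor is part of the closed family because every differentiation produces a
  further factor \<open>q\<close>.\<close>

lemma csmooth_affine:
  assumes "csmooth f"
  shows "csmooth (\<lambda>t. of_real r * f (p + q * t))"
proof -
  obtain S where S: "f \<in> S" "\<And>g. g \<in> S \<Longrightarrow> \<exists>g'\<in>S. \<forall>t. (g has_vector_derivative g' t) (at t)"
    using csmoothE[OF assms(1)] by metis
  let ?T = "{\<lambda>t. of_real r * g (p + q * t) | r g. g \<in> S}"
  have "\<exists>h'\<in>?T. \<forall>t. (h has_vector_derivative h' t) (at t)" if "h \<in> ?T" for h
  proof -
    obtain r g where g: "g \<in> S" "h = (\<lambda>t. of_real r * g (p + q * t))" using \<open>h \<in> ?T\<close> by blast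
    then obtain g' where g': "g' \<in> S" "\<And>t. (g has_vector_derivative g' t) (at t)" using S(2) by blast
    show ?thesis
    proof (rule bexI[of _ "\<lambda>t. of_real (r * q) * g' (p + q * t)"])
      show "\<forall>t. (h has_vector_derivative of_real (r * q) * g' (p + q * t)) (at t)"
      proof
        fix t
        have "((\<lambda>t. p + q * t) has_vector_derivative q) (at t)"
          by (auto intro!: derivative_eq_intros simp: has_real_derivative_iff_has_vector_derivative[symmetric])
        then have "((\<lambda>t. g (p + q * t)) has_vector_derivative q *\<^sub>R g' (p + q * t)) (at t)"
          using vector_diff_chain_at[of "\<lambda>t. p + q * t" q t g "g' (p + q * t)"] g'(2)[of "p + q * t"] by (simp add: o_def)
        then have "((\<lambda>t. of_real r * g (p + q * t)) has_vector_derivative of_real r * (q *\<^sub>R g' (p + q * t))) (at t)"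
          by (rule has_vector_derivative_mult_right)
        then show "(h has_vector_derivative of_real (r * q) * g' (p + q * t)) (at t)"
          by (simp add: g scaleR_conv_of_real mult.assoc)
      qed
      show "(\<lambda>t. of_real (r * q) * g' (p + q * t)) \<in> ?T" using g' by blast
    qed
  qed
  moreover have "(\<lambda>t. of_real r * f (p + q * t)) \<in> ?T" using S(1) by blast
  ultimately show ?thesis by (rule csmoothI[rotated])
qed

lemma csmooth_antiderivative:
  assumes "csmooth f" "\<And>t. (F has_vector_derivative f t) (at t)"
  shows "csmooth F"
proof -
  obtain S where S: "f \<in> S" "\<And>g. g \<in> S \<Longrightarrow> \<exists>g'\<in>S. \<forall>t. (g has_vector_derivative g' t) (at t)"
    using csmoothE[OF assms(1)] by metis
  show ?thesis
  proof (rule csmoothI[of F "insert F S"])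
    fix g assume "g \<in> insert F S"
    then show "\<exists>g'\<in>insert F S. \<forall>t. (g has_vector_derivative g' t) (at t)"
      using S(1) S(2)[of g] assms(2) by auto
  qed simp
qed

lemma csmooth_diff:
  assumes "csmooth f" "csmooth g"
  shows "csmooth (\<lambda>t. f t - g t)"
proof -
  obtain S where S: "f \<in> S" "\<And>g. g \<in> S \<Longrightarrow> \<exists>g'\<in>S. \<forall>t. (g has_vector_derivative g' t) (at t)"
    using csmoothE[OF assms(1)] by metis
  obtain T where T: "g \<in> T" "\<And>g. g \<in> T \<Longrightarrow> \<exists>g'\<in>T. \<forall>t. (g has_vector_derivative g' t) (at t)"
    using csmoothE[OF assms(2)] by metis
  let ?D = "{\<lambda>t. f t - g t | f g. f \<in> S \<and> g \<in> T}"
  have "\<exists>h'\<in>?D. \<forall>t. (h has_vector_derivative h' t) (at t)" if "h \<in> ?D" for h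
  proof -
    obtain f g where h: "f \<in> S" "g \<in> T" "h = (\<lambda>t. f t - g t)" using \<open>h \<in> ?D\<close> by blast
    obtain f' g' where *: "f' \<in> S" "g' \<in> T" "\<And>t. (f has_vector_derivative f' t) (at t)" "\<And>t. (g has_vector_derivative g' t) (at t)"
      using S(2)[OF h(1)] T(2)[OF h(2)] by blast
    show ?thesis
      by (rule bexI[of _ "\<lambda>t. f' t - g' t"]) (use * h(3) in \<open>auto intro: has_vector_derivative_diff\<close>)
  qed
  moreover have "(\<lambda>t. f t - g t) \<in> ?D" using S(1) T(1) by blast
  ultimately show ?thesis by (rule csmoothI[rotated])
qed

lemma csmooth_exp: "csmooth (\<lambda>t. exp (c * of_real t))"
proof -
  let ?T = "{\<lambda>t. k * exp (c * of_real t) | k. True}"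
  have "\<exists>h'\<in>?T. \<forall>t. (h has_vector_derivative h' t) (at t)" if "h \<in> ?T" for h
  proof -
    obtain k where h: "h = (\<lambda>t. k * exp (c * of_real t))" using \<open>h \<in> ?T\<close> by blast
    show ?thesis
    proof (rule bexI[of _ "\<lambda>t. (k * c) * exp (c * of_real t)"])
      show "\<forall>t. (h has_vector_derivative (k * c) * exp (c * of_real t)) (at t)"
        unfolding h by (intro allI has_vector_derivative_real_field) (auto intro!: derivative_eq_intros)
    qed blast
  qed
  moreover have "(\<lambda>t. exp (c * of_real t)) \<in> ?T" by (auto intro: exI[of _ 1])
  ultimately show ?thesis by (rule csmoothI[rotated])
qed

section \<open>Flat functions, bumps and mollifiers\<close>

definition flat :: "real poly \<Rightarrow> real \<Rightarrow> real" where
  "flat p t = (if 0 < t then poly p (1 / t) * exp (- 1 / t) else 0)"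

lemma poly_exp_limit: "((\<lambda>x. poly p x / exp x) \<longlongrightarrow> (0::real)) at_top"
proof -
  have "((\<lambda>x. \<Sum>i\<le>degree p. coeff p i * (x ^ i / exp x)) \<longlongrightarrow> (\<Sum>i\<le>degree p. coeff p i * 0)) at_top"
    by (intro tendsto_intros tendsto_power_div_exp_0)
  then show ?thesis by (simp add: poly_altdef sum_divide_distrib)
qed

text \<open>With \<open>s = 1 / t\<close> the derivative of \<open>p(s) exp (- s)\<close> is
  \<open>s^2 (p(s) - p'(s)) exp (- s)\<close>. The family is thus closed under differentiation,
  which is what \<open>csmooth\<close> asks for.\<close>

lemma flat_deriv: "(flat p has_real_derivative flat ([:0, 0, 1:] * (p - pderiv p)) t) (at t)"
proof (cases t "0 :: real" rule: linorder_cases)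
  case less
  have "((\<lambda>_. 0) has_real_derivative 0) (at t)" by simp
  moreover have "eventually (\<lambda>s. 0 = flat p s) (nhds t)"
    using eventually_nhds_in_open[of "{..<0}" t] less by (auto simp: flat_def elim!: eventually_mono)
  ultimately show ?thesis using less DERIV_cong_ev[of t t "\<lambda>_. 0" "flat p" 0 0] by (simp add: flat_def)
next
  case greater
  have "((\<lambda>s. poly p (1 / s) * exp (- 1 / s)) has_real_derivative
      poly (pderiv p) (1 / t) * (- 1 / t\<^sup>2) * exp (- 1 / t) + poly p (1 / t) * (exp (- 1 / t) * (1 / t\<^sup>2))) (at t)"
    using greater by (auto intro!: derivative_eq_intros DERIV_chain2[OF poly_DERIV] simp: power2_eq_square field_simps)
  moreover have "eventually (\<lambda>s. poly p (1 / s) * exp (- 1 / s) = flat p s) (nhds t)"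
    using eventually_nhds_in_open[of "{0<..}" t] greater by (auto simp: flat_def elim!: eventually_mono)
  moreover have "poly (pderiv p) (1 / t) * (- 1 / t\<^sup>2) * exp (- 1 / t) + poly p (1 / t) * (exp (- 1 / t) * (1 / t\<^sup>2))
      = flat ([:0, 0, 1:] * (p - pderiv p)) t"
    using greater by (simp add: flat_def power2_eq_square field_simps)
  ultimately show ?thesis using DERIV_cong_ev[of t t "\<lambda>s. poly p (1 / s) * exp (- 1 / s)" "flat p"] by simp
next
  case equal
  \<comment> \<open>At the origin the right difference quotient is again a polynomial in
    \<open>1 / h\<close> over \<open>exp (1 / h)\<close>; the left one is identically 0.\<close>
  have "((\<lambda>h. (flat p (0 + h) - flat p 0) / h) \<longlongrightarrow> 0) (at 0)"
    unfolding filterlim_at_split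
  proof
    show "((\<lambda>h. (flat p (0 + h) - flat p 0) / h) \<longlongrightarrow> 0) (at_left 0)"
      by (rule tendsto_eventually) (auto simp: eventually_at_filter flat_def)
    have "((\<lambda>h. poly ([:0, 1:] * p) (inverse h) / exp (inverse h)) \<longlongrightarrow> 0) (at_right (0::real))"
      by (rule filterlim_compose[OF poly_exp_limit filterlim_inverse_at_top_right])
    moreover have "eventually (\<lambda>h. poly ([:0, 1:] * p) (inverse h) / exp (inverse h) = (flat p (0 + h) - flat p 0) / h) (at_right (0::real))"
      by (auto simp: eventually_at_filter flat_def exp_minus field_simps)
    ultimately show "((\<lambda>h. (flat p (0 + h) - flat p 0) / h) \<longlongrightarrow> 0) (at_right 0)"
      by (rule Lim_transform_eventually)
  qed
  then show ?thesis using equal by (simp add: has_field_derivative_def[symmetric] DERIV_def flat_def)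
qed

lemma csmooth_flat: "csmooth (\<lambda>t. of_real (flat p t))"
proof -
  let ?T = "{\<lambda>t. complex_of_real (flat p t) | p. True}"
  have "\<exists>h'\<in>?T. \<forall>t. (h has_vector_derivative h' t) (at t)" if "h \<in> ?T" for h
  proof -
    obtain p where h: "h = (\<lambda>t. complex_of_real (flat p t))" using \<open>h \<in> ?T\<close> by blast
    show ?thesis
      by (rule bexI[of _ "\<lambda>t. of_real (flat ([:0, 0, 1:] * (p - pderiv p)) t)"])
        (use flat_deriv in \<open>auto simp: h intro!: has_vector_derivative_of_real simp: has_real_derivative_iff_has_vector_derivative\<close>)
  qed
  moreover have "(\<lambda>t. complex_of_real (flat p t)) \<in> ?T" by blast
  ultimately show ?thesis by (rule csmoothI[rotated])
qed

text \<open>A bump and its primitive are produced together: the bump localises at a point, the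
  primitive is a smooth step whose differences approximate indicators of intervals.\<close>

lemma mollifier:
  obtains b B :: "real \<Rightarrow> real" where
    "csmooth (\<lambda>t. of_real (b t))" "csmooth (\<lambda>t. of_real (B t))" "\<And>t. (B has_real_derivative b t) (at t)"
    "\<And>t. 0 \<le> b t" "\<And>t. 1 \<le> \<bar>t\<bar> \<Longrightarrow> b t = 0" "\<And>t. t \<le> -1 \<Longrightarrow> B t = 0" "\<And>t. 1 \<le> t \<Longrightarrow> B t = 1"
    "\<And>t. 0 \<le> B t" "\<And>t. B t \<le> 1"
proof -
  \<comment> \<open>One factor vanishes to the left of -1, the other to the right of 1. The affine
    arguments are written in the form handled by \<open>csmooth_affine\<close>.\<close>
  define f where "f t = flat 1 (1 + 1 * t) * flat 1 (1 + (- 1) * t)" for t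
  have sf: "csmooth (\<lambda>t. complex_of_real (f t))"
    using csmooth_mult[OF csmooth_affine[OF csmooth_flat[of 1], of 1 1 1] csmooth_affine[OF csmooth_flat[of 1], of 1 1 "-1"]]
    by (simp add: f_def)
  have f0: "0 \<le> f t" for t by (auto simp: f_def flat_def)
  have fpos: "0 < f t" if "-1 < t" "t < 1" for t using that by (auto simp: f_def flat_def)
  have fzero: "f t = 0" if "1 \<le> \<bar>t\<bar>" for t using that by (auto simp: f_def flat_def abs_if split: if_splits)
  have cont: "isCont f t" for t
    using continuous_on_Re[OF csmooth_continuous[OF sf]] by (simp add: continuous_on_eq_continuous_at)
  obtain F where F: "\<And>t. (F has_vector_derivative f t) (at t)"
    using einterval_antiderivative[of "-\<infinity>" "\<infinity>" f] cont by auto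
  then have D: "(F has_real_derivative f t) (at t)" for t
    by (simp add: has_real_derivative_iff_has_vector_derivative)
  define K where "K = F 1 - F (-1)"
  have K: "0 < K"
  proof -
    have "F (-1) < F 1"
      by (rule DERIV_pos_imp_increasing_open) (use D fpos DERIV_isCont[OF D] in \<open>auto intro!: continuous_at_imp_continuous_on\<close>)
    then show ?thesis by (simp add: K_def)
  qed
  have mono: "F s \<le> F t" if "s \<le> t" for s t
    by (rule DERIV_nonneg_imp_nondecreasing[OF that]) (use D f0 in blast)
  have left: "F t = F (-1)" if "t \<le> -1" for t
  proof (cases "t = -1")
    case False
    show ?thesis
    proof (rule DERIV_isconst_end[of t "-1" F, symmetric])
      show "continuous_on {t..-1} F" by (intro continuous_at_imp_continuous_on ballI DERIV_isCont[OF D])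
      show "\<And>x. t < x \<Longrightarrow> x < -1 \<Longrightarrow> (F has_real_derivative 0) (at x)" using D fzero by (metis abs_ge_minus_self le_minus_iff less_imp_le order.trans)
    qed (use that False in auto)
  qed simp
  have right: "F t = F 1" if "1 \<le> t" for t
  proof (cases "t = 1")
    case False
    show ?thesis
    proof (rule DERIV_isconst_end[of 1 t F])
      show "continuous_on {1..t} F" by (intro continuous_at_imp_continuous_on ballI DERIV_isCont[OF D])
      show "\<And>x. 1 < x \<Longrightarrow> x < t \<Longrightarrow> (F has_real_derivative 0) (at x)" using D fzero by (metis abs_ge_self less_imp_le order.trans)
    qed (use that False in auto)
  qed simp
  define b where "b t = f t / K" for t
  define B where "B t = (F t - F (-1)) / K" for t
  have sb: "csmooth (\<lambda>t. complex_of_real (b t))"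
    using csmooth_affine[OF sf, of "1/K" 0 1] by (simp add: b_def)
  have DB: "(B has_real_derivative b t) (at t)" for t
    unfolding B_def[abs_def] b_def using D[of t] K by (auto intro!: derivative_eq_intros)
  have sB: "csmooth (\<lambda>t. complex_of_real (B t))"
    by (rule csmooth_antiderivative[OF sb has_vector_derivative_of_real[OF DB]])
  have b0: "0 \<le> b t" for t using f0[of t] K by (simp add: b_def)
  have bz: "b t = 0" if "1 \<le> \<bar>t\<bar>" for t using fzero[OF that] by (simp add: b_def)
  have Bl: "B t = 0" if "t \<le> -1" for t using left[OF that] by (simp add: B_def)
  have Br: "B t = 1" if "1 \<le> t" for t using right[OF that] K by (simp add: B_def K_def)
  have B0: "0 \<le> B t" for t
  proof (cases "t \<le> -1")
    case False
    then show ?thesis using mono[of "-1" t] K by (simp add: B_def)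
  qed (simp add: Bl)
  have B1: "B t \<le> 1" for t
  proof (cases "1 \<le> t")
    case False
    then have "(F t - F (-1)) \<le> K" using mono[of t 1] by (simp add: K_def)
    then show ?thesis using K by (simp add: B_def)
  qed (simp add: Br)
  show thesis by (rule that[OF sb sB DB b0 bz Bl Br B0 B1])
qed

lemma product_derivatives:
  assumes E: "\<And>n x. (E n has_vector_derivative E (Suc n) x) (at x)"
    and d: "\<And>n y. (d n has_vector_derivative d (Suc n) y) (at y)"
  shows "(dx ^^ i) ((dy ^^ j) (\<lambda>x y. E 0 x * d 0 y)) = (\<lambda>x y. E i x * (d j y :: complex))"
proof -
  have y: "(dy ^^ j) (\<lambda>x y. E 0 x * d 0 y) = (\<lambda>x y. E 0 x * d j y)"
  proof (induction j)
    case (Suc j)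
    have "((\<lambda>t. E 0 x * d j t) has_vector_derivative E 0 x * d (Suc j) y) (at y)" for x y
      by (rule has_vector_derivative_mult_right[OF d])
    then show ?case unfolding funpow.simps o_apply Suc by (intro ext) (simp only: dy_def vector_derivative_at)
  qed simp
  show ?thesis unfolding y
  proof (induction i)
    case (Suc i)
    have "((\<lambda>t. E i t * d j y) has_vector_derivative E (Suc i) x * d j y) (at x)" for x y
      by (rule has_vector_derivative_mult_left[OF E])
    then show ?case unfolding funpow.simps o_apply Suc by (intro ext) (simp only: dx_def vector_derivative_at)
  qed simp
qed

lemma smooth_product:
  assumes "csmooth e" "csmooth \<psi>"
  shows "smooth (\<lambda>x y. e x * \<psi> y)"
proof -
  obtain E where E: "E 0 = e" "\<And>n x. (E n has_vector_derivative E (Suc n) x) (at x)" using csmooth_derivatives[OF assms(1)] by metis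
  obtain d where d: "d 0 = \<psi>" "\<And>n x. (d n has_vector_derivative d (Suc n) x) (at x)" using csmooth_derivatives[OF assms(2)] by metis
  have cE: "continuous_on UNIV (E n)" "continuous_on UNIV (d n)" for n
    using E(2) d(2) by (auto intro!: continuous_at_imp_continuous_on has_vector_derivative_continuous)
  have 1: "continuous_on UNIV (\<lambda>(x, y). E i x * d j y)" for i j
    unfolding case_prod_beta'
    by (intro continuous_intros continuous_on_compose2[OF cE(1)] continuous_on_compose2[OF cE(2)]) auto
  have 2: "(\<lambda>t. E i t * d j y) differentiable (at x)" for i j x y
    by (rule differentiableI_vector[OF has_vector_derivative_mult_left[OF E(2)]])
  have 3: "(\<lambda>t. E i x * d j t) differentiable (at y)" for i j x y
    by (rule differentiableI_vector[OF has_vector_derivative_mult_right[OF d(2)]])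
  have "(dx ^^ i) ((dy ^^ j) (\<lambda>x y. e x * \<psi> y)) = (\<lambda>x y. E i x * d j y)" for i j
    using product_derivatives[of E d, OF E(2) d(2)] by (simp only: E(1) d(1))
  then show ?thesis unfolding smooth_def Let_def by (simp only: 1 2 3 simp_thms)
qed

locale mollifier_pair =
  fixes b B :: "real \<Rightarrow> real"
  assumes csb: "csmooth (\<lambda>t. of_real (b t))" and csB: "csmooth (\<lambda>t. of_real (B t))"
    and DB: "\<And>t. (B has_real_derivative b t) (at t)" and b0: "\<And>t. 0 \<le> b t" and bz: "\<And>t. 1 \<le> \<bar>t\<bar> \<Longrightarrow> b t = 0"
    and Bl: "\<And>t. t \<le> -1 \<Longrightarrow> B t = 0" and Br: "\<And>t. 1 \<le> t \<Longrightarrow> B t = 1" and B0: "\<And>t. 0 \<le> B t" and B1: "\<And>t. B t \<le> 1"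
begin

text \<open>The bump compressed to radius \<open>1 / Suc n\<close> about \<open>y\<close>, an
  approximate identity; \<open>Bn\<close> is the corresponding approximation of the unit step at
  \<open>y\<close>.\<close>

definition bn :: "nat \<Rightarrow> real \<Rightarrow> real \<Rightarrow> real" where
  "bn n y t = real (Suc n) * b (- (real (Suc n) * y) + real (Suc n) * t)"
definition Bn :: "nat \<Rightarrow> real \<Rightarrow> real \<Rightarrow> real" where
  "Bn n y t = B (- (real (Suc n) * y) + real (Suc n) * t)"

lemma cs_bn: "csmooth (\<lambda>t. of_real (bn n y t))"
  using csmooth_affine[OF csb, of "real (Suc n)" "- (real (Suc n) * y)" "real (Suc n)"] by (simp add: bn_def)

lemma cs_Bn: "csmooth (\<lambda>t. of_real (Bn n y t))"
  using csmooth_affine[OF csB, of 1 "- (real (Suc n) * y)" "real (Suc n)"] by (simp add: Bn_def)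

lemma D_Bn: "(Bn n y has_real_derivative bn n y t) (at t)"
proof -
  have "((\<lambda>t. - (real (Suc n) * y) + real (Suc n) * t) has_real_derivative real (Suc n)) (at t)"
    by (auto intro!: derivative_eq_intros)
  from DERIV_chain2[OF DB this] show ?thesis by (simp add: Bn_def[abs_def] bn_def mult.commute)
qed

lemma bn_nonneg: "0 \<le> bn n y t" by (simp add: bn_def b0)

lemma scaled_arg: "- (real (Suc n) * y) + real (Suc n) * t = real (Suc n) * (t - y)"
  by (simp add: algebra_simps)

lemma bn_zero: "1 / real (Suc n) \<le> \<bar>t - y\<bar> \<Longrightarrow> bn n y t = 0"
proof -
  assume "1 / real (Suc n) \<le> \<bar>t - y\<bar>"
  then have "1 \<le> real (Suc n) * \<bar>t - y\<bar>" by (simp add: field_simps del: of_nat_Suc)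
  also have "\<dots> = \<bar>real (Suc n) * (t - y)\<bar>" by (simp only: abs_mult abs_of_nat)
  finally have "1 \<le> \<bar>real (Suc n) * (t - y)\<bar>" .
  then show ?thesis unfolding bn_def scaled_arg by (simp add: bz)
qed

lemma bn_zero_far: "1 \<le> \<bar>t - y\<bar> \<Longrightarrow> bn n y t = 0"
  by (rule bn_zero) (auto intro: order.trans[of _ 1])

lemma continuous_bn: "continuous_on UNIV (bn n y)"
  using continuous_on_Re[OF csmooth_continuous[OF cs_bn]] by simp

lemma integrable_bn:
  fixes G :: "real \<Rightarrow> 'a::{real_normed_algebra_1, banach, second_countable_topology}"
  assumes "continuous_on UNIV G"
  shows "integrable lborel (\<lambda>t. bn n y t *\<^sub>R G t)"
proof -
  have "set_integrable lborel {y-1..y+1} (\<lambda>t. bn n y t *\<^sub>R G t)"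
    unfolding set_integrable_def
    by (rule borel_integrable_compact) (auto intro!: continuous_intros continuous_on_subset[OF continuous_bn] continuous_on_subset[OF assms])
  moreover have "indicator {y-1..y+1} t *\<^sub>R (bn n y t *\<^sub>R G t) = bn n y t *\<^sub>R G t" for t
    using bn_zero_far[of t y n] by (cases "t \<in> {y-1..y+1}") (auto simp: abs_if split: if_splits)
  ultimately show ?thesis by (simp only: set_integrable_def)
qed

lemma integral_bn: "(LBINT t. bn n y t) = 1"
proof -
  have "bn n y t = indicator {y-1..y+1} t *\<^sub>R bn n y t" for t
    using bn_zero_far[of t y n] by (cases "t \<in> {y-1..y+1}") (auto simp: abs_if split: if_splits)
  then have "(LBINT t. bn n y t) = (LBINT t. indicator {y-1..y+1} t *\<^sub>R bn n y t)"
    by (intro Bochner_Integration.integral_cong refl)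
  also have "\<dots> = Bn n y (y + 1) - Bn n y (y - 1)"
    by (rule integral_FTC_atLeastAtMost)
      (use D_Bn in \<open>auto intro: continuous_on_subset[OF continuous_bn] has_vector_derivative_at_within simp: has_real_derivative_iff_has_vector_derivative\<close>)
  also have "\<dots> = 1" unfolding Bn_def scaled_arg by (simp add: Bl Br)
  finally show ?thesis .
qed

lemma mollify_limit:
  fixes G :: "real \<Rightarrow> complex"
  assumes G: "continuous_on UNIV G"
  shows "(\<lambda>n. LBINT t. bn n y t *\<^sub>R G t) \<longlonglongrightarrow> G y"
proof (rule LIMSEQ_I)
  fix e :: real assume e: "0 < e"
  obtain d where d: "0 < d" "\<And>t. \<bar>t - y\<bar> < d \<Longrightarrow> norm (G t - G y) < e / 2"
    using G e unfolding continuous_on_iff dist_norm by (metis UNIV_I half_gt_zero real_norm_def)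
  obtain N where N: "1 / real (Suc N) < d" using nat_approx_posE[OF d(1)] by blast
  show "\<exists>N. \<forall>n\<ge>N. norm ((LBINT t. bn n y t *\<^sub>R G t) - G y) < e"
  proof (intro exI[of _ N] allI impI)
    fix n assume "n \<ge> N"
    then have "1 / real (Suc n) \<le> 1 / real (Suc N)" by (simp add: frac_le)
    then have n: "1 / real (Suc n) < d" using N by linarith
    have pt: "norm (bn n y t *\<^sub>R (G t - G y)) \<le> e / 2 * bn n y t" for t
    proof (cases "\<bar>t - y\<bar> < d")
      case True
      then have "bn n y t * norm (G t - G y) \<le> bn n y t * (e / 2)"
        using d(2)[OF True] bn_nonneg[of n y t] by (intro mult_left_mono) auto
      then show ?thesis using bn_nonneg[of n y t] by (simp add: mult.commute)
    next
      case False
      then show ?thesis using bn_zero[of n t y] n by simp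
    qed
    have i1: "integrable lborel (\<lambda>t. bn n y t *\<^sub>R G t)" and i2: "integrable lborel (\<lambda>t. bn n y t *\<^sub>R G y)"
      by (intro integrable_bn G continuous_intros)+
    have ib: "integrable lborel (\<lambda>t. bn n y t)" using integrable_bn[of "\<lambda>_. 1::real" n y] by simp
    have "(LBINT t. bn n y t *\<^sub>R (G t - G y)) = (LBINT t. bn n y t *\<^sub>R G t) - (LBINT t. bn n y t *\<^sub>R G y)"
      unfolding scaleR_diff_right by (rule Bochner_Integration.integral_diff[OF i1 i2])
    also have "(LBINT t. bn n y t *\<^sub>R G y) = G y" using ib by (simp add: integral_bn)
    finally have "norm ((LBINT t. bn n y t *\<^sub>R G t) - G y) = norm (LBINT t. bn n y t *\<^sub>R (G t - G y))" by simp
    also have "\<dots> \<le> (LBINT t. norm (bn n y t *\<^sub>R (G t - G y)))" by (rule integral_norm_bound)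
    also have "\<dots> \<le> (LBINT t. e / 2 * bn n y t)"
    proof (rule integral_mono)
      have "integrable lborel (\<lambda>t. bn n y t *\<^sub>R (G t - G y))"
        unfolding scaleR_diff_right by (rule Bochner_Integration.integrable_diff[OF i1 i2])
      then show "integrable lborel (\<lambda>t. norm (bn n y t *\<^sub>R (G t - G y)))" by (rule integrable_norm)
    qed (use pt ib in auto)
    also have "\<dots> = e / 2" by (simp add: integral_bn)
    finally show "norm ((LBINT t. bn n y t *\<^sub>R G t) - G y) < e" using e by simp
  qed
qed

end

lemma ex_mollifier_pair: "\<exists>b B. mollifier_pair b B"
  by (rule mollifier) (intro exI mollifier_pair.intro)

section \<open>Integration over the cylinder and Fourier transforms\<close>

context period begin

sublocale XY: pair_sigma_finite X "lborel :: real measure" ..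

lemma Omega_borel [measurable]: "Omega l \<in> sets borel"
  unfolding Omega_def by (intro borel_closed closed_Times) auto

lemma X_lborel_density: "X \<Otimes>\<^sub>M lborel = density lborel (\<lambda>p. ennreal (indicator (Omega l) p / (2 * l)))"
proof -
  have "X \<Otimes>\<^sub>M (lborel :: real measure) = density lborel (\<lambda>x. ennreal (indicator {-l..l} x / (2 * l))) \<Otimes>\<^sub>M density lborel (\<lambda>_::real. 1)"
    by (simp add: X_def density_1)
  also have "\<dots> = density (lborel \<Otimes>\<^sub>M lborel) (\<lambda>(x, y). ennreal (indicator {-l..l} x / (2 * l)) * 1)"
    by (rule pair_measure_density) (auto simp: density_1 intro: lborel.sigma_finite_measure_axioms)
  also have "\<dots> = density lborel (\<lambda>p. ennreal (indicator (Omega l) p / (2 * l)))"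
    unfolding lborel_prod by (intro arg_cong2[where f = density]) (auto simp: Omega_def indicator_def)
  finally show ?thesis .
qed

text \<open>Transfers integrals of Borel functions from the completed measure on the strip to the
  product with \<open>X\<close>, where Fubini is available; \<open>2 * l\<close> undoes the
  normalisation of \<open>X\<close>.\<close>

lemma Omega_integral:
  fixes f :: "real \<times> real \<Rightarrow> complex"
  assumes f: "f \<in> borel_measurable borel"
  shows "integral\<^sup>L (lebesgue_on (Omega l)) f = 2 * l * integral\<^sup>L (X \<Otimes>\<^sub>M lborel) f"
    and "integrable (lebesgue_on (Omega l)) f \<longleftrightarrow> integrable (X \<Otimes>\<^sub>M lborel) f"
proof -
  have [measurable]: "f \<in> borel_measurable lborel" using f by simp
  have fm: "(\<lambda>p. indicator (Omega l) p *\<^sub>R f p) \<in> borel_measurable lborel" by measurable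
  have eq: "(\<lambda>p. (indicator (Omega l) p / (2 * l)) *\<^sub>R f p) = (\<lambda>p. (1 / (2 * l)) *\<^sub>R (indicator (Omega l) p *\<^sub>R f p))"
    by auto
  have "integral\<^sup>L (lebesgue_on (Omega l)) f = integral\<^sup>L lborel (\<lambda>p. indicator (Omega l) p *\<^sub>R f p)"
    by (subst integral_restrict_space) (auto simp: integral_completion[OF fm])
  moreover have "integral\<^sup>L (X \<Otimes>\<^sub>M lborel) f = (1 / (2 * l)) *\<^sub>R integral\<^sup>L lborel (\<lambda>p. indicator (Omega l) p *\<^sub>R f p)"
    unfolding X_lborel_density using l_pos by (subst integral_density) (auto simp: eq simp del: scaleR_scaleR)
  ultimately show "integral\<^sup>L (lebesgue_on (Omega l)) f = 2 * l * integral\<^sup>L (X \<Otimes>\<^sub>M lborel) f"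
    using l_pos by (simp add: scaleR_conv_of_real)
  have "integrable (lebesgue_on (Omega l)) f \<longleftrightarrow> integrable lborel (\<lambda>p. indicator (Omega l) p *\<^sub>R f p)"
    by (subst integrable_restrict_space) (auto simp: integrable_completion[OF fm])
  moreover have "integrable (X \<Otimes>\<^sub>M lborel) f \<longleftrightarrow> integrable lborel (\<lambda>p. (1 / (2 * l)) *\<^sub>R (indicator (Omega l) p *\<^sub>R f p))"
    unfolding X_lborel_density using l_pos by (subst integrable_density) (auto simp: eq simp del: scaleR_scaleR)
  moreover have "integrable lborel (\<lambda>p. (1 / (2 * l)) *\<^sub>R (indicator (Omega l) p *\<^sub>R f p)) \<longleftrightarrow> integrable lborel (\<lambda>p. indicator (Omega l) p *\<^sub>R f p)"
    (is "integrable _ (\<lambda>p. ?c *\<^sub>R ?h p) \<longleftrightarrow> _")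
  proof
    assume *: "integrable lborel (\<lambda>p. ?c *\<^sub>R ?h p)"
    have "integrable lborel (\<lambda>p. (2 * l) *\<^sub>R (?c *\<^sub>R ?h p))" by (rule integrable_scaleR_right[OF *])
    moreover have "(\<lambda>p. (2 * l) *\<^sub>R (?c *\<^sub>R ?h p)) = ?h" using l_pos by auto
    ultimately show "integrable lborel ?h" by (simp only:)
  qed (rule integrable_scaleR_right)
  ultimately show "integrable (lebesgue_on (Omega l)) f \<longleftrightarrow> integrable (X \<Otimes>\<^sub>M lborel) f"
    by (simp only:)
qed

lemma AE_Omega:
  assumes "AE p in lebesgue_on (Omega l). P p"
  shows "AE p in X \<Otimes>\<^sub>M lborel. P p"
proof -
  have "AE p in lebesgue. p \<in> Omega l \<longrightarrow> P p"
    using assms by (subst (asm) AE_restrict_space_iff) auto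
  then have "AE p in lborel. p \<in> Omega l \<longrightarrow> P p" by (simp add: AE_completion_iff)
  then show ?thesis
    unfolding X_lborel_density by (subst AE_density) (auto simp: indicator_def elim!: eventually_mono)
qed

lemma integrable_compact_support:
  fixes H :: "real \<Rightarrow> real \<Rightarrow> complex"
  assumes H: "continuous_on UNIV (case_prod H)" and R: "\<And>x t. R < \<bar>t\<bar> \<Longrightarrow> H x t = 0"
  shows "integrable (X \<Otimes>\<^sub>M lborel) (case_prod H)"
proof -
  have Hm: "case_prod H \<in> borel_measurable borel" using H by (rule borel_measurable_continuous_onI)
  have "integrable lborel (\<lambda>p. indicator ({-l..l} \<times> {-R..R}) p *\<^sub>R case_prod H p)"
    by (rule borel_integrable_compact) (auto intro: compact_Times continuous_on_subset[OF H])
  moreover have "indicator ({-l..l} \<times> {-R..R}) p *\<^sub>R case_prod H p = indicator (Omega l) p *\<^sub>R case_prod H p" for p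
  proof (cases p)
    case (Pair x t)
    show ?thesis using R[of t x] by (cases "\<bar>t\<bar> \<le> R") (auto simp: Pair Omega_def indicator_def)
  qed
  ultimately have "integrable lborel (\<lambda>p. indicator (Omega l) p *\<^sub>R case_prod H p)" by simp
  then have "integrable (lebesgue_on (Omega l)) (case_prod H)"
    using Hm by (subst integrable_restrict_space) (auto simp: integrable_completion)
  then show ?thesis using Omega_integral(2)[OF Hm] by simp
qed

lemma csmooth_em: "csmooth (em m)"
proof -
  have "em m = (\<lambda>t. exp (\<i> * of_real (w * of_int m) * of_real t))"
    by (auto simp: em_def cis_conv_exp mult_ac)
  then show ?thesis by (simp only: csmooth_exp)
qed

lemma test_fun_product:
  assumes "csmooth \<psi>" "\<And>t. R < \<bar>t\<bar> \<Longrightarrow> \<psi> t = 0"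
  shows "test_fun l (\<lambda>x y. em m x * \<psi> y)"
  unfolding test_fun_def x_periodic_def
  using smooth_product[OF csmooth_em assms(1)] assms(2) by (auto simp: em_period)

lemma continuous_case_prodD:
  assumes W: "continuous_on UNIV (\<lambda>(x, y). W x y)"
  shows "continuous_on S (\<lambda>x. W x y)" "continuous_on S (\<lambda>y. W x y)"
proof -
  have "continuous_on S (\<lambda>x. (x, y))" "continuous_on S (\<lambda>y. (x, y))" by (intro continuous_intros)+
  from continuous_on_compose2[OF W this(1) subset_UNIV] continuous_on_compose2[OF W this(2) subset_UNIV]
  show "continuous_on S (\<lambda>x. W x y)" "continuous_on S (\<lambda>y. W x y)" by simp_all
qed

lemma local_bound:
  assumes W: "continuous_on UNIV (\<lambda>(x, y). W x y :: complex)" and per: "x_periodic l W"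
  shows "\<exists>C. \<forall>x y. \<bar>y\<bar> \<le> R \<longrightarrow> norm (W x y) \<le> C"
proof -
  have "compact ((\<lambda>(x, y). W x y) ` ({-l..l} \<times> {-R..R}))"
    by (rule compact_continuous_image[OF continuous_on_subset[OF W]]) (auto intro: compact_Times)
  then have "bounded ((\<lambda>(x, y). W x y) ` ({-l..l} \<times> {-R..R}))" by (rule compact_imp_bounded)
  then obtain C where C: "\<forall>p\<in>(\<lambda>(x, y). W x y) ` ({-l..l} \<times> {-R..R}). norm p \<le> C" unfolding bounded_iff by fast
  have perz: "W (x + 2 * l * of_int k) y = W x y" for x y k
  proof (induction k rule: int_induct[where k=0])
    case (step1 i)
    have "W (x + 2 * l * of_int i + 2 * l) y = W (x + 2 * l * of_int i) y" using per unfolding x_periodic_def by blast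
    then show ?case using step1 by (simp add: algebra_simps)
  next
    case (step2 i)
    have "W (x + 2 * l * of_int (i - 1) + 2 * l) y = W (x + 2 * l * of_int (i - 1)) y" using per unfolding x_periodic_def by blast
    then show ?case using step2 by (simp add: algebra_simps)
  qed simp
  have "norm (W x y) \<le> C" if "\<bar>y\<bar> \<le> R" for x y
  proof -
    define k where "k = round (x / (2 * l))"
    have "\<bar>of_int k - x / (2 * l)\<bar> \<le> 1/2" unfolding k_def by (rule of_int_round_abs_le)
    then have "\<bar>x + 2 * l * of_int (- k)\<bar> \<le> l" using l_pos by (auto simp: abs_le_iff field_simps)
    then have "norm (W (x + 2 * l * of_int (- k)) y) \<le> C" using C that by force
    then show ?thesis by (simp only: perz)
  qed
  then show ?thesis by blast
qed

lemma continuous_md: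
  assumes W: "continuous_on UNIV (\<lambda>(x, y). W x y)" and per: "x_periodic l W"
  shows "continuous_on UNIV (\<lambda>y. md m (\<lambda>x. W x y))"
proof -
  have "isCont (\<lambda>y. md m (\<lambda>x. W x y)) y" for y
    unfolding continuous_at_sequentially o_def
  proof (intro allI impI)
    fix Y :: "nat \<Rightarrow> real" assume Y: "Y \<longlonglongrightarrow> y"
    then have "Bseq Y" by (intro convergent_imp_Bseq convergentI)
    then obtain R where R: "\<And>n. \<bar>Y n\<bar> \<le> R" unfolding Bseq_def by auto
    obtain C where C: "\<And>x y. \<bar>y\<bar> \<le> R \<Longrightarrow> norm (W x y) \<le> C" using local_bound[OF W per, of R] by blast
    have [measurable]: "(\<lambda>x. W x s) \<in> borel_measurable borel" for s
      by (rule borel_measurable_continuous_onI[OF continuous_case_prodD(1)[OF W]])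
    show "(\<lambda>n. md m (\<lambda>x. W x (Y n))) \<longlonglongrightarrow> md m (\<lambda>x. W x y)"
      unfolding md_def
    proof (rule integral_dominated_convergence[where w = "\<lambda>_. C"])
      have "(\<lambda>n. W x (Y n)) \<longlonglongrightarrow> W x y" for x
        using continuous_case_prodD(2)[OF W, of UNIV x] Y unfolding continuous_on_eq_continuous_at[OF open_UNIV] continuous_at_sequentially o_def by blast
      then show "AE x in X. (\<lambda>n. W x (Y n) * em (- m) x) \<longlonglongrightarrow> W x y * em (- m) x"
        by (intro AE_I2 tendsto_intros)
    qed (use C R in \<open>auto simp: norm_mult\<close>)
  qed
  then show ?thesis by (simp add: continuous_at_imp_continuous_on)
qed

lemma integral_against_product:
  assumes F: "continuous_on UNIV (\<lambda>(x, y). F x y)" and \<psi>: "continuous_on UNIV \<psi>" "\<And>t. R < \<bar>t\<bar> \<Longrightarrow> \<psi> t = 0"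
  shows "(LINT (x, t)|lebesgue_on (Omega l). F x t * (em (- m) x * \<psi> t)) = 2 * l * (LBINT t. \<psi> t * md m (\<lambda>x. F x t))"
    and "integrable lborel (\<lambda>t. \<psi> t * md m (\<lambda>x. F x t))"
proof -
  let ?H = "\<lambda>x t. F x t * (em (- m) x * \<psi> t)"
  have cH: "continuous_on UNIV (case_prod ?H)"
    using F unfolding case_prod_beta'
    by (intro continuous_intros continuous_on_compose2[OF \<psi>(1)] continuous_on_compose2[OF continuous_em]) auto
  have Hm: "case_prod ?H \<in> borel_measurable borel" using cH by (rule borel_measurable_continuous_onI)
  have iH: "integrable (X \<Otimes>\<^sub>M lborel) (case_prod ?H)"
    by (rule integrable_compact_support[OF cH, of R]) (use \<psi>(2) in auto)
  have inner: "(LINT x|X. ?H x t) = \<psi> t * md m (\<lambda>x. F x t)" for t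
    unfolding md_def by (subst integral_mult_right_zero[symmetric]) (simp add: mult_ac)
  have "(LINT (x, t)|lebesgue_on (Omega l). ?H x t) = 2 * l * integral\<^sup>L (X \<Otimes>\<^sub>M lborel) (case_prod ?H)"
    by (rule Omega_integral(1)[OF Hm])
  also have "integral\<^sup>L (X \<Otimes>\<^sub>M lborel) (case_prod ?H) = (LBINT t. \<psi> t * md m (\<lambda>x. F x t))"
    using XY.integral_snd[OF iH] by (simp add: inner)
  finally show "(LINT (x, t)|lebesgue_on (Omega l). F x t * (em (- m) x * \<psi> t)) = 2 * l * (LBINT t. \<psi> t * md m (\<lambda>x. F x t))" .
  show "integrable lborel (\<lambda>t. \<psi> t * md m (\<lambda>x. F x t))" using XY.integrable_snd[OF iH] by (simp add: inner)
qed

text \<open>A test function with the single frequency \<open>- m\<close> in \<open>x\<close> sees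
  only row \<open>m\<close> of a Fourier transform, by orthogonality.\<close>

lemma fourier_product:
  assumes \<psi>: "continuous_on UNIV \<psi>" "\<And>t. R < \<bar>t\<bar> \<Longrightarrow> \<psi> t = 0"
  shows "fourier l (\<lambda>x y. em (- m) x * \<psi> y) (- k) (- \<xi>) = (if k = m then (LBINT t. \<psi> t * cis (\<xi> * t)) else 0)"
proof -
  have mdk: "md m (\<lambda>x. em k x * cis (\<xi> * t)) = (if k = m then cis (\<xi> * t) else 0)" for t
    using md_cmult[of m "cis (\<xi> * t)" "em k"] by (simp add: md_em mult.commute)
  have "(\<lambda>(x, y). em (- m) x * \<psi> y * exp (- \<i> * of_real (freq l * of_int (- k) * x) - \<i> * of_real (- \<xi> * y)))
      = (\<lambda>(x, y). (em k x * cis (\<xi> * y)) * (em (- m) x * \<psi> y))"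
    by (auto simp: em_def cis_conv_exp exp_add[symmetric] w_def[symmetric] mult_ac intro!: arg_cong[where f = exp])
       (simp_all add: algebra_simps exp_add[symmetric])
  then have "fourier l (\<lambda>x y. em (- m) x * \<psi> y) (- k) (- \<xi>)
     = 1 / of_real (2 * l) * (LINT (x, t)|lebesgue_on (Omega l). (em k x * cis (\<xi> * t)) * (em (- m) x * \<psi> t))"
    unfolding fourier_def by simp
  also have "(LINT (x, t)|lebesgue_on (Omega l). (em k x * cis (\<xi> * t)) * (em (- m) x * \<psi> t))
     = 2 * l * (LBINT t. \<psi> t * md m (\<lambda>x. em k x * cis (\<xi> * t)))"
    by (rule integral_against_product[OF _ \<psi>])
      (auto simp: case_prod_beta' cis_conv_exp intro!: continuous_intros)
  finally show ?thesis unfolding mdk using l_pos by (cases "k = m") simp_all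
qed

text \<open>The distributional transform is tested against \<open>em (- m)\<close> times an
  approximate identity at \<open>y\<close>: the left side tends to the mode at \<open>y\<close>, and
  the right side never exceeds the mass of \<open>g\<close> on row \<open>m\<close>. The factor
  \<open>l / pi\<close> over \<open>2 * l\<close> leaves \<open>1 / (2 * pi)\<close>.\<close>

lemma fourier_L1_modes:
  fixes F :: "real \<Rightarrow> real \<Rightarrow> complex"
  assumes F: "continuous_on UNIV (\<lambda>(x, y). F x y)" and per: "x_periodic l F"
    and g: "integrable (count_space UNIV \<Otimes>\<^sub>M lborel) g" and FT: "is_fourier_transform l F g" and A: "finite A"
  shows "(\<Sum>m\<in>A. norm (md m (\<lambda>x. F x y))) \<le> (LINT p|(count_space UNIV \<Otimes>\<^sub>M lborel). norm (g p)) / (2 * pi)"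
proof -
  let ?M = "count_space UNIV \<Otimes>\<^sub>M (lborel :: real measure)"
  obtain b B where "mollifier_pair b B" using ex_mollifier_pair by blast
  then interpret mollifier_pair b B .
  \<comment> \<open>The mass of \<open>g\<close> on row \<open>m\<close>; over disjoint rows these
    masses add up to at most the total.\<close>
  define \<gamma> where "\<gamma> m = (LINT p|?M. norm (g p) * indicator {m} (fst p))" for m
  have ig: "integrable ?M (\<lambda>p. norm (g p) * indicator {m} (fst p))" for m
    by (rule Bochner_Integration.integrable_bound[OF g]) (use g in \<open>auto simp: indicator_def\<close>)
  have one: "norm (md m (\<lambda>x. F x y)) \<le> \<gamma> m / (2 * pi)" for m
  proof -
    have bound: "norm (LBINT t. bn n y t *\<^sub>R md m (\<lambda>x. F x t)) \<le> \<gamma> m / (2 * pi)" for n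
    proof -
      define \<psi> where "\<psi> = (\<lambda>t. complex_of_real (bn n y t))"
      have cs: "csmooth \<psi>" unfolding \<psi>_def by (rule cs_bn)
      have c\<psi>: "continuous_on UNIV \<psi>" by (rule csmooth_continuous[OF cs])
      have z\<psi>: "\<psi> t = 0" if "\<bar>y\<bar> + 1 < \<bar>t\<bar>" for t
        unfolding \<psi>_def using that by (simp add: bn_zero_far)
      \<comment> \<open>The approximate identity is nonnegative with integral 1, so its transform is
        at most 1 for every \<open>n\<close>.\<close>
      have hat: "norm (LBINT t. \<psi> t * cis (\<xi> * t)) \<le> 1" for \<xi>
        by (rule order.trans[OF integral_norm_bound]) (simp add: norm_mult \<psi>_def bn_nonneg integral_bn)
      have "2 * l * (LBINT t. \<psi> t * md m (\<lambda>x. F x t)) = (LINT (x, t)|lebesgue_on (Omega l). F x t * (em (- m) x * \<psi> t))"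
        using integral_against_product(1)[OF F c\<psi> z\<psi>, where m = m] by simp
      also have "\<dots> = of_real (l / pi) * (LINT (k, \<xi>)|?M. g (k, \<xi>) * fourier l (\<lambda>x y. em (- m) x * \<psi> y) (- k) (- \<xi>))"
        using FT test_fun_product[OF cs z\<psi>, where m = "- m"] unfolding is_fourier_transform_def by blast
      finally have "norm (2 * l * (LBINT t. \<psi> t * md m (\<lambda>x. F x t)))
          = l / pi * norm (LINT (k, \<xi>)|?M. g (k, \<xi>) * fourier l (\<lambda>x y. em (- m) x * \<psi> y) (- k) (- \<xi>))"
        using l_pos by (simp only: norm_mult norm_of_real) simp
      also have "norm (LINT (k, \<xi>)|?M. g (k, \<xi>) * fourier l (\<lambda>x y. em (- m) x * \<psi> y) (- k) (- \<xi>)) \<le> \<gamma> m"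
      proof -
        have "norm (LINT p:UNIV|?M. (case p of (k, \<xi>) \<Rightarrow> g (k, \<xi>) * fourier l (\<lambda>x y. em (- m) x * \<psi> y) (- k) (- \<xi>)))
            \<le> (LINT p:UNIV|?M. norm (g p) * indicator {m} (fst p))"
        proof (rule norm_set_integral_le)
          show "set_integrable ?M UNIV (\<lambda>p. norm (g p) * indicator {m} (fst p))" using ig by (simp add: set_integrable_def)
          fix p :: "int \<times> real"
          show "norm (case p of (k, \<xi>) \<Rightarrow> g (k, \<xi>) * fourier l (\<lambda>x y. em (- m) x * \<psi> y) (- k) (- \<xi>)) \<le> norm (g p) * indicator {m} (fst p)"
          proof (cases p)
            case (Pair k \<xi>)
            have "fourier l (\<lambda>x y. em (- m) x * \<psi> y) (- k) (- \<xi>) = (if k = m then (LBINT t. \<psi> t * cis (\<xi> * t)) else 0)"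
              by (rule fourier_product[OF c\<psi> z\<psi>])
            then show ?thesis unfolding Pair prod.case
              using hat[of \<xi>] by (auto simp: norm_mult mult_left_le)
          qed
        qed
        then show ?thesis by (simp add: set_lebesgue_integral_def \<gamma>_def)
      qed
      finally have "2 * l * norm (LBINT t. \<psi> t * md m (\<lambda>x. F x t)) \<le> l / pi * \<gamma> m"
        using l_pos by (simp add: norm_mult mult_left_mono divide_right_mono)
      then have "norm (LBINT t. \<psi> t * md m (\<lambda>x. F x t)) \<le> \<gamma> m / (2 * pi)"
        using l_pos by (simp add: field_simps)
      then show ?thesis by (simp add: \<psi>_def scaleR_conv_of_real)
    qed
    show ?thesis
      by (rule LIMSEQ_le_const2[OF tendsto_norm[OF mollify_limit[OF continuous_md[OF F per]]]]) (use bound in blast)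
  qed
  have "(\<Sum>m\<in>A. norm (md m (\<lambda>x. F x y))) \<le> (\<Sum>m\<in>A. \<gamma> m) / (2 * pi)"
    unfolding sum_divide_distrib by (intro sum_mono one)
  also have "(\<Sum>m\<in>A. \<gamma> m) = (LINT p|?M. (\<Sum>m\<in>A. norm (g p) * indicator {m} (fst p)))"
    unfolding \<gamma>_def using ig by simp
  also have "\<dots> \<le> (LINT p|?M. norm (g p))"
  proof (rule integral_mono)
    show "integrable ?M (\<lambda>p. \<Sum>m\<in>A. norm (g p) * indicator {m} (fst p))" using ig by auto
    fix p :: "int \<times> real"
    have "(\<Sum>m\<in>A. norm (g p) * indicator {m} (fst p)) = (\<Sum>m\<in>A. if fst p = m then norm (g p) else 0)"
      by (intro sum.cong) (auto simp: indicator_def)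
    also have "\<dots> \<le> norm (g p)" using A by simp
    finally show "(\<Sum>m\<in>A. norm (g p) * indicator {m} (fst p)) \<le> norm (g p)" .
  qed (use g in auto)
  finally show ?thesis by (simp add: divide_right_mono)
qed

end

section \<open>From the distributional equation to the mode equations\<close>

context mollifier_pair begin

lemma Bn_limit:
  assumes "t \<noteq> y"
  shows "(\<lambda>n. Bn n y t) \<longlonglongrightarrow> (if y < t then 1 else 0)"
proof -
  obtain N where N: "1 / real (Suc N) < \<bar>t - y\<bar>" using nat_approx_posE[of "\<bar>t - y\<bar>"] assms by auto
  have "Bn n y t = (if y < t then 1 else 0)" if "n \<ge> N" for n
  proof -
    have "1 / real (Suc n) \<le> 1 / real (Suc N)" using that by (simp add: frac_le)
    then have "1 / real (Suc n) \<le> \<bar>t - y\<bar>" using N by linarith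
    then have *: "1 \<le> real (Suc n) * \<bar>t - y\<bar>" by (simp add: field_simps del: of_nat_Suc)
    show ?thesis
    proof (cases "y < t")
      case True
      then show ?thesis unfolding Bn_def scaled_arg using * by (simp add: Br)
    next
      case False
      then have "\<bar>t - y\<bar> = - (t - y)" by simp
      then have "real (Suc n) * (t - y) \<le> -1" using * by (simp only:)
      then show ?thesis unfolding Bn_def scaled_arg using False by (simp only: Bl if_False)
    qed
  qed
  then show ?thesis by (intro tendsto_eventually eventually_sequentiallyI)
qed

lemma Bn_left: "t \<le> y - 1 \<Longrightarrow> Bn n y t = 0" and Bn_right: "y + 1 \<le> t \<Longrightarrow> Bn n y t = 1"
proof -
  show "Bn n y t = 0" if "t \<le> y - 1"
  proof -
    have "real (Suc n) * (t - y) \<le> real (Suc n) * (-1)" using that by (intro mult_left_mono) auto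
    also have "\<dots> \<le> -1" by simp
    finally show ?thesis unfolding Bn_def scaled_arg by (rule Bl)
  qed
  show "Bn n y t = 1" if "y + 1 \<le> t"
  proof -
    have "1 \<le> real (Suc n) * 1" by simp
    also have "\<dots> \<le> real (Suc n) * (t - y)" using that by (intro mult_left_mono) auto
    finally show ?thesis unfolding Bn_def scaled_arg by (rule Br)
  qed
qed

end

lemma measurable_lebesgue_on_borel:
  "f \<in> borel_measurable borel \<Longrightarrow> f \<in> borel_measurable (lebesgue_on S)"
  by (intro measurable_restrict_space1 measurable_completion) simp

context potential begin

text \<open>Testing the equation with \<open>em (- m) x * \<psi> y\<close> separates the variables
  and leaves the weak form of the equation for mode \<open>m\<close>.\<close>

lemma weak_mode_equation:
  fixes u :: "real \<Rightarrow> real \<Rightarrow> complex"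
  assumes u: "(\<lambda>(x, y). u x y) \<in> borel_measurable (lebesgue_on (Omega l))"
    and link: "AE p in lebesgue_on (Omega l). (case p of (x, y) \<Rightarrow> u x y) = (case p of (x, y) \<Rightarrow> U x y)"
    and Uint: "integrable (X \<Otimes>\<^sub>M lborel) (case_prod U)"
    and W: "continuous_on UNIV (\<lambda>(x, y). W x y)" and Wb: "\<And>x y. norm (W x y) \<le> C"
    and PDE: "solves_PDE l u z W"
    and \<psi>: "csmooth \<psi>" "\<And>t. (\<psi> has_vector_derivative \<psi>' t) (at t)" "continuous_on UNIV \<psi>'"
    and supp: "\<And>t. R < \<bar>t\<bar> \<Longrightarrow> \<psi> t = 0" "\<And>t. R < \<bar>t\<bar> \<Longrightarrow> \<psi>' t = 0"
  shows "(LBINT t. (\<psi>' t - a z m * \<psi> t) * mode m W t) + (LBINT t. \<psi> t * src m W t) = 0"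
proof -
  \<comment> \<open>Each \<open>x\<close>-derivative of the test function multiplies it by
    \<open>c\<close>; the adjoint operator thus acts as \<open>c^2 - 2 i z c\<close>, which is
    \<open>- a z m\<close>.\<close>
  define c where "c = - (\<i> * of_real (w * of_int m))"
  have em_eq: "em (- m) x = exp (c * of_real x)" for x
    by (simp add: em_def cis_conv_exp c_def mult_ac)
  define E where "E n x = c ^ n * em (- m) x" for n x
  have DE: "(E n has_vector_derivative E (Suc n) x) (at x)" for n x
    unfolding E_def[abs_def] em_eq[abs_def] em_eq
    by (rule has_vector_derivative_real_field) (auto intro!: derivative_eq_intros)
  obtain d where d: "d 0 = \<psi>" "\<And>n t. (d n has_vector_derivative d (Suc n) t) (at t)"
    using csmooth_derivatives[OF \<psi>(1)] by metis
  have d1: "d 1 t = \<psi>' t" for t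
    using vector_derivative_unique_at[of \<psi> "d 1 t" t "\<psi>' t"] d(2)[of 0 t] \<psi>(2)[of t] by (simp add: d(1))
  let ?\<tau> = "\<lambda>x y. em (- m) x * \<psi> y"
  have \<tau>: "?\<tau> = (\<lambda>x y. E 0 x * d 0 y)" by (simp add: E_def d(1))
  have D: "dy ?\<tau> = (\<lambda>x y. em (- m) x * \<psi>' y)" "dx ?\<tau> = (\<lambda>x y. c * em (- m) x * \<psi> y)" "dx (dx ?\<tau>) = (\<lambda>x y. c\<^sup>2 * em (- m) x * \<psi> y)"
    using product_derivatives[of E d 0 1, OF DE d(2)] product_derivatives[of E d 1 0, OF DE d(2)] product_derivatives[of E d 2 0, OF DE d(2)]
    unfolding \<tau> by (simp_all add: E_def d(1) d1[unfolded One_nat_def] numeral_2_eq_2)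
  have test: "test_fun l ?\<tau>" by (rule test_fun_product[OF \<psi>(1) supp(1)])
  have cc: "c\<^sup>2 - 2 * \<i> * z * c = - a z m"
    by (simp add: c_def a_def power2_eq_square algebra_simps)
  let ?\<eta> = "\<lambda>t. \<psi>' t - a z m * \<psi> t"
  have c\<psi>: "continuous_on UNIV \<psi>" by (rule csmooth_continuous[OF \<psi>(1)])
  have c\<eta>: "continuous_on UNIV ?\<eta>" by (intro continuous_intros c\<psi> \<psi>(3))
  let ?f1 = "\<lambda>(x, t). W x t * (em (- m) x * ?\<eta> t)" and ?f2 = "\<lambda>(x, t). u x t * (W x t * (em (- m) x * \<psi> t))"
  \<comment> \<open>\<open>u\<close> is only Lebesgue measurable on the strip. Before Fubini is
    used, it is exchanged for the Borel function \<open>U\<close>, with which it agrees almost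
    everywhere.\<close>
  let ?f3 = "\<lambda>(x, t). U x t * (W x t * (em (- m) x * \<psi> t))"
  have c1: "continuous_on UNIV ?f1"
    using W unfolding case_prod_beta'
    by (intro continuous_intros continuous_on_compose2[OF c\<eta>, of UNIV snd, simplified]) auto
  have c2: "continuous_on UNIV (\<lambda>(x, t). W x t * (em (- m) x * \<psi> t))"
    using W unfolding case_prod_beta'
    by (intro continuous_intros continuous_on_compose2[OF c\<psi>]) auto
  have i1: "integrable (lebesgue_on (Omega l)) ?f1"
    unfolding Omega_integral(2)[OF borel_measurable_continuous_onI[OF c1]]
    by (rule integrable_compact_support[OF c1, of R]) (use supp in auto)
  obtain K where K: "\<And>t. norm (\<psi> t) \<le> K"
  proof -
    have "bounded (\<psi> ` {-R..R})" by (intro compact_imp_bounded compact_continuous_image continuous_on_subset[OF c\<psi>]) auto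
    then obtain K where K: "\<forall>t\<in>\<psi> ` {-R..R}. norm t \<le> K" unfolding bounded_iff by fast
    have "norm (\<psi> t) \<le> \<bar>K\<bar>" for t
    proof (cases "R < \<bar>t\<bar>")
      case False
      then have "t \<in> {-R..R}" by auto
      then have "norm (\<psi> t) \<le> K" using K by blast
      then show ?thesis by linarith
    qed (simp add: supp)
    then show thesis by (rule that)
  qed
  have Ub: "case_prod U \<in> borel_measurable borel" using U_meas by (simp add: borel_prod)
  have m2: "(\<lambda>(x, t). W x t * (em (- m) x * \<psi> t)) \<in> borel_measurable borel" by (rule borel_measurable_continuous_onI[OF c2])
  have f3m: "?f3 \<in> borel_measurable borel"
    using borel_measurable_times[OF Ub m2] by (simp add: case_prod_beta')
  have i3': "integrable (X \<Otimes>\<^sub>M lborel) ?f3"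
  proof (rule Bochner_Integration.integrable_bound[of _ "\<lambda>p. (C * K) *\<^sub>R case_prod U p"])
    show "integrable (X \<Otimes>\<^sub>M lborel) (\<lambda>p. (C * K) *\<^sub>R case_prod U p)" using Uint by (rule integrable_scaleR_right)
    show "?f3 \<in> borel_measurable (X \<Otimes>\<^sub>M lborel)" using f3m by (simp add: borel_prod[symmetric] cong: measurable_cong_sets)
    show "AE p in X \<Otimes>\<^sub>M lborel. norm (?f3 p) \<le> norm ((C * K) *\<^sub>R case_prod U p)"
    proof (rule AE_I2)
      fix p :: "real \<times> real"
      obtain x t where p: "p = (x, t)" by (cases p)
      have "norm (W x t) * norm (\<psi> t) \<le> C * K" using Wb[of x t] K[of t] by (intro mult_mono) (auto intro: order.trans[OF norm_ge_zero])
      then have "norm (U x t) * (norm (W x t) * norm (\<psi> t)) \<le> norm (U x t) * \<bar>C * K\<bar>" by (intro mult_left_mono) auto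
      then show "norm (?f3 p) \<le> norm ((C * K) *\<^sub>R case_prod U p)" by (simp add: p norm_mult mult_ac)
    qed
  qed
  have i3: "integrable (lebesgue_on (Omega l)) ?f3" unfolding Omega_integral(2)[OF f3m] by (rule i3')
  have f2m: "?f2 \<in> borel_measurable (lebesgue_on (Omega l))"
    using borel_measurable_times[OF u measurable_lebesgue_on_borel[OF m2]] by (simp add: case_prod_beta')
  have ae: "AE p in lebesgue_on (Omega l). ?f2 p = ?f3 p" using link by eventually_elim (auto simp: case_prod_beta')
  have f3m': "?f3 \<in> borel_measurable (lebesgue_on (Omega l))" by (rule measurable_lebesgue_on_borel[OF f3m])
  have i2: "integrable (lebesgue_on (Omega l)) ?f2" using i3 integrable_cong_AE[OF f2m f3m' ae] by simp
  have "0 = (LINT p|lebesgue_on (Omega l). ?f1 p + ?f2 p)"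
  proof -
    have "(LINT (x, y)|lebesgue_on (Omega l). W x y * (dy ?\<tau> x y + dx (dx ?\<tau>) x y - 2 * \<i> * z * dx ?\<tau> x y) + u x y * W x y * ?\<tau> x y) = 0"
      using PDE test unfolding solves_PDE_def by blast
    moreover have "W x y * (dy ?\<tau> x y + dx (dx ?\<tau>) x y - 2 * \<i> * z * dx ?\<tau> x y) + u x y * W x y * ?\<tau> x y
        = W x y * (em (- m) x * ?\<eta> y) + u x y * (W x y * (em (- m) x * \<psi> y))" for x y
    proof -
      have "dy ?\<tau> x y + dx (dx ?\<tau>) x y - 2 * \<i> * z * dx ?\<tau> x y = em (- m) x * (\<psi>' y + (c\<^sup>2 - 2 * \<i> * z * c) * \<psi> y)"
      proof -
        have "dy ?\<tau> x y = em (- m) x * \<psi>' y" "dx ?\<tau> x y = c * em (- m) x * \<psi> y" "dx (dx ?\<tau>) x y = c\<^sup>2 * em (- m) x * \<psi> y"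
          by (simp_all only: D(1), simp_all only: D(3), simp_all only: D(2))
        then show ?thesis by (simp add: algebra_simps)
      qed
      then show ?thesis unfolding cc by (simp add: mult_ac)
    qed
    ultimately show ?thesis by (simp add: case_prod_beta')
  qed
  also have "\<dots> = integral\<^sup>L (lebesgue_on (Omega l)) ?f1 + integral\<^sup>L (lebesgue_on (Omega l)) ?f2"
    by (rule Bochner_Integration.integral_add[OF i1 i2])
  also have "integral\<^sup>L (lebesgue_on (Omega l)) ?f1 = 2 * l * (LBINT t. ?\<eta> t * mode m W t)"
    unfolding mode_def by (rule integral_against_product(1)[OF W c\<eta>, of R]) (use supp in auto)
  also have "integral\<^sup>L (lebesgue_on (Omega l)) ?f2 = integral\<^sup>L (lebesgue_on (Omega l)) ?f3"
    by (rule integral_cong_AE[OF f2m f3m' ae])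
  also have "\<dots> = 2 * l * integral\<^sup>L (X \<Otimes>\<^sub>M lborel) ?f3" by (rule Omega_integral(1)[OF f3m])
  also have "integral\<^sup>L (X \<Otimes>\<^sub>M lborel) ?f3 = (LBINT t. \<psi> t * src m W t)"
  proof -
    have "(LINT x|X. U x t * (W x t * (em (- m) x * \<psi> t))) = \<psi> t * src m W t" for t
      unfolding src_def md_def by (subst integral_mult_right_zero[symmetric]) (simp add: mult_ac)
    then show ?thesis using XY.integral_snd[OF i3'] by simp
  qed
  finally have "0 = of_real (2 * l) * ((LBINT t. ?\<eta> t * mode m W t) + (LBINT t. \<psi> t * src m W t))"
    by (simp add: ring_distribs)
  then show ?thesis using l_pos by simp
qed

text \<open>The variation-of-constants formula on \<open>(y0, y]\<close> is the weak equation tested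
  with \<open>exp (\<alpha> t)\<close> times the indicator of that interval, which is approximated
  by smooth functions.\<close>

lemma evo_of_weak:
  assumes W: "continuous_on UNIV (\<lambda>(x, y). W x y)" and sl: "slice W" and Wb: "\<And>x y. norm (W x y) \<le> C"
    and weak: "\<And>m \<psi> \<psi>' R. csmooth \<psi> \<Longrightarrow> (\<And>t. (\<psi> has_vector_derivative \<psi>' t) (at t)) \<Longrightarrow> continuous_on UNIV \<psi>' \<Longrightarrow>
      (\<And>t. R < \<bar>t\<bar> \<Longrightarrow> \<psi> t = 0) \<Longrightarrow> (\<And>t. R < \<bar>t\<bar> \<Longrightarrow> \<psi>' t = 0) \<Longrightarrow>
      (LBINT t. (\<psi>' t - a z m * \<psi> t) * mode m W t) + (LBINT t. \<psi> t * src m W t) = 0"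
  shows "evo z W"
  unfolding evo_def lsol_def
proof (intro allI impI)
  fix m and y0 y :: real assume y: "y0 \<le> y"
  obtain b B where "mollifier_pair b B" using ex_mollifier_pair by blast
  then interpret mollifier_pair b B .
  define \<alpha> where "\<alpha> = a z m"
  let ?e = "\<lambda>t. exp (\<alpha> * of_real t)"
  have per: "x_periodic l W" using sliceD(3)[OF sl] by (simp add: x_periodic_def)
  have cm: "continuous_on UNIV (mode m W)" unfolding mode_def[abs_def] by (rule continuous_md[OF W per])
  have ce: "continuous_on UNIV ?e" by (intro continuous_intros)
  \<comment> \<open>A difference of smooth steps at \<open>y0\<close> and \<open>y\<close> times the
    integrating factor.\<close>
  define \<psi> where "\<psi> n t = ?e t * (of_real (Bn n y0 t) - of_real (Bn n y t))" for n t
  define \<psi>' where "\<psi>' n t = ?e t * (of_real (bn n y0 t) - of_real (bn n y t)) + \<alpha> * ?e t * (of_real (Bn n y0 t) - of_real (Bn n y t))" for n t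
  have cs: "csmooth (\<psi> n)" for n unfolding \<psi>_def[abs_def] by (intro csmooth_mult csmooth_exp csmooth_diff cs_Bn)
  have D\<psi>: "(\<psi> n has_vector_derivative \<psi>' n t) (at t)" for n t
    unfolding \<psi>_def[abs_def] \<psi>'_def
  proof (rule has_vector_derivative_mult)
    show "(?e has_vector_derivative \<alpha> * ?e t) (at t)"
      by (rule has_vector_derivative_real_field) (auto intro!: derivative_eq_intros)
    show "((\<lambda>t. of_real (Bn n y0 t) - of_real (Bn n y t)) has_vector_derivative of_real (bn n y0 t) - complex_of_real (bn n y t)) (at t)"
      by (intro has_vector_derivative_diff has_vector_derivative_of_real D_Bn)
  qed
  have c\<psi>': "continuous_on UNIV (\<psi>' n)" for n
    unfolding \<psi>'_def[abs_def]
    by (intro continuous_intros csmooth_continuous[OF cs_bn] csmooth_continuous[OF cs_Bn])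
  define R where "R = \<bar>y0\<bar> + \<bar>y\<bar> + 1"
  \<comment> \<open>Outside this interval both steps are 0 or both are 1.\<close>
  have far: "Bn n y0 t - Bn n y t = 0" if "t \<notin> {y0 - 1..y + 1}" for n t
    using that y Bn_left[of t y0 n] Bn_left[of t y n] Bn_right[of y0 t n] Bn_right[of y t n] by (cases "t < y0 - 1") auto
  have far': "t \<notin> {y0 - 1..y + 1}" "1 \<le> \<bar>t - y0\<bar>" "1 \<le> \<bar>t - y\<bar>" if "R < \<bar>t\<bar>" for t
    using that unfolding R_def by auto
  have s1: "\<psi> n t = 0" if "R < \<bar>t\<bar>" for n t
    using far[OF far'(1)[OF that], of n] by (simp add: \<psi>_def of_real_diff[symmetric] del: of_real_diff)
  have s2: "\<psi>' n t = 0" if "R < \<bar>t\<bar>" for n t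
    using far[OF far'(1)[OF that], of n] bn_zero_far[OF far'(2)[OF that]] bn_zero_far[OF far'(3)[OF that]]
    by (simp add: \<psi>'_def of_real_diff[symmetric] del: of_real_diff)
  let ?G = "\<lambda>t. ?e t * mode m W t"
  have cG: "continuous_on UNIV ?G" by (intro continuous_intros cm)
  have eq: "(LBINT t. bn n y0 t *\<^sub>R ?G t) - (LBINT t. bn n y t *\<^sub>R ?G t) + (LBINT t. \<psi> n t * src m W t) = 0" for n
  proof -
    \<comment> \<open>The integrating factor cancels the term with the rate; only the bumps at the
      two endpoints remain, and they converge to point values of the continuous mode.\<close>
    have "(\<psi>' n t - a z m * \<psi> n t) * mode m W t = bn n y0 t *\<^sub>R ?G t - bn n y t *\<^sub>R ?G t" for t
      by (simp add: \<psi>'_def \<psi>_def \<alpha>_def scaleR_conv_of_real algebra_simps)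
    then have "(LBINT t. (\<psi>' n t - a z m * \<psi> n t) * mode m W t) = (LBINT t. bn n y0 t *\<^sub>R ?G t) - (LBINT t. bn n y t *\<^sub>R ?G t)"
      by (simp only: Bochner_Integration.integral_diff[OF integrable_bn[OF cG] integrable_bn[OF cG]])
    then show ?thesis using weak[of "\<psi> n" "\<psi>' n" R m, OF cs D\<psi> c\<psi>' s1 s2] by simp
  qed
  have L2: "(\<lambda>n. LBINT t. \<psi> n t * src m W t) \<longlonglongrightarrow> (LBINT t:{y0<..y}. ?e t * src m W t)"
    unfolding set_lebesgue_integral_def
  proof (rule integral_dominated_convergence[where w = "\<lambda>t. exp (\<bar>Re \<alpha>\<bar> * R) * (C * phi t)"])
    show "integrable lborel (\<lambda>t. exp (\<bar>Re \<alpha>\<bar> * R) * (C * phi t))" using phi_integrable by simp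
    have [measurable]: "\<psi> n \<in> borel_measurable borel" for n
      by (rule borel_measurable_continuous_onI[OF csmooth_continuous[OF cs]])
    have [measurable]: "?e \<in> borel_measurable borel" by (rule borel_measurable_continuous_onI[OF ce])
    show "(\<lambda>t. \<psi> n t * src m W t) \<in> borel_measurable lborel" for n using src_measurable(1)[OF sl] by measurable
    show "(\<lambda>t. indicat_real {y0<..y} t *\<^sub>R (?e t * src m W t)) \<in> borel_measurable lborel" using src_measurable(1)[OF sl] by measurable
    \<comment> \<open>The smooth steps converge away from their centres; the two centres form a null
      set.\<close>
    have pt: "(\<lambda>n. \<psi> n t * src m W t) \<longlonglongrightarrow> indicat_real {y0<..y} t *\<^sub>R (?e t * src m W t)" if "t \<noteq> y0" "t \<noteq> y" for t
    proof -
      have "(\<lambda>n. \<psi> n t * src m W t) \<longlonglongrightarrow> ?e t * (of_real (if y0 < t then 1 else 0) - of_real (if y < t then 1 else 0)) * src m W t"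
        unfolding \<psi>_def by (intro tendsto_intros Bn_limit that)
      moreover have "?e t * (of_real (if y0 < t then 1 else 0) - of_real (if y < t then 1 else 0)) * src m W t = indicat_real {y0<..y} t *\<^sub>R (?e t * src m W t)"
        using y that by (auto simp: indicator_def)
      ultimately show ?thesis by simp
    qed
    show "AE t in lborel. (\<lambda>n. \<psi> n t * src m W t) \<longlonglongrightarrow> indicat_real {y0<..y} t *\<^sub>R (?e t * src m W t)"
      using AE_lborel_singleton[of y0] AE_lborel_singleton[of y] by eventually_elim (rule pt)
    show "AE t in lborel. norm (\<psi> n t * src m W t) \<le> exp (\<bar>Re \<alpha>\<bar> * R) * (C * phi t)" for n
    proof (rule AE_I2)
      fix t
      have sb: "norm (src m W t) \<le> C * phi t" by (rule norm_src_le[OF sl Wb])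
      have "norm (\<psi> n t) \<le> exp (\<bar>Re \<alpha>\<bar> * R)"
      proof (cases "R < \<bar>t\<bar>")
        case True
        then show ?thesis by (simp add: s1)
      next
        case False
        have "Re \<alpha> * t \<le> \<bar>Re \<alpha>\<bar> * \<bar>t\<bar>" by (metis abs_ge_self abs_mult)
        also have "\<dots> \<le> \<bar>Re \<alpha>\<bar> * R" using False by (intro mult_left_mono) auto
        finally have 1: "norm (?e t) \<le> exp (\<bar>Re \<alpha>\<bar> * R)" by simp
        have "\<bar>Bn n y0 t - Bn n y t\<bar> \<le> 1" unfolding Bn_def
          using B0 B1 by (smt (verit))
        then have 2: "norm (complex_of_real (Bn n y0 t) - of_real (Bn n y t)) \<le> 1"
          by (simp only: of_real_diff[symmetric] norm_of_real)
        show ?thesis unfolding \<psi>_def norm_mult using mult_mono[OF 1 2] by simp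
      qed
      then show "norm (\<psi> n t * src m W t) \<le> exp (\<bar>Re \<alpha>\<bar> * R) * (C * phi t)"
        unfolding norm_mult using sb by (intro mult_mono) auto
    qed
  qed
  have "(\<lambda>n. (LBINT t. bn n y0 t *\<^sub>R ?G t) - (LBINT t. bn n y t *\<^sub>R ?G t) + (LBINT t. \<psi> n t * src m W t))
     \<longlonglongrightarrow> ?G y0 - ?G y + (LBINT t:{y0<..y}. ?e t * src m W t)"
    by (intro tendsto_add tendsto_diff mollify_limit cG L2)
  then have lim0: "?G y0 - ?G y + (LBINT t:{y0<..y}. ?e t * src m W t) = 0"
    unfolding eq by (simp add: LIMSEQ_const_iff)
  have e0: "exp (- \<alpha> * of_real y) * exp (\<alpha> * of_real t) = exp (- \<alpha> * of_real (y - t))" for t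
    unfolding exp_add[symmetric] by (rule arg_cong[where f = exp]) (simp add: algebra_simps)
  have e1: "exp (- \<alpha> * of_real y) * (exp (\<alpha> * of_real t) * c) = exp (- \<alpha> * of_real (y - t)) * c" for t c
    unfolding mult.assoc[symmetric] e0 ..
  have G: "?G y = ?G y0 + (LBINT t:{y0<..y}. ?e t * src m W t)" using lim0 by (simp add: algebra_simps)
  have "mode m W y = exp (- \<alpha> * of_real y) * ?G y" unfolding e1 by simp
  also have "\<dots> = exp (- \<alpha> * of_real y) * ?G y0 + exp (- \<alpha> * of_real y) * (LBINT t:{y0<..y}. ?e t * src m W t)"
    unfolding G by (rule distrib_left)
  also have "\<dots> = exp (- \<alpha> * of_real (y - y0)) * mode m W y0 + (LBINT t:{y0<..y}. exp (- \<alpha> * of_real (y - t)) * src m W t)"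
    unfolding set_integral_mult_right[symmetric] e1 ..
  finally show "mode m W y = exp (- a z m * of_real (y - y0)) * mode m W y0 + (LBINT t:{y0<..y}. exp (- a z m * of_real (y - t)) * src m W t)"
    unfolding \<alpha>_def .
qed

lemma nonresonant: "z \<in> C_omega l \<Longrightarrow> m \<noteq> 0 \<Longrightarrow> Re (a z m) \<noteq> 0"
proof
  assume z: "z \<in> C_omega l" and m: "m \<noteq> 0" and "Re (a z m) = 0"
  then have "w * of_int m + 2 * Re z = 0" using w_pos by (simp add: Re_a)
  then have "2 * Re z = freq l * of_int (- m)" by (simp add: w_def)
  then show False using z m unfolding C_omega_def by (metis (mono_tags, lifting) mem_Collect_eq neg_equal_0_iff_equal)
qed

text \<open>Away from resonance every mode other than 0 has a nonzero real rate. Starting the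
  formula at distance \<open>n\<close>, on the left for stable and on the right for unstable modes,
  damps the bounded data by \<open>exp (- r n)\<close>. Mode 0 is undamped, and there the limit at
  infinity fixes the data.\<close>

lemma sol_of_evo:
  assumes sl: "slice W" and ev: "evo z W" and Wb: "\<And>x y. norm (W x y) \<le> B"
    and z: "z \<in> C_omega l" and lim: "\<And>x. ((\<lambda>y. W x y) \<longlongrightarrow> 1) at_infinity"
  shows "sol z \<rho> B W"
  unfolding sol_def
proof (intro conjI allI impI sl ev Wb)
  have B0: "0 \<le> B" using norm_ge_zero Wb order.trans by blast
  have mb: "norm (mode m W y) \<le> B" for m y by (rule norm_mode_le[OF sl Wb])
  have nat_lim: "(\<lambda>n. exp (- r * real n) * B + k) \<longlonglongrightarrow> k" if "0 < r" for r k :: real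
  proof -
    have "filterlim (\<lambda>n. - (r * real n)) at_bot sequentially"
      unfolding filterlim_uminus_at_bot minus_minus
      by (rule filterlim_tendsto_pos_mult_at_top[OF tendsto_const that filterlim_real_sequentially])
    then have "(\<lambda>n. exp (- r * real n)) \<longlonglongrightarrow> 0"
      using filterlim_compose[OF exp_at_bot, of "\<lambda>n. - (r * real n)"] by simp
    then have "(\<lambda>n. exp (- r * real n) * B + k) \<longlonglongrightarrow> 0 * B + k" by (intro tendsto_intros)
    then show ?thesis by simp
  qed
  show "norm (mode m W y) \<le> B * Phi y" if "pos z \<rho> m" for m y
  proof -
    have "m \<noteq> 0" using that not_pos_0 by auto
    then have r: "0 < Re (a z m)" using that nonresonant[OF z] by (auto simp: pos_def)
    have "norm (mode m W y) \<le> exp (- Re (a z m) * real n) * B + B * Phi y" for n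
    proof -
      have "norm (mode m W y) \<le> exp (- Re (a z m) * (y - (y - real n))) * norm (mode m W (y - real n))
           + (LBINT t:{y - real n<..y}. exp (- Re (a z m) * (y - t)) * norm (src m W t))"
        by (rule evo_norm_le[OF sl ev Wb]) auto
      also have "(LBINT t:{y - real n<..y}. exp (- Re (a z m) * (y - t)) * norm (src m W t)) \<le> (LBINT t:{y - real n<..y}. B * phi t)"
      proof (rule set_integral_mono)
        show "set_integrable lborel {y - real n<..y} (\<lambda>t. exp (- Re (a z m) * (y - t)) * norm (src m W t))"
          by (rule exp_src_integrable[OF sl Wb])
        show "set_integrable lborel {y - real n<..y} (\<lambda>t. B * phi t)" by (intro set_integrable_mult_right phi_set) simp
        fix t assume "t \<in> {y - real n<..y}"
        then have "exp (- Re (a z m) * (y - t)) \<le> 1" using r by simp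
        then have "exp (- Re (a z m) * (y - t)) * norm (src m W t) \<le> 1 * (B * phi t)"
          by (intro mult_mono norm_src_le[OF sl Wb]) auto
        then show "exp (- Re (a z m) * (y - t)) * norm (src m W t) \<le> B * phi t" by simp
      qed
      also have "\<dots> \<le> B * Phi y"
        using B0 Phi_nonneg[of "y - real n"] by (simp add: Phi_diff mult_left_mono)
      also have "exp (- Re (a z m) * (y - (y - real n))) * norm (mode m W (y - real n)) \<le> exp (- Re (a z m) * real n) * B"
        using mb by (simp add: mult_left_mono)
      finally show ?thesis by simp
    qed
    then show ?thesis by (intro LIMSEQ_le_const[OF nat_lim[OF r]]) blast
  qed
  show "norm (mode m W y) \<le> B * (Phi_inf - Phi y)" if "neg z \<rho> m" for m y
  proof -
    have "m \<noteq> 0" using that not_neg_0 by auto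
    then have r: "0 < - Re (a z m)" using that nonresonant[OF z] by (auto simp: neg_def)
    have "norm (mode m W y) \<le> exp (- (- Re (a z m)) * real n) * B + B * (Phi_inf - Phi y)" for n
    proof -
      let ?s = "y + real n" and ?C = "exp (- Re (a z m) * real n)"
      have "mode m W ?s = exp (- a z m * of_real (?s - y)) * mode m W y + (LBINT t:{y<..?s}. exp (- a z m * of_real (?s - t)) * src m W t)"
      proof -
        have "y \<le> ?s" by simp
        then show ?thesis using ev unfolding evo_def lsol_def by blast
      qed
      then have eq: "exp (- a z m * of_real (?s - y)) * mode m W y = mode m W ?s - (LBINT t:{y<..?s}. exp (- a z m * of_real (?s - t)) * src m W t)"
        by simp
      have "norm (LBINT t:{y<..?s}. exp (- a z m * of_real (?s - t)) * src m W t) \<le> ?C * B * (Phi ?s - Phi y)"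
      proof (rule norm_src_integral_le[OF sl Wb])
        fix t assume "t \<in> {y<..?s}"
        then have "- Re (a z m) * (?s - t) \<le> - Re (a z m) * real n" using r by (intro mult_left_mono) auto
        then show "norm (exp (- a z m * complex_of_real (?s - t))) \<le> ?C" by simp
      qed auto
      also have "\<dots> \<le> ?C * B * (Phi_inf - Phi y)" using B0 Phi_le_inf[of ?s] by (intro mult_left_mono) auto
      finally have "norm (exp (- a z m * of_real (?s - y)) * mode m W y) \<le> B + ?C * B * (Phi_inf - Phi y)"
        unfolding eq using mb[of m ?s] by (intro order.trans[OF norm_triangle_ineq4] add_mono)
      then have "?C * norm (mode m W y) \<le> B + ?C * B * (Phi_inf - Phi y)"
        by (simp add: norm_mult)
      \<comment> \<open>Division by the growth factor turns the amplification over \<open>n\<close>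
        units into damping of the data at \<open>y + n\<close>.\<close>
      moreover have "norm b \<le> inverse c * B + B * d" if "0 < c" "c * norm b \<le> B + c * B * d" for c d :: real and b :: complex
        using that by (simp add: field_simps)
      ultimately have "norm (mode m W y) \<le> inverse ?C * B + B * (Phi_inf - Phi y)" by simp
      then show ?thesis by (simp add: exp_minus)
    qed
    then show ?thesis by (intro LIMSEQ_le_const[OF nat_lim[OF r]]) blast
  qed
  have diff: "norm (mode 0 W y - mode 0 W s) \<le> B * (Phi y - Phi s)" if "s \<le> y" for s y
  proof -
    have "mode 0 W y = exp (- a z 0 * of_real (y - s)) * mode 0 W s + (LBINT t:{s<..y}. exp (- a z 0 * of_real (y - t)) * src 0 W t)"
      using ev that unfolding evo_def lsol_def by blast
    then have "mode 0 W y - mode 0 W s = (LBINT t:{s<..y}. exp (- a z 0 * of_real (y - t)) * src 0 W t)" by (simp add: a_0)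
    moreover have "norm (LBINT t:{s<..y}. exp (- a z 0 * of_real (y - t)) * src 0 W t) \<le> 1 * B * (Phi y - Phi s)"
      by (rule norm_src_integral_le[OF sl Wb]) (use that in \<open>auto simp: a_0\<close>)
    ultimately show ?thesis by simp
  qed
  \<comment> \<open>The limits in \<open>y\<close> hold for each \<open>x\<close> separately;
    boundedness lets them pass under the mean over a period.\<close>
  have m0: "(\<lambda>n. mode 0 W (Y n)) \<longlonglongrightarrow> 1" if "filterlim Y at_infinity sequentially" for Y :: "nat \<Rightarrow> real"
  proof -
    have "(\<lambda>n. LINT x|X. W x (Y n) * em 0 x) \<longlonglongrightarrow> (LINT x|X. 1)"
    proof (rule integral_dominated_convergence[where w = "\<lambda>_. B"])
      show "AE x in X. (\<lambda>n. W x (Y n) * em 0 x) \<longlonglongrightarrow> 1"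
        using filterlim_compose[OF lim that] by (intro AE_I2) simp
      show "(\<lambda>x. W x (Y n) * em 0 x) \<in> borel_measurable X" for n using sliceD(5)[OF sl, of "Y n"] by simp
    qed (use Wb in auto)
    then show ?thesis using X.prob_space by (simp add: mode_def md_def)
  qed
  have seqs: "filterlim (\<lambda>n. y - real n) at_infinity sequentially" "filterlim (\<lambda>n. y + real n) at_infinity sequentially" for y :: real
  proof -
    have "filterlim (\<lambda>n. - y + real n) at_top sequentially"
      by (rule filterlim_tendsto_add_at_top[OF tendsto_const filterlim_real_sequentially])
    then have "filterlim (\<lambda>n. - (- y + real n)) at_bot sequentially" by (simp only: filterlim_uminus_at_bot minus_minus)
    then show "filterlim (\<lambda>n. y - real n) at_infinity sequentially"
      using filterlim_mono[OF _ at_bot_le_at_infinity order_refl] by (simp add: algebra_simps)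
    have "filterlim (\<lambda>n. y + real n) at_top sequentially"
      by (rule filterlim_tendsto_add_at_top[OF tendsto_const filterlim_real_sequentially])
    then show "filterlim (\<lambda>n. y + real n) at_infinity sequentially" by (rule filterlim_at_top_imp_at_infinity)
  qed
  show "norm (mode 0 W y - 1) \<le> B * Phi y" for y
  proof (rule LIMSEQ_le_const2)
    show "(\<lambda>n. norm (mode 0 W y - mode 0 W (y - real n))) \<longlonglongrightarrow> norm (mode 0 W y - 1)"
      by (intro tendsto_intros m0 seqs)
    have "norm (mode 0 W y - mode 0 W (y - real n)) \<le> B * Phi y" for n
      using diff[of "y - real n" y] mult_left_mono[OF _ B0, of "Phi y - Phi (y - real n)" "Phi y"] Phi_nonneg[of "y - real n"] by simp
    then show "\<exists>N. \<forall>n\<ge>N. norm (mode 0 W y - mode 0 W (y - real n)) \<le> B * Phi y" by blast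
  qed
  show "norm (mode 0 W y - 1) \<le> B * (Phi_inf - Phi y)" for y
  proof (rule LIMSEQ_le_const2)
    show "(\<lambda>n. norm (mode 0 W y - mode 0 W (y + real n))) \<longlonglongrightarrow> norm (mode 0 W y - 1)"
      by (intro tendsto_intros m0 seqs)
    have "norm (mode 0 W y - mode 0 W (y + real n)) \<le> B * (Phi_inf - Phi y)" for n
      using diff[of y "y + real n"] mult_left_mono[OF _ B0, of "Phi (y + real n) - Phi y" "Phi_inf - Phi y"] Phi_le_inf[of "y + real n"]
      by (simp add: norm_minus_commute)
    then show "\<exists>N. \<forall>n\<ge>N. norm (mode 0 W y - mode 0 W (y + real n)) \<le> B * (Phi_inf - Phi y)" by blast
  qed
qed

text \<open>Strict signs of rates persist by continuity. A vanishing rate becomes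
  \<open>2 w m (Re (zn n) - Re z)\<close>, whose sign is that of \<open>\<rho> m\<close> when the
  sequence lies on the side given by \<rho>.\<close>

lemma signs_eventually:
  assumes lim: "zn \<longlonglongrightarrow> z" and side: "\<And>m n. m \<noteq> 0 \<Longrightarrow> Re (a z m) = 0 \<Longrightarrow> 0 < \<rho> * (Re (zn n) - Re z)"
  shows "pos z \<rho> m \<Longrightarrow> \<forall>\<^sub>F n in sequentially. pos (zn n) \<rho> m"
    and "neg z \<rho> m \<Longrightarrow> \<forall>\<^sub>F n in sequentially. neg (zn n) \<rho> m"
proof -
  have lim': "(\<lambda>n. Re (a (zn n) m)) \<longlonglongrightarrow> Re (a z m)"
    unfolding Re_a by (intro tendsto_intros lim)
  have diff: "Re (a (zn n) m) = 2 * w * (of_int m * (Re (zn n) - Re z))" if "Re (a z m) = 0" for n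
  proof -
    have "Re (a (zn n) m) - Re (a z m) = 2 * w * (of_int m * (Re (zn n) - Re z))"
      unfolding Re_a by (simp add: algebra_simps)
    then show ?thesis using that by simp
  qed
  \<comment> \<open>Multiplying by \<rho> twice avoids a distinction by the sign of \<rho>.\<close>
  have sq: "0 < \<rho> * \<rho>" if "\<rho> * of_int m \<noteq> 0" using that by (auto simp: zero_less_mult_iff)
  {
    assume p: "pos z \<rho> m"
    show "\<forall>\<^sub>F n in sequentially. pos (zn n) \<rho> m"
    proof (cases "0 < Re (a z m)")
      case True
      show ?thesis using order_tendstoD(1)[OF lim' True] by eventually_elim (simp add: pos_def)
    next
      case False
      then have 0: "Re (a z m) = 0" "0 < \<rho> * of_int m" using p by (auto simp: pos_def)
      have "0 < of_int m * (Re (zn n) - Re z)" for n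
      proof -
        have "0 < \<rho> * (Re (zn n) - Re z)" using side 0 not_pos_0 p by (metis)
        then have "0 < (\<rho> * of_int m) * (\<rho> * (Re (zn n) - Re z))" using 0 by simp
        also have "\<dots> = (\<rho> * \<rho>) * (of_int m * (Re (zn n) - Re z))" by (simp add: mult_ac)
        finally show ?thesis using sq 0(2) by (simp only: zero_less_mult_iff) auto
      qed
      then show ?thesis using w_pos by (intro always_eventually) (simp add: pos_def diff[OF 0(1)])
    qed
  next
    assume p: "neg z \<rho> m"
    show "\<forall>\<^sub>F n in sequentially. neg (zn n) \<rho> m"
    proof (cases "Re (a z m) < 0")
      case True
      show ?thesis using order_tendstoD(2)[OF lim' True] by eventually_elim (simp add: neg_def)
    next
      case False
      then have 0: "Re (a z m) = 0" "\<rho> * of_int m < 0" using p by (auto simp: neg_def)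
      have "of_int m * (Re (zn n) - Re z) < 0" for n
      proof -
        have "0 < \<rho> * (Re (zn n) - Re z)" using side 0 not_neg_0 p by (metis)
        then have "(\<rho> * of_int m) * (\<rho> * (Re (zn n) - Re z)) < 0" by (rule mult_neg_pos[OF 0(2)])
        moreover have "(\<rho> * of_int m) * (\<rho> * (Re (zn n) - Re z)) = (\<rho> * \<rho>) * (of_int m * (Re (zn n) - Re z))" by (simp add: mult_ac)
        ultimately have "(\<rho> * \<rho>) * (of_int m * (Re (zn n) - Re z)) < 0" by (simp only:)
        then show ?thesis using sq 0(2) by (simp only: mult_less_0_iff) auto
      qed
      then show ?thesis using w_pos by (intro always_eventually) (simp add: neg_def diff[OF 0(1)] mult_less_0_iff)
    qed
  }
qed

end

section \<open>The family of solutions\<close>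

lemma AE_lborel_dense:
  fixes S :: "'a::euclidean_space set"
  assumes "AE x in lborel. P x" and S: "open S" "S \<noteq> {}"
  shows "\<exists>x\<in>S. P x"
proof (rule ccontr)
  assume neg: "\<not> (\<exists>x\<in>S. P x)"
  obtain N where N: "{x \<in> space lborel. \<not> P x} \<subseteq> N" "emeasure lborel N = 0" "N \<in> sets lborel"
    using assms(1) by (rule AE_E)
  obtain c where c: "c \<in> S" using S by auto
  obtain r where r: "0 < r" "ball c r \<subseteq> S" using S c by (auto simp: open_contains_ball)
  have "ball c r \<subseteq> N" using N(1) neg r(2) by auto
  then have "emeasure lborel (ball c r) \<le> emeasure lborel N" by (rule emeasure_mono[OF _ N(3)])
  moreover have "0 < unit_ball_vol (real DIM('a)) * r ^ DIM('a)" using r(1) by simp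
  ultimately show False using r(1) N(2) by (simp add: emeasure_ball)
qed

lemma LIMSEQ_subseqI:
  fixes X :: "nat \<Rightarrow> 'a::metric_space"
  assumes "\<And>s. strict_mono (s :: nat \<Rightarrow> nat) \<Longrightarrow> \<exists>r. strict_mono (r :: nat \<Rightarrow> nat) \<and> (\<lambda>n. X (s (r n))) \<longlonglongrightarrow> L"
  shows "X \<longlonglongrightarrow> L"
proof (rule ccontr)
  assume "\<not> X \<longlonglongrightarrow> L"
  then obtain e where e: "0 < e" "\<not> (\<forall>\<^sub>F n in sequentially. dist (X n) L < e)"
    unfolding tendsto_iff by auto
  obtain s :: "nat \<Rightarrow> nat" where s: "strict_mono s" "\<And>n. \<not> dist (X (s n)) L < e"
    using not_eventually_sequentiallyD[OF e(2)] by blast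
  obtain r :: "nat \<Rightarrow> nat" where r: "strict_mono r" "(\<lambda>n. X (s (r n))) \<longlonglongrightarrow> L" using assms[OF s(1)] by blast
  have "\<forall>\<^sub>F n in sequentially. dist (X (s (r n))) L < e" by (rule tendstoD[OF r(2) e(1)])
  then show False using s(2) by simp
qed

context period begin

lemma open_C_omega: "open (C_omega l)"
proof -
  have "C_omega l = - ((\<lambda>z. 2 * Re z / w) -` (of_int ` (- {0 :: int})))"
  proof (intro set_eqI iffI)
    fix z assume "z \<in> C_omega l"
    then show "z \<in> - ((\<lambda>z. 2 * Re z / w) -` (of_int ` (- {0 :: int})))"
      using w_pos unfolding C_omega_def by (auto simp: w_def[symmetric] field_simps)
  next
    fix z assume z: "z \<in> - ((\<lambda>z. 2 * Re z / w) -` (of_int ` (- {0 :: int})))"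
    have "2 * Re z \<noteq> w * of_int n" if "n \<noteq> 0" for n :: int
    proof
      assume "2 * Re z = w * of_int n"
      then have "2 * Re z / w = of_int n" using w_pos by simp
      then have "2 * Re z / w \<in> of_int ` (- {0 :: int})" using that by (intro image_eqI[of _ _ n]) auto
      then show False using z by simp
    qed
    then show "z \<in> C_omega l" unfolding C_omega_def w_def by simp
  qed
  moreover have "closed ((\<lambda>z. 2 * Re z / w) -` (of_int ` (- {0 :: int})))"
    by (intro closed_vimage closed_of_int_image continuous_intros) (use w_pos in auto)
  ultimately show ?thesis by (simp add: open_Compl)
qed

lemma E_dom_sets: "E_dom l \<in> sets lebesgue"
proof -
  have "E_dom l = ({-l..l} \<times> UNIV \<times> UNIV) \<inter> (UNIV \<times> UNIV \<times> C_omega l)"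
    by (auto simp: E_dom_def Omega_def)
  moreover have "({-l..l} \<times> UNIV \<times> UNIV :: (real \<times> real \<times> complex) set) \<in> sets borel"
    by (intro borel_closed closed_Times) auto
  moreover have "(UNIV \<times> UNIV \<times> C_omega l :: (real \<times> real \<times> complex) set) \<in> sets borel"
    by (intro borel_open open_Times open_C_omega) auto
  ultimately have "E_dom l \<in> sets borel" by (metis sets.Int)
  then show ?thesis by simp
qed

lemma periodic_bound:
  fixes F :: "real \<Rightarrow> complex"
  assumes per: "\<And>x. F (x + 2 * l) = F x" and F: "\<And>x. x \<in> {-l..l} \<Longrightarrow> norm (F x) \<le> B"
  shows "norm (F x) \<le> B"
proof -
  interpret periodic_fun_simple F "2 * l" by standard (rule per)
  define n where "n = \<lfloor>(x + l) / (2 * l)\<rfloor>"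
  have "of_int n \<le> (x + l) / (2 * l)" "(x + l) / (2 * l) < of_int n + 1" unfolding n_def by linarith+
  then have "of_int n * (2 * l) \<le> x + l" "x + l < (of_int n + 1) * (2 * l)" using l_pos by (simp_all add: field_simps)
  then have "x - of_int n * (2 * l) \<in> {-l..l}" by (auto simp: algebra_simps)
  then have "norm (F (x - of_int n * (2 * l))) \<le> B" by (rule F)
  then show ?thesis by (simp only: minus_of_int)
qed

text \<open>The null sets for different \<open>(x, y)\<close> must be united. By Fubini the bound
  holds for almost all \<open>z\<close> at densely many \<open>(x, y)\<close>; countably many of
  these suffice, because continuity and periodicity yield the rest.\<close>

lemma ae_bound:
  fixes \<mu> :: "real \<Rightarrow> real \<Rightarrow> complex \<Rightarrow> complex"
  assumes ae: "AE (x, y, z) in lebesgue_on (E_dom l). norm (\<mu> x y z) \<le> B"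
    and cont: "\<And>z. z \<in> C_omega l \<Longrightarrow> continuous_on UNIV (\<lambda>(x, y). \<mu> x y z)"
    and per: "\<And>z. z \<in> C_omega l \<Longrightarrow> x_periodic l (\<lambda>x y. \<mu> x y z)"
  shows "AE z in lborel. z \<in> C_omega l \<longrightarrow> (\<forall>x y. norm (\<mu> x y z) \<le> B)"
proof -
  define P where "P x y z \<longleftrightarrow> ((x, y, z) \<in> E_dom l \<longrightarrow> norm (\<mu> x y z) \<le> B)" for x y z
  have "AE p in lebesgue. p \<in> E_dom l \<longrightarrow> (case p of (x, y, z) \<Rightarrow> norm (\<mu> x y z) \<le> B)"
    using ae E_dom_sets by (subst (asm) AE_restrict_space_iff) auto
  then have "AE p in (lborel :: (real \<times> real \<times> complex) measure). P (fst p) (fst (snd p)) (snd (snd p))"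
    unfolding AE_completion_iff by eventually_elim (auto simp: P_def)
  then have a1: "AE p in (lborel :: real measure) \<Otimes>\<^sub>M (lborel :: (real \<times> complex) measure). P (fst p) (fst (snd p)) (snd (snd p))"
    by (simp only: lborel_prod)
  have "AE x in lborel. AE q in (lborel :: (real \<times> complex) measure). P x (fst q) (snd q)"
    using lborel_pair.AE_pair[OF a1] by simp
  then have a2: "AE x in lborel. AE y in lborel. AE z in lborel. P x y z"
  proof eventually_elim
    case (elim x)
    then have "AE q in (lborel :: real measure) \<Otimes>\<^sub>M (lborel :: complex measure). P x (fst q) (snd q)"
      by (simp only: lborel_prod)
    then show ?case using lborel_pair.AE_pair by fastforce
  qed
  \<comment> \<open>Dense because each of the nested almost-everywhere statements has a good point
    in every nonempty open set.\<close>
  define G where "G = {p. AE z in lborel. P (fst p) (snd p) z}"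
  obtain D where D: "countable D" "D \<subseteq> G" "G \<subseteq> closure D" by (rule separable)
  have "closure G = UNIV"
  proof (rule ccontr)
    assume "closure G \<noteq> UNIV"
    then obtain p where p: "p \<in> - closure G" by auto
    then obtain S T where ST: "open S" "open T" "p \<in> S \<times> T" "S \<times> T \<subseteq> - closure G"
      using open_prod_elim[of "- closure G" p] by (metis closed_closure open_Compl)
    have "S \<noteq> {}" "T \<noteq> {}" using ST by auto
    obtain x where x: "x \<in> S" "AE y in lborel. AE z in lborel. P x y z"
      using AE_lborel_dense[OF a2 \<open>open S\<close> \<open>S \<noteq> {}\<close>] by blast
    obtain y where y: "y \<in> T" "AE z in lborel. P x y z"
      using AE_lborel_dense[OF x(2) \<open>open T\<close> \<open>T \<noteq> {}\<close>] by blast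
    have "(x, y) \<in> G" using y by (simp add: G_def)
    then show False using ST(4) x(1) y(1) closure_subset by blast
  qed
  then have dense: "closure D = UNIV" using D(3) closure_minimal[OF D(3) closed_closure] by auto
  have "AE z in lborel. \<forall>p\<in>D. P (fst p) (snd p) z"
    using D(2) by (subst AE_ball_countable[OF D(1)]) (auto simp: G_def)
  then show ?thesis
  proof eventually_elim
    case (elim z)
    show ?case
    proof (intro impI allI)
      fix x y assume z: "z \<in> C_omega l"
      \<comment> \<open>The open strip: a dense set is dense in it, and its closure contains the
        edges.\<close>
      define O' where "O' = {-l<..<l} \<times> (UNIV :: real set)"
      have cl: "closed {p. norm (case p of (x, y) \<Rightarrow> \<mu> x y z) \<le> B}"
        by (intro closed_Collect_le continuous_on_norm cont[OF z] continuous_on_const)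
      have "O' \<inter> D \<subseteq> {p. norm (case p of (x, y) \<Rightarrow> \<mu> x y z) \<le> B}"
      proof
        fix p assume p: "p \<in> O' \<inter> D"
        obtain x y where xy: "p = (x, y)" by (cases p)
        have "P x y z" using elim p xy by auto
        then show "p \<in> {p. norm (case p of (x, y) \<Rightarrow> \<mu> x y z) \<le> B}"
          using p z by (auto simp: xy P_def E_dom_def Omega_def O'_def)
      qed
      then have 1: "closure (O' \<inter> D) \<subseteq> {p. norm (case p of (x, y) \<Rightarrow> \<mu> x y z) \<le> B}"
        by (rule closure_minimal[OF _ cl])
      have "open O'" unfolding O'_def by (intro open_Times) auto
      then have "O' \<subseteq> closure (O' \<inter> D)" using open_Int_closure_subset[of O' D] dense by simp
      then have "closure O' \<subseteq> {p. norm (case p of (x, y) \<Rightarrow> \<mu> x y z) \<le> B}"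
        using 1 cl by (intro closure_minimal) auto
      moreover have "closure O' = {-l..l} \<times> UNIV"
        unfolding O'_def closure_Times using l_pos by simp
      ultimately have sub: "{-l..l} \<times> UNIV \<subseteq> {p. norm (case p of (x, y) \<Rightarrow> \<mu> x y z) \<le> B}" by simp
      have "norm (\<mu> x' y z) \<le> B" if "x' \<in> {-l..l}" for x'
      proof -
        have "(x', y) \<in> {-l..l} \<times> UNIV" using that by simp
        then have "(x', y) \<in> {p. norm (case p of (x, y) \<Rightarrow> \<mu> x y z) \<le> B}"
          by (rule subsetD[OF sub])
        then show ?thesis by simp
      qed
      then show "norm (\<mu> x y z) \<le> B"
      proof (rule periodic_bound[of "\<lambda>x. \<mu> x y z", rotated])
        show "\<mu> (x + 2 * l) y z = \<mu> x y z" for x using per[OF z] by (simp add: x_periodic_def)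
      qed
    qed
  qed
qed

end

locale solution_family = potential l U for l U +
  fixes u :: "real \<Rightarrow> real \<Rightarrow> complex" and \<mu> :: "real \<Rightarrow> real \<Rightarrow> complex \<Rightarrow> complex"
  assumes u_meas: "(\<lambda>(x, y). u x y) \<in> borel_measurable (lebesgue_on (Omega l))"
    and link: "AE p in lebesgue_on (Omega l). (case p of (x, y) \<Rightarrow> u x y) = (case p of (x, y) \<Rightarrow> U x y)"
    and Uint: "integrable (X \<Otimes>\<^sub>M lborel) (case_prod U)"
    and solution: "is_solution l u \<mu>"
begin

lemma \<mu>_cont: "z \<in> C_omega l \<Longrightarrow> continuous_on UNIV (\<lambda>(x, y). \<mu> x y z)"
  and \<mu>_per: "z \<in> C_omega l \<Longrightarrow> x_periodic l (\<lambda>x y. \<mu> x y z)"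
  and \<mu>_L1: "z \<in> C_omega l \<Longrightarrow> fourier_in_L1 l (\<lambda>x y. \<mu> x y z - 1)"
  and \<mu>_PDE: "z \<in> C_omega l \<Longrightarrow> solves_PDE l u z (\<lambda>x y. \<mu> x y z)"
  and \<mu>_lim: "z \<in> C_omega l \<Longrightarrow> ((\<lambda>y. \<mu> x y z) \<longlongrightarrow> 1) at_infinity"
  using solution unfolding is_solution_def by auto

lemma \<mu>_slice:
  assumes z: "z \<in> C_omega l"
  shows "slice (\<lambda>x y. \<mu> x y z)"
  unfolding slice_def
proof (intro conjI allI)
  have "(\<lambda>(x, y). \<mu> x y z) \<in> borel_measurable borel" by (rule borel_measurable_continuous_onI[OF \<mu>_cont[OF z]])
  then show "(\<lambda>(x, y). \<mu> x y z) \<in> borel_measurable (borel \<Otimes>\<^sub>M borel)" by (simp only: borel_prod)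
  show "continuous_on UNIV (\<lambda>x. \<mu> x y z)" for y
    using continuous_on_compose2[OF \<mu>_cont[OF z], of UNIV "\<lambda>x. (x, y)"] by (simp add: continuous_intros)
  show "\<mu> (x + 2 * l) y z = \<mu> x y z" for x y using \<mu>_per[OF z] by (simp add: x_periodic_def)
qed

text \<open>For one single \<open>z\<close> the almost-everywhere bound says nothing. Integrability
  of the transform of \<open>\<mu> - 1\<close> does, with a bound that may depend on
  \<open>z\<close>.\<close>

lemma \<mu>_bounded:
  assumes z: "z \<in> C_omega l"
  shows "\<exists>B. \<forall>x y. norm (\<mu> x y z) \<le> B"
proof -
  let ?F = "\<lambda>x y. \<mu> x y z - 1"
  obtain g where g: "integrable (count_space UNIV \<Otimes>\<^sub>M lborel) g" "is_fourier_transform l ?F g"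
    using \<mu>_L1[OF z] unfolding fourier_in_L1_def by blast
  let ?S = "(LINT p|(count_space UNIV \<Otimes>\<^sub>M lborel). norm (g p)) / (2 * pi)"
  have "continuous_on UNIV (\<lambda>p. (case p of (x, y) \<Rightarrow> \<mu> x y z) - 1)"
    by (intro continuous_on_diff continuous_on_const \<mu>_cont[OF z])
  then have F: "continuous_on UNIV (\<lambda>(x, y). ?F x y)" by (simp add: case_prod_unfold)
  have per: "x_periodic l ?F" using \<mu>_per[OF z] by (simp add: x_periodic_def)
  have "norm (?F x y) \<le> ?S" for x y
  proof (rule norm_le_sum_fourier[of "\<lambda>x. ?F x y"])
    show "continuous_on UNIV (\<lambda>x. ?F x y)" by (intro continuous_on_diff continuous_on_const sliceD(2)[OF \<mu>_slice[OF z]])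
    show "?F (x + 2 * l) y = ?F x y" for x using per by (simp add: x_periodic_def)
    show "(\<Sum>m\<in>A. norm (md m (\<lambda>x. ?F x y))) \<le> ?S" if "finite A" for A
      by (rule fourier_L1_modes[OF F per g that])
  qed
  then have "norm (\<mu> x y z) \<le> ?S + 1" for x y
    using norm_triangle_ineq[of "\<mu> x y z - 1" 1] by (smt (verit) diff_add_cancel norm_one)
  then show ?thesis by blast
qed

lemma \<mu>_sol:
  assumes z: "z \<in> C_omega l" and B: "\<And>x y. norm (\<mu> x y z) \<le> B"
  shows "sol z \<rho> B (\<lambda>x y. \<mu> x y z)"
proof (rule sol_of_evo[OF \<mu>_slice[OF z] _ B z \<mu>_lim[OF z]])
  show "evo z (\<lambda>x y. \<mu> x y z)"
  proof (rule evo_of_weak[OF \<mu>_cont[OF z] \<mu>_slice[OF z] B])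
    fix m \<psi> \<psi>' and R :: real
    assume \<psi>: "csmooth \<psi>" "\<And>t. (\<psi> has_vector_derivative \<psi>' t) (at t)" "continuous_on UNIV \<psi>'"
      "\<And>t. R < \<bar>t\<bar> \<Longrightarrow> \<psi> t = 0" "\<And>t. R < \<bar>t\<bar> \<Longrightarrow> \<psi>' t = 0"
    show "(LBINT t. (\<psi>' t - a z m * \<psi> t) * mode m (\<lambda>x y. \<mu> x y z) t) + (LBINT t. \<psi> t * src m (\<lambda>x y. \<mu> x y z) t) = 0"
      by (rule weak_mode_equation[OF u_meas link Uint \<mu>_cont[OF z] B \<mu>_PDE[OF z] \<psi>(1-3)]) (fact \<psi>)+
  qed
qed

text \<open>The shift changes \<open>2 Re z\<close> by an even multiple of \<omega>. It can reach an
  excluded line only from an excluded line or from \<open>Re z = 0\<close>.\<close>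

lemma C_omega_shift:
  assumes z: "z \<in> C_omega l" and r: "Re z \<noteq> 0"
  shows "z + of_real (w * of_int j) \<in> C_omega l"
  unfolding C_omega_def
proof (intro CollectI allI impI notI)
  fix n :: int assume n: "n \<noteq> 0" and eq: "2 * Re (z + of_real (w * of_int j)) = freq l * of_int n"
  then have e: "2 * Re z = freq l * of_int (n - 2 * j)" by (simp add: w_def algebra_simps)
  then have "n - 2 * j \<noteq> 0" using r by auto
  then show False using z e unfolding C_omega_def by blast
qed

text \<open>On the imaginary axis all rates have nonnegative real part, so there are no unstable
  modes and the shift is never called for there.\<close>

lemma neg_Re_nonzero: "neg z \<rho> j \<Longrightarrow> z \<in> C_omega l \<Longrightarrow> Re z \<noteq> 0"
proof
  assume n: "neg z \<rho> j" and z: "z \<in> C_omega l" and "Re z = 0"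
  then have "0 \<le> Re (a z j)" by (simp add: Re_a)
  moreover have "Re (a z j) \<noteq> 0" using nonresonant[OF z] n not_neg_0 by metis
  ultimately show False using n by (simp add: neg_def)
qed

text \<open>The auxiliary solutions demanded by \<open>sol_unique\<close> are members of the family
  itself, at the shifted parameters.\<close>

lemma \<mu>_unique:
  assumes z: "z \<in> C_omega l" and N: "sol z \<rho> B N" and \<rho>: "\<rho> \<noteq> 0"
  shows "\<mu> x y z = N x y"
proof -
  obtain C where C: "\<And>x y. norm (\<mu> x y z) \<le> C" using \<mu>_bounded[OF z] by blast
  show ?thesis
  proof (rule sol_unique[OF \<rho> \<mu>_sol[OF z C] N])
    fix j assume "neg z \<rho> j"
    then have z': "z + of_real (w * of_int j) \<in> C_omega l" (is "?z \<in> _")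
      by (intro C_omega_shift z neg_Re_nonzero[OF _ z])
    obtain C' where "\<And>x y. norm (\<mu> x y ?z) \<le> C'" using \<mu>_bounded[OF z'] by blast
    then have "sol ?z \<rho> C' (\<lambda>x y. \<mu> x y ?z)" by (rule \<mu>_sol[OF z'])
    then show "\<exists>B N. sol ?z \<rho> B N" by (intro exI)
  qed
qed

text \<open>The parameters obeying the essential bound are dense. A limit of solutions along them is
  a solution at \<open>z\<close> with the same bound, and by uniqueness it is \<mu>.\<close>

lemma \<mu>_uniform_bound: "\<exists>B>0. \<forall>z\<in>C_omega l. \<forall>x y. norm (\<mu> x y z) \<le> B"
proof -
  obtain B0 where "AE (x, y, z) in lebesgue_on (E_dom l). norm (\<mu> x y z) \<le> B0"
    using solution unfolding is_solution_def in_Linfty_E_def by blast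
  then have ae: "AE z in lborel. z \<in> C_omega l \<longrightarrow> (\<forall>x y. norm (\<mu> x y z) \<le> B0)"
    by (rule ae_bound) (auto intro: \<mu>_cont \<mu>_per)
  define B where "B = \<bar>B0\<bar> + 1"
  have B: "0 < B" "B0 \<le> B" by (auto simp: B_def)
  have "norm (\<mu> x y z) \<le> B" if z: "z \<in> C_omega l" for x y z
  proof -
    have "\<exists>z'. dist z' z < 1 / real (Suc n) \<and> z' \<in> C_omega l \<and> (\<forall>x y. norm (\<mu> x y z') \<le> B0)" for n
    proof -
      have "\<exists>z'\<in>ball z (1 / real (Suc n)) \<inter> C_omega l. z' \<in> C_omega l \<longrightarrow> (\<forall>x y. norm (\<mu> x y z') \<le> B0)"
      proof (rule AE_lborel_dense[OF ae])
        show "open (ball z (1 / real (Suc n)) \<inter> C_omega l)" by (intro open_Int open_ball open_C_omega)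
        have "z \<in> ball z (1 / real (Suc n)) \<inter> C_omega l" using z by simp
        then show "ball z (1 / real (Suc n)) \<inter> C_omega l \<noteq> {}" by blast
      qed
      then show ?thesis by (auto simp: dist_commute)
    qed
    then obtain zn where zn: "\<And>n. dist (zn n) z < 1 / real (Suc n)" "\<And>n. zn n \<in> C_omega l" "\<And>n x y. norm (\<mu> x y (zn n)) \<le> B0"
      by metis
    have "(\<lambda>n. dist (zn n) z) \<longlonglongrightarrow> 0"
    proof (rule tendsto_sandwich[OF _ _ tendsto_const LIMSEQ_inverse_real_of_nat])
      show "\<forall>\<^sub>F n in sequentially. dist (zn n) z \<le> inverse (real (Suc n))"
        unfolding inverse_eq_divide by (intro always_eventually allI less_imp_le[OF zn(1)])
    qed simp
    then have lim: "zn \<longlonglongrightarrow> z" unfolding tendsto_dist_iff[of zn] .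
    have S: "sol (zn n) 1 B (\<lambda>x y. \<mu> x y (zn n))" for n
      by (rule \<mu>_sol[OF zn(2)]) (rule order.trans[OF zn(3) B(2)])
    \<comment> \<open>Vacuous: \<open>z\<close> itself is not resonant, so there is no mode whose
      sign depends on the side.\<close>
    have side: "0 < 1 * (Re (zn n) - Re z)" if "m \<noteq> 0" "Re (a z m) = 0" for m n
      using nonresonant[OF z] that by blast
    have "\<exists>N. sol z 1 B N"
    proof (rule sol_compact[OF S lim B(1)])
      fix m
      show "\<forall>\<^sub>F n in sequentially. pos (zn n) 1 m" if "pos z 1 m"
        by (rule signs_eventually(1)[OF lim _ that]) (rule side)
      show "\<forall>\<^sub>F n in sequentially. neg (zn n) 1 m" if "neg z 1 m"
        by (rule signs_eventually(2)[OF lim _ that]) (rule side)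
    next
      fix N assume "sol z 1 B N"
      then show "\<exists>N. sol z 1 B N" by (rule exI[where x = N])
    qed
    then obtain N where N: "sol z 1 B N" by (rule exE)
    show ?thesis unfolding \<mu>_unique[OF z N one_neq_zero] by (rule solD(3)[OF N])
  qed
  then show ?thesis using B(1) by blast
qed

lemma ex_sol_limit:
  assumes f: "\<And>n. f n \<in> C_omega l" "\<And>n. 0 < \<rho> * (Re (f n) - Re z0)" "f \<longlonglongrightarrow> z0"
    and B: "0 < B" "\<forall>z\<in>C_omega l. \<forall>x y. norm (\<mu> x y z) \<le> B"
  obtains r N where "strict_mono (r :: nat \<Rightarrow> nat)" "sol z0 \<rho> B N" "\<And>x y. (\<lambda>n. \<mu> x y (f (r n))) \<longlonglongrightarrow> N x y"
proof -
  have S: "sol (f n) \<rho> B (\<lambda>x y. \<mu> x y (f n))" for n by (rule \<mu>_sol[OF f(1)]) (use B(2) f(1) in blast)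
  show thesis
  proof (rule sol_compact[OF S f(3) B(1)])
    fix m
    show "\<forall>\<^sub>F n in sequentially. pos (f n) \<rho> m" if "pos z0 \<rho> m" by (rule signs_eventually(1)[OF f(3) f(2) that])
    show "\<forall>\<^sub>F n in sequentially. neg (f n) \<rho> m" if "neg z0 \<rho> m" by (rule signs_eventually(2)[OF f(3) f(2) that])
  qed (rule that)
qed

text \<open>The limit is taken over the full half-plane, which contains every sector. One
  subsequence produces a solution \<open>M\<close> on the line, and each further subsequential limit
  is a solution for the same \<rho>, hence equals \<open>M\<close>.\<close>

theorem one_sided_limit:
  assumes z0: "Re z0 \<noteq> 0" and \<rho>: "\<rho> \<noteq> 0"
  shows "\<exists>L. ((\<lambda>z. \<mu> x y z) \<longlongrightarrow> L) (at z0 within {z \<in> C_omega l. 0 < \<rho> * (Re z - Re z0)})"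
proof (cases "z0 islimpt {z \<in> C_omega l. 0 < \<rho> * (Re z - Re z0)}")
  case False
  then have "at z0 within {z \<in> C_omega l. 0 < \<rho> * (Re z - Re z0)} = bot" by (simp add: trivial_limit_within[symmetric] trivial_limit_def)
  then show ?thesis by simp
next
  case True
  obtain B where B: "0 < B" "\<forall>z\<in>C_omega l. \<forall>x y. norm (\<mu> x y z) \<le> B" using \<mu>_uniform_bound by blast
  obtain f0 where f0: "\<And>n::nat. f0 n \<in> {z \<in> C_omega l. 0 < \<rho> * (Re z - Re z0)} - {z0}" "f0 \<longlonglongrightarrow> z0"
    using True unfolding islimpt_sequential by blast
  have "(\<lambda>n. Re (f0 n)) \<longlonglongrightarrow> Re z0" by (intro tendsto_intros f0)
  then have "\<forall>\<^sub>F n in sequentially. Re (f0 n) \<noteq> 0" using z0 by (rule tendsto_imp_eventually_ne)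
  \<comment> \<open>An initial segment is dropped to keep the sequence off the imaginary axis, where
    shifted parameters could be resonant.\<close>
  then obtain k where k: "\<And>n. k \<le> n \<Longrightarrow> Re (f0 n) \<noteq> 0" unfolding eventually_sequentially by blast
  define f where "f n = f0 (n + k)" for n
  have f: "f n \<in> C_omega l" "0 < \<rho> * (Re (f n) - Re z0)" "Re (f n) \<noteq> 0" for n
    using f0(1)[of "n + k"] k[of "n + k"] by (auto simp: f_def)
  have flim: "f \<longlonglongrightarrow> z0" unfolding f_def by (rule LIMSEQ_ignore_initial_segment[OF f0(2)])
  have shifted: "\<exists>B N. sol (z0 + of_real (w * of_int j)) \<rho> B N" for j
  proof -
    let ?f = "\<lambda>n. f n + of_real (w * of_int j)"
    have 1: "?f n \<in> C_omega l" for n by (rule C_omega_shift[OF f(1,3)])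
    have 2: "0 < \<rho> * (Re (?f n) - Re (z0 + of_real (w * of_int j)))" for n using f(2)[of n] by simp
    have 3: "?f \<longlonglongrightarrow> z0 + of_real (w * of_int j)" by (intro tendsto_intros flim)
    show ?thesis by (rule ex_sol_limit[OF 1 2 3 B]) (intro exI)
  qed
  have "\<exists>M. sol z0 \<rho> B M" by (rule ex_sol_limit[OF f(1,2) flim B]) (intro exI)
  then obtain M where M: "sol z0 \<rho> B M" ..
  have "((\<lambda>z. \<mu> x y z) \<longlongrightarrow> M x y) (at z0 within {z \<in> C_omega l. 0 < \<rho> * (Re z - Re z0)})"
    unfolding tendsto_at_iff_sequentially comp_def
  proof (intro allI impI)
    fix Z assume Z: "\<forall>i. Z i \<in> {z \<in> C_omega l. 0 < \<rho> * (Re z - Re z0)} - {z0}" and Zlim: "Z \<longlonglongrightarrow> z0"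
    show "(\<lambda>n. \<mu> x y (Z n)) \<longlonglongrightarrow> M x y"
    proof (rule LIMSEQ_subseqI)
      fix s :: "nat \<Rightarrow> nat" assume s: "strict_mono s"
      have 1: "Z (s n) \<in> C_omega l" and 2: "0 < \<rho> * (Re (Z (s n)) - Re z0)" for n using Z by auto
      have 3: "(\<lambda>n. Z (s n)) \<longlonglongrightarrow> z0" using LIMSEQ_subseq_LIMSEQ[OF Zlim s] by (simp add: comp_def)
      obtain r :: "nat \<Rightarrow> nat" and N where r: "strict_mono r" "sol z0 \<rho> B N" "\<And>x y. (\<lambda>n. \<mu> x y (Z (s (r n)))) \<longlonglongrightarrow> N x y"
        by (rule ex_sol_limit[OF 1 2 3 B]) (rule that)
      have "N x y = M x y" by (rule sol_unique[OF \<rho> r(2) M shifted])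
      then show "\<exists>r. strict_mono r \<and> (\<lambda>n. \<mu> x y (Z (s (r n)))) \<longlonglongrightarrow> M x y" using r(1) r(3)[of x y] by auto
    qed
  qed
  then show ?thesis ..
qed

theorem vertical_limit:
  assumes x0: "Complex x0 0 \<in> C_omega l"
  shows "((\<lambda>b. \<mu> x y (Complex x0 b)) \<longlongrightarrow> 1) at_infinity"
proof (rule ccontr)
  obtain B where B: "0 < B" "\<forall>z\<in>C_omega l. \<forall>x y. norm (\<mu> x y z) \<le> B" using \<mu>_uniform_bound by blast
  have C: "Complex x0 b \<in> C_omega l" for b using x0 by (simp add: C_omega_def)
  assume "\<not> ?thesis"
  then obtain e where e: "0 < e" "\<not> (\<forall>\<^sub>F b in at_infinity. dist (\<mu> x y (Complex x0 b)) 1 < e)"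
    unfolding tendsto_iff by auto
  then have "\<exists>b. real n \<le> \<bar>b\<bar> \<and> \<not> dist (\<mu> x y (Complex x0 b)) 1 < e" for n
    unfolding eventually_at_infinity by (metis real_norm_def)
  \<comment> \<open>Failure of the limit gives a sequence escaping to infinity that stays away from
    1; a subsequence contradicts this.\<close>
  then obtain b where b: "\<And>n. real n \<le> \<bar>b n\<bar>" "\<And>n. \<not> dist (\<mu> x y (Complex x0 (b n))) 1 < e" by metis
  have top: "filterlim (\<lambda>n. \<bar>b n\<bar>) at_top sequentially"
    by (rule filterlim_at_top_mono[OF filterlim_real_sequentially]) (use b(1) in auto)
  have S: "sol (Complex x0 (b n)) 1 B (\<lambda>x y. \<mu> x y (Complex x0 (b n)))" for n
    by (rule \<mu>_sol[OF C]) (use B(2) C in blast)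
  obtain r :: "nat \<Rightarrow> nat" where r: "strict_mono r" "\<And>x y. (\<lambda>n. \<mu> x y (Complex x0 (b (r n)))) \<longlonglongrightarrow> 1"
    using vertical_limit_subsequence[OF S B(1) top nonresonant[OF x0]] by blast
  have "\<forall>\<^sub>F n in sequentially. dist (\<mu> x y (Complex x0 (b (r n)))) 1 < e" by (rule tendstoD[OF r(2) e(1)])
  then show False using b(2) by simp
qed

end

section \<open>A Borel representative of the potential and the conclusion\<close>

lemma measurable_completion_AE:
  assumes f: "f \<in> borel_measurable M" and ae: "AE x in M. f x = g x"
  shows "g \<in> borel_measurable (completion M)"
proof (rule measurableI)
  fix A :: "'b set" assume A: "A \<in> sets borel"
  have f': "f -` A \<inter> space M \<in> sets (completion M)"
    using measurable_sets[OF measurable_completion[OF f] A] by simp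
  have n1: "{x \<in> space M. f x \<noteq> g x} \<in> sets (completion M)"
    using sets_completion_AE[where M = M and P = "\<lambda>x. f x \<noteq> g x"] ae by (simp add: pred_def)
  have "AE x in M. \<not> (f x \<noteq> g x \<and> g x \<in> A)" using ae by eventually_elim simp
  then have n2: "{x \<in> space M. f x \<noteq> g x \<and> g x \<in> A} \<in> sets (completion M)"
    using sets_completion_AE[where M = M and P = "\<lambda>x. f x \<noteq> g x \<and> g x \<in> A"] by (simp add: pred_def)
  have "g -` A \<inter> space (completion M) = (f -` A \<inter> space M - {x \<in> space M. f x \<noteq> g x}) \<union> {x \<in> space M. f x \<noteq> g x \<and> g x \<in> A}"
    by auto
  also have "\<dots> \<in> sets (completion M)" using f' n1 n2 by auto
  finally show "g -` A \<inter> space (completion M) \<in> sets (completion M)" .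
qed auto

context period begin

lemma ex_borel_representative:
  fixes f :: "real \<times> real \<Rightarrow> complex"
  assumes f: "f \<in> borel_measurable (lebesgue_on (Omega l))"
  obtains F where "F \<in> borel_measurable borel" "AE p in lebesgue_on (Omega l). f p = F p"
proof -
  let ?h = "\<lambda>p. indicator (Omega l) p *\<^sub>R f p"
  have h: "?h \<in> borel_measurable lebesgue"
    using f by (subst (asm) borel_measurable_restrict_space_iff) auto
  then have "(\<lambda>p. Re (?h p)) \<in> borel_measurable lebesgue" "(\<lambda>p. Im (?h p)) \<in> borel_measurable lebesgue"
    by (simp_all only: borel_measurable_complex_iff)
  note this[THEN completion_ex_borel_measurable_real]
  then obtain r i where ri: "r \<in> borel_measurable lborel" "AE p in lborel. Re (?h p) = r p"
      "i \<in> borel_measurable lborel" "AE p in lborel. Im (?h p) = i p"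
    by (elim bexE)
  define F where "F p = of_real (r p) + \<i> * of_real (i p)" for p
  have rb: "r \<in> borel_measurable borel" "i \<in> borel_measurable borel" using ri by simp_all
  show ?thesis
  proof
    show "F \<in> borel_measurable borel" unfolding F_def using rb by measurable
    have "AE p in lborel. ?h p = F p" using ri(2,4)
      by eventually_elim (simp add: complex_eq_iff F_def)
    then have "AE p in lebesgue. p \<in> Omega l \<longrightarrow> f p = F p"
      unfolding AE_completion_iff by eventually_elim auto
    then show "AE p in lebesgue_on (Omega l). f p = F p"
      by (subst AE_restrict_space_iff) auto
  qed
qed

lemma integrable_representative:
  fixes F :: "real \<times> real \<Rightarrow> complex"
  assumes u: "integrable (lebesgue_on (Omega l)) h"
    and F: "g \<in> borel_measurable borel" and ae: "AE p in lebesgue_on (Omega l). h p = g p"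
  shows "integrable (X \<Otimes>\<^sub>M lborel) (g :: _ \<Rightarrow> real)"
proof -
  have "integrable (lebesgue_on (Omega l)) g"
    by (rule integrable_cong_AE_imp[OF u measurable_lebesgue_on_borel[OF F]]) (use ae in eventually_elim, simp)
  then have "integrable (lebesgue_on (Omega l)) (\<lambda>p. complex_of_real (g p))" by (rule integrable_of_real)
  then have "integrable (X \<Otimes>\<^sub>M lborel) (\<lambda>p. complex_of_real (g p))"
    using F by (subst (asm) Omega_integral(2)) auto
  then show ?thesis by (simp only: complex_of_real_integrable_eq)
qed

text \<open>A Borel representative inherits integrability and zero mean only for almost every
  \<open>t\<close>. Setting it to 0 for the exceptional \<open>t\<close> makes all conditions hold
  everywhere and alters it on a null set only.\<close>

lemma ex_potential:
  fixes u :: "real \<Rightarrow> real \<Rightarrow> complex"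
  assumes u1: "in_Lp l 1 u" and u2: "in_Lp l 2 u"
    and u0: "\<forall>y. (LINT x|lebesgue_on {-l..l}. u x y) = 0"
  obtains U where "potential l U"
    "AE p in lebesgue_on (Omega l). (case p of (x, y) \<Rightarrow> u x y) = (case p of (x, y) \<Rightarrow> U x y)"
    "integrable (X \<Otimes>\<^sub>M lborel) (case_prod U)"
proof -
  let ?u = "\<lambda>p. case p of (x, y) \<Rightarrow> u x y"
  have um: "?u \<in> borel_measurable (lebesgue_on (Omega l))" using u1 by (simp add: in_Lp_def)
  obtain F where F: "F \<in> borel_measurable borel" and uF: "AE p in lebesgue_on (Omega l). ?u p = F p"
    using ex_borel_representative[OF um] .
  have F' [measurable]: "F \<in> borel_measurable (borel \<Otimes>\<^sub>M borel)" using F by (simp only: borel_prod)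
  have FX: "F \<in> borel_measurable (X \<Otimes>\<^sub>M lborel)" by measurable
  have i1: "integrable (X \<Otimes>\<^sub>M lborel) (\<lambda>p. norm (F p))"
  proof (rule integrable_representative)
    show "integrable (lebesgue_on (Omega l)) (\<lambda>(x, y). norm (u x y) powr 1)" using u1 by (simp add: in_Lp_def)
    show "AE p in lebesgue_on (Omega l). (case p of (x, y) \<Rightarrow> norm (u x y) powr 1) = norm (F p)"
      using uF by eventually_elim (auto split: prod.splits)
    show "(\<lambda>p. norm (F p)) \<in> borel_measurable borel" using F by simp
  qed
  have i2: "integrable (X \<Otimes>\<^sub>M lborel) (\<lambda>p. (norm (F p))\<^sup>2)"
  proof (rule integrable_representative)
    show "integrable (lebesgue_on (Omega l)) (\<lambda>(x, y). norm (u x y) powr 2)" using u2 by (simp add: in_Lp_def)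
    show "AE p in lebesgue_on (Omega l). (case p of (x, y) \<Rightarrow> norm (u x y) powr 2) = (norm (F p))\<^sup>2"
      using uF by eventually_elim (auto split: prod.splits simp: powr_numeral)
    show "(\<lambda>p. (norm (F p))\<^sup>2) \<in> borel_measurable borel" using F by measurable
  qed
  have iF: "integrable (X \<Otimes>\<^sub>M lborel) F" using i1 FX by (simp only: integrable_norm_iff)
  have s1: "AE t in lborel. integrable X (\<lambda>x. F (x, t))"
    by (rule XY.AE_integrable_snd) (simp add: iF)
  have s2: "AE t in lborel. integrable X (\<lambda>x. (norm (F (x, t)))\<^sup>2)"
    by (rule XY.AE_integrable_snd) (simp add: i2 case_prod_unfold)
  have j1: "integrable lborel (\<lambda>t. LINT x|X. norm (F (x, t)))"
    by (rule XY.integrable_snd) (simp add: i1 case_prod_unfold)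
  have j2: "integrable lborel (\<lambda>t. LINT x|X. (norm (F (x, t)))\<^sup>2)"
    by (rule XY.integrable_snd) (simp add: i2 case_prod_unfold)
  \<comment> \<open>Agreement almost everywhere on the strip is sliced in the direction of
    \<open>t\<close>; the exchange of quantifiers is justified by a measurable null set
    \<open>N\<close>.\<close>
  have s0: "AE t in lborel. AE x in X. u x t = F (x, t)"
  proof -
    obtain N where N: "{p \<in> space (X \<Otimes>\<^sub>M lborel). \<not> ?u p = F p} \<subseteq> N" "emeasure (X \<Otimes>\<^sub>M lborel) N = 0" "N \<in> sets (X \<Otimes>\<^sub>M lborel)"
      using AE_Omega[OF uF] by (rule AE_E)
    have "AE p in X \<Otimes>\<^sub>M lborel. p \<notin> N" by (rule AE_not_in) (use N in \<open>auto simp: null_sets_def\<close>)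
    then have "AE x in X. AE t in lborel. (x, t) \<notin> N" by (rule XY.AE_pair)
    moreover have "{p \<in> space (X \<Otimes>\<^sub>M lborel). (fst p, snd p) \<notin> N} \<in> sets (X \<Otimes>\<^sub>M lborel)"
      using sets.compl_sets[OF N(3)] by (simp add: set_diff_eq)
    ultimately have "AE t in lborel. AE x in X. (x, t) \<notin> N" using XY.AE_commute[of "\<lambda>x t. (x, t) \<notin> N"] by simp
    then show ?thesis
    proof eventually_elim
      case (elim t)
      have "u x t = F (x, t)" if "(x, t) \<notin> N" for x
        using subsetD[OF N(1), of "(x, t)"] that by (auto simp: space_pair_measure)
      with elim show ?case by (auto elim!: eventually_mono)
    qed
  qed
  \<comment> \<open>The zero mean is given for \<open>u\<close>, whose slices are a priori not
    Borel; comparison takes place in the completed measure.\<close>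
  have mean: "(LINT x|X. F (x, t)) = 0" if "AE x in X. u x t = F (x, t)" for t
  proof -
    have Ft: "(\<lambda>x. F (x, t)) \<in> borel_measurable borel" by measurable
    let ?f = "\<lambda>x. indicator {-l..l} x *\<^sub>R F (x, t)" and ?g = "\<lambda>x. indicator {-l..l} x *\<^sub>R u x t"
    have fm: "?f \<in> borel_measurable lborel" using Ft by simp
    have "AE x in lborel. x \<in> {-l..l} \<longrightarrow> u x t = F (x, t)"
      using that l_pos unfolding X_def by (subst (asm) AE_density) (auto simp: indicator_def elim!: eventually_mono)
    then have ae: "AE x in lborel. ?f x = ?g x" by eventually_elim (auto simp: indicator_def)
    \<comment> \<open>In a complete measure a function agreeing almost everywhere with a measurable
      one is measurable; this transfers the integral from \<open>F\<close> to
      \<open>u\<close>.\<close>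
    have gm: "?g \<in> borel_measurable lebesgue" by (rule measurable_completion_AE[OF fm ae])
    have "integral\<^sup>L lborel ?f = integral\<^sup>L lebesgue ?f" by (rule integral_completion[OF fm, symmetric])
    also have "\<dots> = integral\<^sup>L lebesgue ?g"
      by (rule integral_cong_AE[OF measurable_completion[OF fm] gm AE_completion[OF ae]])
    also have "\<dots> = (LINT x|lebesgue_on {-l..l}. u x t)" by (rule integral_restrict_space[symmetric]) simp
    finally show ?thesis using u0 by (simp add: integral_X[OF Ft])
  qed
  have "AE t in lborel. integrable X (\<lambda>x. F (x, t)) \<and> integrable X (\<lambda>x. (norm (F (x, t)))\<^sup>2) \<and> (LINT x|X. F (x, t)) = 0"
    using s0 s1 s2 by eventually_elim (use mean in blast)
  then obtain N where N: "{t \<in> space lborel. \<not> (integrable X (\<lambda>x. F (x, t)) \<and> integrable X (\<lambda>x. (norm (F (x, t)))\<^sup>2) \<and> (LINT x|X. F (x, t)) = 0)} \<subseteq> N"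
      "emeasure lborel N = 0" "N \<in> sets lborel"
    by (rule AE_E)
  have Nb [measurable]: "N \<in> sets borel" using N(3) by simp
  define U where "U x t = indicator (- N) t *\<^sub>R F (x, t)" for x t
  have good: "integrable X (\<lambda>x. F (x, t))" "integrable X (\<lambda>x. (norm (F (x, t)))\<^sup>2)" "(LINT x|X. F (x, t)) = 0" if "t \<notin> N" for t
    using N(1) that by auto
  have U1: "(\<lambda>x. norm (U x t)) = (\<lambda>x. indicator (- N) t *\<^sub>R norm (F (x, t)))"
    and U2: "(\<lambda>x. (norm (U x t))\<^sup>2) = (\<lambda>x. indicator (- N) t *\<^sub>R (norm (F (x, t)))\<^sup>2)" for t
    by (auto simp: U_def indicator_def)
  have UF: "case_prod U = (\<lambda>p. indicator (UNIV \<times> - N) p *\<^sub>R F p)" by (auto simp: U_def indicator_def)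
  have NN: "UNIV \<times> - N \<in> sets (X \<Otimes>\<^sub>M lborel)" by (intro pair_measureI) auto
  show thesis
  proof (rule that)
    show "integrable (X \<Otimes>\<^sub>M lborel) (case_prod U)" unfolding UF by (rule integrable_mult_indicator[OF NN iF])
    have "AE p in (lborel :: real measure) \<Otimes>\<^sub>M (lborel :: real measure). snd p \<notin> N"
    proof (rule lborel_pair.AE_pair_measure)
      show "{p \<in> space (lborel \<Otimes>\<^sub>M lborel). snd p \<notin> N} \<in> sets ((lborel :: real measure) \<Otimes>\<^sub>M (lborel :: real measure))" by measurable
      show "AE x in (lborel :: real measure). AE y in lborel. snd (x, y) \<notin> N"
        unfolding snd_conv by (intro AE_I2 AE_not_in) (use N in \<open>auto simp: null_sets_def\<close>)
    qed
    then have "AE p in lebesgue. p \<in> Omega l \<longrightarrow> snd p \<notin> N"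
      unfolding lborel_prod AE_completion_iff by eventually_elim simp
    then have "AE p in lebesgue_on (Omega l). snd p \<notin> N" by (subst AE_restrict_space_iff) auto
    then show "AE p in lebesgue_on (Omega l). (case p of (x, y) \<Rightarrow> u x y) = (case p of (x, y) \<Rightarrow> U x y)"
      using uF by eventually_elim (auto simp: U_def)
    show "potential l U"
    proof
      show "case_prod U \<in> borel_measurable (borel \<Otimes>\<^sub>M borel)" unfolding UF by measurable
      show "integrable X (\<lambda>x. U x t)" for t using good[of t] by (cases "t \<in> N") (auto simp: U_def)
      show "integrable X (\<lambda>x. (norm (U x t))\<^sup>2)" for t using good[of t] by (cases "t \<in> N") (auto simp: U_def)
      show "(LINT x|X. U x t) = 0" for t using good[of t] by (cases "t \<in> N") (auto simp: U_def)
      show "integrable lborel (\<lambda>t. LINT x|X. norm (U x t))"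
        unfolding U1 integral_scaleR_right by (rule integrable_mult_indicator[OF _ j1]) simp
      show "integrable lborel (\<lambda>t. LINT x|X. (norm (U x t))\<^sup>2)"
        unfolding U2 integral_scaleR_right by (rule integrable_mult_indicator[OF _ j2]) simp
    qed
  qed
qed

end

theorem theorem2p7:
  fixes l :: real
    and u ux uy :: "real \<Rightarrow> real \<Rightarrow> complex"
    and \<mu> :: "real \<Rightarrow> real \<Rightarrow> complex \<Rightarrow> complex"
  assumes "0 < l"
    and "x_periodic l u"
    and "in_Lp l 1 u" and "in_Lp l 2 u"
    and "\<forall>y. (LINT x|lebesgue_on {-l..l}. u x y) = 0"
    and "max (freq l * Lp_norm l 1 u) (sqrt (freq l) * Lp_norm l 2 u) < 2 * pi / C_const (freq l)"
    and "is_solution l u \<mu>"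
    and "in_Lp l 1 (\<lambda>x y. of_real y * u x y)"
    and "weak_dx l u ux" and "in_Lp l 1 ux" and "in_Lp l 2 ux"
    and "weak_dy l u uy" and "in_Lp l 1 uy" and "in_Lp l 2 uy"
  shows "(\<forall>(x, y) \<in> Omega l. \<forall>n::int. n \<noteq> 0 \<longrightarrow>
            (\<forall>z0. Re z0 = freq l / 2 * of_int n \<longrightarrow>
               (\<exists>L. has_right_limit l (\<lambda>z. \<mu> x y z) z0 L) \<and>
               (\<exists>L. has_left_limit l (\<lambda>z. \<mu> x y z) z0 L))) \<and>
         (\<forall>(x, y) \<in> Omega l. \<forall>a. Complex a 0 \<in> C_omega l \<longrightarrow>
            ((\<lambda>b. \<mu> x y (Complex a b)) \<longlongrightarrow> 1) at_infinity)"
proof -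
  interpret period l using assms(1) by unfold_locales
  obtain U where U: "potential l U"
    "AE p in lebesgue_on (Omega l). (case p of (x, y) \<Rightarrow> u x y) = (case p of (x, y) \<Rightarrow> U x y)"
    "integrable (X \<Otimes>\<^sub>M lborel) (case_prod U)"
    using ex_potential[OF assms(3-5)] .
  have um: "(\<lambda>(x, y). u x y) \<in> borel_measurable (lebesgue_on (Omega l))" using assms(3) by (simp add: in_Lp_def)
  interpret S: solution_family l U u \<mu>
    by (intro solution_family.intro solution_family_axioms.intro U um assms(7))
  have right: "\<exists>L. has_right_limit l (\<lambda>z. \<mu> x y z) z0 L" if r: "Re z0 \<noteq> 0" for x y z0
  proof -
    obtain L where L: "((\<lambda>z. \<mu> x y z) \<longlongrightarrow> L) (at z0 within {z \<in> C_omega l. 0 < 1 * (Re z - Re z0)})"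
      using S.one_sided_limit[OF r one_neq_zero] by blast
    have "has_right_limit l (\<lambda>z. \<mu> x y z) z0 L"
      unfolding has_right_limit_def by (intro allI impI tendsto_within_subset[OF L]) auto
    then show ?thesis ..
  qed
  have left: "\<exists>L. has_left_limit l (\<lambda>z. \<mu> x y z) z0 L" if r: "Re z0 \<noteq> 0" for x y z0
  proof -
    \<comment> \<open>Approach from the left is \<rho> = -1; every sector lies in the corresponding
      half-plane.\<close>
    obtain L where L: "((\<lambda>z. \<mu> x y z) \<longlongrightarrow> L) (at z0 within {z \<in> C_omega l. 0 < - 1 * (Re z - Re z0)})"
      using S.one_sided_limit[OF r, of "- 1"] by (metis neg_equal_0_iff_equal one_neq_zero)
    have "has_left_limit l (\<lambda>z. \<mu> x y z) z0 L"
      unfolding has_left_limit_def by (intro allI impI tendsto_within_subset[OF L]) auto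
    then show ?thesis ..
  qed
  \<comment> \<open>Here \<open>n \<noteq> 0\<close> enters: the line \<open>n = 0\<close> would be
    the imaginary axis, which is excluded from \<open>one_sided_limit\<close>.\<close>
  have "Re z0 \<noteq> 0" if "n \<noteq> 0" "Re z0 = freq l / 2 * of_int n" for z0 and n :: int
    unfolding that(2) w_def[symmetric] using that(1) w_pos by simp
  then show ?thesis using right left S.vertical_limit by blast
qed

end
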